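(* Let $I\subset\mathbb{R}$ be an open interval and let $\phi:\mathbb{R}^3\times I\to\mathbb{R}$ and $u:\mathbb{R}^3\times I\to\mathbb{R}^3$ be smooth with $\phi_t+u\cdot\nabla\phi=0$. Assume that for every $t\in I$ the set $\{\phi(\cdot,t)=0\}$ is a closed surface contained in a compact set independent of $t$, that $|\nabla\phi(\cdot,t)|>0$ in a neighbourhood of $\{\phi(\cdot,t)=0\}$, and that the topology of $\{\phi(\cdot,t)=0\}$ does not change with $t$. Let $n=\nabla\phi/|\nabla\phi|$, $H=\operatorname{div}(n)$ and $G=\operatorname{Tr}(\operatorname{Cof}([\nabla n]))$. Let $F:\mathbb{R}\times\mathbb{R}\to\mathbb{R}$ be smooth, let $F_H$, $F_G$ denote its partial derivatives with respect to its first and second variable, evaluated at $(H,G)$, and set $$J^{H,G}(\phi)(t)=\int_{\{\phi(\cdot,t)=0\}}F(H,G)\,d\sigma .$$ Let $t_0\in I$ be such that $\phi(\cdot,t_0)$ is a distance function, i.e. $|\nabla\phi(\cdot,t_0)|=1$ in a neighbourhood of $\{\phi(\cdot,t_0)=0\}$. Then at $t=t_0$ $$\frac{d}{dt}J^{H,G}(\phi)=\int_{\{\phi=0\}}\Big(F(H,G)H-F_H(H^2-2G)-\Delta_{\partial\Omega}F_H\Big)u\cdot n\,d\sigma+\int_{\{\phi=0\}}\Big(-F_G\,GH-H\Delta_{\partial\Omega}F_G+[\nabla_{\partial\Omega}n]:\nabla_{\partial\Omega}(\nabla_{\partial\Omega}F_G)\Big)u\cdot n\,d\sigma .$$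
   Context: $\nabla$, $\operatorname{div}$ are taken with respect to the space variable $x$; $d\sigma$ is surface measure. For a vector field $v$, $[\nabla v]_{ij}=\partial_j v_i$. For $3\times3$ matrices, $\operatorname{Tr}(\operatorname{Cof}(M))=\frac12(\operatorname{Tr}(M)^2-\operatorname{Tr}(M^2))$ and $M:N=\sum_{i,j}M_{ij}N_{ij}$. On the surface $H=\kappa_1+\kappa_2$ (mean curvature, without factor $1/2$) and $G=\kappa_1\kappa_2$ (Gaussian curvature), where $\kappa_1,\kappa_2$ are the principal curvatures, i.e. the eigenvalues of $dn$ on the tangent plane. Tangential operators: for a function $g$, $\nabla_{\partial\Omega}g=\nabla g-(\nabla g\cdot n)n$; for a vector field $v$, $[\nabla_{\partial\Omega}v]=[\nabla v](I-n\otimes n)$ with $[n\otimes n]_{ij}=n_in_j$, and $\operatorname{div}_{\partial\Omega}(v)=\operatorname{Tr}([\nabla_{\partial\Omega}v])$; $\Delta_{\partial\Omega}g=\operatorname{div}_{\partial\Omega}(\nabla_{\partial\Omega}g)$ (Laplace–Beltrami). *)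

theory Defs
  imports "HOL-Analysis.Analysis"
begin

subsection \<open>Smooth functions on open sets\<close>

primrec Ck_on :: "nat \<Rightarrow> 'a::real_normed_vector set \<Rightarrow> ('a \<Rightarrow> 'b::real_normed_vector) \<Rightarrow> bool" where
  "Ck_on 0 S f \<longleftrightarrow> continuous_on S f"
| "Ck_on (Suc k) S f \<longleftrightarrow> (\<forall>x\<in>S. f differentiable (at x)) \<and>
     (\<forall>v. Ck_on k S (\<lambda>x. frechet_derivative f (at x) v))"

(* Only meaningful for open S, since derivatives are taken in the full space. *)
definition smooth_on :: "'a::real_normed_vector set \<Rightarrow> ('a \<Rightarrow> 'b::real_normed_vector) \<Rightarrow> bool" where
  "smooth_on S f \<longleftrightarrow> (\<forall>k. Ck_on k S f)"


subsection \<open>Differential operators and cofactor matrix\<close>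

definition grad :: "(real^'n \<Rightarrow> real) \<Rightarrow> real^'n \<Rightarrow> real^'n" where
  "grad g x = (\<chi> i. frechet_derivative g (at x) (axis i 1))"

definition divergence :: "(real^'n \<Rightarrow> real^'n) \<Rightarrow> real^'n \<Rightarrow> real" where
  "divergence v x = trace (jacobian v (at x))"

lemma jacobian_nth:
  "jacobian v (at x) $ i $ j = frechet_derivative v (at x) (axis j 1) $ i"
  by (simp add: jacobian_def matrix_def)

(* The (i,j) entry is the signed minor: row i and column j are replaced by unit vectors. *)
definition cofactor_matrix :: "real^'n^'n \<Rightarrow> real^'n^'n" where
  "cofactor_matrix M = (\<chi> i j. det (\<chi> k l. if k = i \<and> l = j then 1
                                 else if k = i \<or> l = j then 0 else M $ k $ l))"

lemma trace_cofactor_matrix_3: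
  fixes M :: "real^3^3"
  shows "trace (cofactor_matrix M) = ((trace M)\<^sup>2 - trace (M ** M)) / 2"
  by (simp add: trace_def cofactor_matrix_def det_3 sum_3 matrix_matrix_mult_def
      power2_eq_square algebra_simps)


subsection \<open>Tangential operators for a surface with unit normal field n\<close>

definition tan_grad :: "(real^3 \<Rightarrow> real^3) \<Rightarrow> (real^3 \<Rightarrow> real) \<Rightarrow> real^3 \<Rightarrow> real^3" where
  "tan_grad n g x = grad g x - (grad g x \<bullet> n x) *\<^sub>R n x"

definition tan_jacobian :: "(real^3 \<Rightarrow> real^3) \<Rightarrow> (real^3 \<Rightarrow> real^3) \<Rightarrow> real^3 \<Rightarrow> real^3^3" where
  "tan_jacobian n v x = jacobian v (at x) ** (mat 1 - (\<chi> i j. n x $ i * n x $ j))"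

definition tan_div :: "(real^3 \<Rightarrow> real^3) \<Rightarrow> (real^3 \<Rightarrow> real^3) \<Rightarrow> real^3 \<Rightarrow> real" where
  "tan_div n v x = trace (tan_jacobian n v x)"

definition laplace_beltrami :: "(real^3 \<Rightarrow> real^3) \<Rightarrow> (real^3 \<Rightarrow> real) \<Rightarrow> real^3 \<Rightarrow> real" where
  "laplace_beltrami n g x = tan_div n (tan_grad n g) x"

(* The product M : N of two matrices is the inner product of the type real^3^3. *)
lemma matrix_inner_eq_sum:
  fixes M N :: "real^3^3"
  shows "M \<bullet> N = (\<Sum>i\<in>UNIV. \<Sum>j\<in>UNIV. M $ i $ j * N $ i $ j)"
  by (simp add: inner_vec_def)


subsection \<open>Surfaces in space and their surface measure\<close>

definition local_parametrization :: "(real^3) set \<Rightarrow> (real^2) set \<Rightarrow> (real^2 \<Rightarrow> real^3) \<Rightarrow> bool" where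
  "local_parametrization S U \<psi> \<longleftrightarrow>
     open U \<and> smooth_on U \<psi> \<and> (\<forall>y\<in>U. inj (frechet_derivative \<psi> (at y))) \<and>
     openin (top_of_set S) (\<psi> ` U) \<and> (\<exists>\<theta>. homeomorphism U (\<psi> ` U) \<psi> \<theta>)"

definition regular_surface :: "(real^3) set \<Rightarrow> bool" where
  "regular_surface S \<longleftrightarrow> (\<forall>p\<in>S. \<exists>U \<psi>. local_parametrization S U \<psi> \<and> p \<in> \<psi> ` U)"

(* Closed in the sense of surfaces: compact and without boundary. *)
definition closed_surface :: "(real^3) set \<Rightarrow> bool" where
  "closed_surface S \<longleftrightarrow> compact S \<and> regular_surface S"

definition area_element :: "(real^2 \<Rightarrow> real^3) \<Rightarrow> real^2 \<Rightarrow> real" where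
  "area_element \<psi> y = norm (cross3 (frechet_derivative \<psi> (at y) (axis 1 1))
                                  (frechet_derivative \<psi> (at y) (axis 2 1)))"

definition patch_measure :: "(real^2) set \<Rightarrow> (real^2 \<Rightarrow> real^3) \<Rightarrow> (real^3) measure" where
  "patch_measure U \<psi> =
     distr (density (restrict_space lborel U) (\<lambda>y. ennreal (area_element \<psi> y))) borel \<psi>"

(* By the change of variables formula, the patch measures of two local parametrizations
   coincide on the intersection of their images. Hence their supremum in the lattice of
   measures is the Borel measure that is concentrated on S (for compact S, say) and that
   agrees with patch_measure U \<psi> on the Borel subsets of every patch \<psi> ` U. *)
definition surface_measure :: "(real^3) set \<Rightarrow> (real^3) measure" where
  "surface_measure S =
     (SUP (U, \<psi>) \<in> {(U, \<psi>). local_parametrization S U \<psi>}. patch_measure U \<psi>)"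

lemma sets_patch_measure [simp]: "sets (patch_measure U \<psi>) = sets borel"
  by (simp add: patch_measure_def)

lemma local_parametrization_empty: "local_parametrization S {} \<psi>"
proof -
  have "Ck_on k {} g" for k and g :: "real^2 \<Rightarrow> real^3"
    by (induction k arbitrary: g) auto
  then show ?thesis
    by (auto simp: local_parametrization_def smooth_on_def homeomorphism_def)
qed

lemma sets_surface_measure [simp]: "sets (surface_measure S) = sets borel"
  unfolding surface_measure_def
  by (rule sets_SUP) (use local_parametrization_empty in auto)

lemma patch_measure_le_surface_measure:
  "local_parametrization S U \<psi> \<Longrightarrow> patch_measure U \<psi> \<le> surface_measure S"
  unfolding surface_measure_def by (rule SUP_upper2[of "(U, \<psi>)"]) auto

definition surface_integral :: "(real^3) set \<Rightarrow> (real^3 \<Rightarrow> real) \<Rightarrow> real" where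
  "surface_integral S f = set_lebesgue_integral (surface_measure S) S f"

end

theory Submission
  imports Defs
begin

text \<open>
  Locally the moving surfaces \<open>{\<phi>(\<cdot>, t) = 0}\<close> are graphs over a fixed box in the tangent plane, by the
  inverse function theorem applied to the map that replaces one coordinate by \<open>\<phi>\<close>. On a graph patch the
  supremum that defines the surface measure is the patch measure itself, because the projection to the
  tangent plane turns every other parametrization into a change of variables in the plane. A surface
  integral of a function supported in a patch thus becomes the integral of
  \<open>q |\<nabla>\<phi>| / \<partial>\<^sub>3\<phi>\<close> over the box. Two facts follow in coordinates and extend by a partition of unity:
  if \<open>|\<nabla>\<phi>| = 1\<close> near the surface, then \<open>\<integral> div Y d\<sigma> = 0\<close> for fields \<open>Y\<close> that are orthogonal to \<open>\<nabla>\<phi>\<close>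
  in a neighbourhood, and \<open>d/dt \<integral> q d\<sigma> = \<integral> (q\<^sub>t + v div (q n)) d\<sigma>\<close> with \<open>v = u \<cdot> n = - \<phi>\<^sub>t\<close>.

  With \<open>A = \<nabla>n\<close> and \<open>\<nabla>\<close>, \<open>\<Delta>\<close> tangential in the following formulas, the second fact is applied to
  \<open>q = F(H, G)\<close>. At \<open>t\<^sub>0\<close> one has \<open>n\<^sub>t = - \<nabla>v\<close>, hence \<open>H\<^sub>t = - \<Delta>v\<close> and
  \<open>G\<^sub>t = A : \<nabla>\<nabla>v - H \<Delta>v\<close>, while \<open>\<partial>\<^sub>n H = - (H\<^sup>2 - 2 G)\<close> and \<open>\<partial>\<^sub>n G = - G H\<close> follow from
  \<open>\<partial>\<^sub>n A = - A\<^sup>2\<close>. The Laplacian and the operator \<open>A : \<nabla>\<nabla> - H \<Delta>\<close>, whose coefficients are divergence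
  free by the Codazzi equations, are symmetric by the first fact, which moves all derivatives from \<open>v\<close>
  to \<open>F\<^sub>H\<close> and \<open>F\<^sub>G\<close>.
\<close>

subsection \<open>Calculus of functions of class C^k\<close>

text \<open>Two facts let all of the geometry be done with ambient partial derivatives. First, near
  the surface at time \<open>t0\<close> the normal is the gradient of \<Phi> and has length 1, so A
  is symmetric with A n = 0; hence the double normal term by which the ambient divergence of a
  tangential field differs from its surface divergence vanishes. Second, A - H I has ambient
  divergence zero, because third derivatives of \<Phi> commute. At other times \<Phi> need not be a
  distance function, so the curvatures are treated as functions on an open set of space-time, with a
  normalised gradient. The time derivative of |grad \<Phi>| at \<open>t0\<close> does not vanish in
  general, and it is what turns the full gradient of v into the tangential one. The box under a
  graph does not depend on time, so that an integral over a moving surface can be differentiated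
  under the integral sign. The price is that the points of a chart move along a fixed vector and not
  along the normal; the difference is the divergence of a tangential field.\<close>

lemma Ck_on_cong:
  assumes "open S" "\<And>x. x \<in> S \<Longrightarrow> f x = g x" "Ck_on k S f"
  shows "Ck_on k S g"
  using assms(2,3)
proof (induction k arbitrary: f g)
  case 0
  then show ?case by (metis Ck_on.simps(1) continuous_on_cong)
next
  case (Suc k)
  have fg: "f differentiable at x" "frechet_derivative f (at x) = frechet_derivative g (at x)"
    if "x \<in> S" for x
    using that Suc.prems \<open>open S\<close> frechet_derivative_transform_within_open[of f x S g] by auto
  have "g differentiable at x" if "x \<in> S" for x
    using fg(1)[OF that] Suc.prems(1) \<open>open S\<close> that
    by (meson differentiable_def has_derivative_transform_within_open)
  moreover have "Ck_on k S (\<lambda>x. frechet_derivative g (at x) v)" for v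
  proof (rule Suc.IH)
    show "Ck_on k S (\<lambda>x. frechet_derivative f (at x) v)"
      using Suc.prems by simp
  qed (use fg in auto)
  ultimately show ?case by simp
qed

text \<open>\<open>Ck_on\<close> refers to \<open>frechet_derivative\<close>, which is a choice
  operator. This rule lets any derivative formula take its place; the closure lemmas below are
  inductions in which that formula is again built from functions of class C^k.\<close>

lemma Ck_on_SucI:
  assumes "open S" "\<And>x. x \<in> S \<Longrightarrow> (f has_derivative f' x) (at x)"
    and "\<And>v. Ck_on k S (\<lambda>x. f' x v)"
  shows "Ck_on (Suc k) S f"
proof -
  have "frechet_derivative f (at x) = f' x" if "x \<in> S" for x
    using assms(2)[OF that] frechet_derivative_at by metis
  then have "Ck_on k S (\<lambda>x. frechet_derivative f (at x) v)" for v
    by (intro Ck_on_cong[OF assms(1) _ assms(3)]) auto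
  then show ?thesis using assms(2) by (auto simp: differentiable_def)
qed

lemma Ck_on_SucD:
  assumes "Ck_on (Suc k) S f"
  shows "x \<in> S \<Longrightarrow> (f has_derivative frechet_derivative f (at x)) (at x)"
    and "Ck_on k S (\<lambda>x. frechet_derivative f (at x) v)"
  using assms by (auto simp: frechet_derivative_works)

lemma Ck_on_Suc_imp: "Ck_on (Suc k) S f \<Longrightarrow> Ck_on k S f"
proof (induction k arbitrary: f)
  case 0
  then show ?case
    by (auto intro!: continuous_at_imp_continuous_on differentiable_imp_continuous_within)
qed auto

lemma Ck_on_le:
  assumes "Ck_on k S f" "j \<le> k"
  shows "Ck_on j S f"
  using assms(2,1) by (induction rule: dec_induct) (blast dest: Ck_on_Suc_imp)+

lemma Ck_on_continuous: "Ck_on k S f \<Longrightarrow> continuous_on S f"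
  using Ck_on_le[of k S f 0] by simp

lemma Ck_on_subset: "Ck_on k S f \<Longrightarrow> T \<subseteq> S \<Longrightarrow> Ck_on k T f"
proof (induction k arbitrary: f)
  case 0
  then show ?case by (auto intro: continuous_on_subset)
qed auto

lemma Ck_on_const: "open S \<Longrightarrow> Ck_on k S (\<lambda>x. c)"
proof (induction k arbitrary: c)
  case (Suc k)
  then show ?case by (intro Ck_on_SucI[where f'="\<lambda>_ _. 0"]) auto
qed auto

lemma Ck_on_bounded_linear:
  assumes "bounded_linear L" "open S"
  shows "Ck_on k S f \<Longrightarrow> Ck_on k S (\<lambda>x. L (f x))"
proof (induction k arbitrary: f)
  case 0
  then show ?case
    using bounded_linear.continuous_on[OF assms(1)] by auto
next
  case (Suc k)
  then show ?case
    by (intro Ck_on_SucI[OF \<open>open S\<close>, where f'="\<lambda>x v. L (frechet_derivative f (at x) v)"]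
        bounded_linear.has_derivative[OF assms(1)] Ck_on_SucD(1)[OF Suc.prems] Suc.IH
        Ck_on_SucD(2)[OF Suc.prems])
qed

lemma Ck_on_id: "open S \<Longrightarrow> Ck_on k S (\<lambda>x. x)"
  by (cases k) (auto intro!: Ck_on_SucI[where f'="\<lambda>_ v. v"] Ck_on_const)

lemma Ck_on_add:
  assumes "open S"
  shows "Ck_on k S f \<Longrightarrow> Ck_on k S g \<Longrightarrow> Ck_on k S (\<lambda>x. f x + g x)"
proof (induction k arbitrary: f g)
  case 0
  then show ?case by (auto intro: continuous_on_add)
next
  case (Suc k)
  show ?case
  proof (rule Ck_on_SucI[OF assms])
    show "((\<lambda>x. f x + g x) has_derivative
        (\<lambda>v. frechet_derivative f (at x) v + frechet_derivative g (at x) v)) (at x)"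
      if "x \<in> S" for x
      by (intro has_derivative_add Ck_on_SucD(1)[OF Suc.prems(1) that] Ck_on_SucD(1)[OF Suc.prems(2) that])
  qed (intro Suc.IH Ck_on_SucD(2)[OF Suc.prems(1)] Ck_on_SucD(2)[OF Suc.prems(2)])
qed

lemma Ck_on_bilinear:
  assumes "bounded_bilinear B" "open S"
  shows "Ck_on k S f \<Longrightarrow> Ck_on k S g \<Longrightarrow> Ck_on k S (\<lambda>x. B (f x) (g x))"
proof (induction k arbitrary: f g)
  case 0
  then show ?case
    using bounded_bilinear.continuous_on[OF assms(1)] by auto
next
  case (Suc k)
  show ?case
  proof (rule Ck_on_SucI[OF assms(2)])
    show "((\<lambda>x. B (f x) (g x)) has_derivative
        (\<lambda>v. B (f x) (frechet_derivative g (at x) v) + B (frechet_derivative f (at x) v) (g x))) (at x)"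
      if "x \<in> S" for x
      by (intro bounded_bilinear.FDERIV[OF assms(1)] Ck_on_SucD(1)[OF Suc.prems(1) that]
          Ck_on_SucD(1)[OF Suc.prems(2) that])
  qed (intro Ck_on_add[OF assms(2)] Suc.IH Ck_on_SucD(2)[OF Suc.prems(1)]
      Ck_on_SucD(2)[OF Suc.prems(2)] Ck_on_Suc_imp[OF Suc.prems(1)] Ck_on_Suc_imp[OF Suc.prems(2)])
qed

lemmas Ck_on_mult = Ck_on_bilinear[OF bounded_bilinear_mult]
lemmas Ck_on_scaleR = Ck_on_bilinear[OF bounded_bilinear_scaleR]
lemmas Ck_on_inner = Ck_on_bilinear[OF bounded_bilinear_inner]
lemmas Ck_on_minus = Ck_on_bounded_linear[OF bounded_linear_minus[OF bounded_linear_ident]]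
lemmas Ck_on_fst = Ck_on_bounded_linear[OF bounded_linear_fst]
lemmas Ck_on_snd = Ck_on_bounded_linear[OF bounded_linear_snd]
lemmas Ck_on_vec_nth = Ck_on_bounded_linear[OF bounded_linear_vec_nth]

lemma Ck_on_diff:
  assumes "open S" "Ck_on k S f" "Ck_on k S g"
  shows "Ck_on k S (\<lambda>x. f x - g x)"
  using Ck_on_add[OF assms(1,2) Ck_on_minus[OF assms(1,3)]] by simp

lemma Ck_on_sum:
  assumes "open S" "\<And>i. i \<in> A \<Longrightarrow> Ck_on k S (f i)"
  shows "Ck_on k S (\<lambda>x. \<Sum>i\<in>A. f i x)"
  using assms(2)
  by (induction A rule: infinite_finite_induct) (auto intro!: Ck_on_const Ck_on_add assms(1))

lemma Ck_on_Pair: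
  assumes "open S" "Ck_on k S f" "Ck_on k S g"
  shows "Ck_on k S (\<lambda>x. (f x, g x))"
proof -
  have "bounded_linear (\<lambda>a. (a, 0))" "bounded_linear (\<lambda>b. (0, b))"
    by (auto intro!: bounded_linear_Pair bounded_linear_ident bounded_linear_zero)
  from Ck_on_bounded_linear[OF this(1) assms(1,2)] Ck_on_bounded_linear[OF this(2) assms(1,3)]
  have "Ck_on k S (\<lambda>x. (f x, 0) + (0, g x))"
    by (rule Ck_on_add[OF assms(1)])
  then show ?thesis by simp
qed

lemma Ck_on_vec_lambda:
  fixes f :: "'i::finite \<Rightarrow> 'a::real_normed_vector \<Rightarrow> real"
  assumes "open S" "\<And>i. Ck_on k S (f i)"
  shows "Ck_on k S (\<lambda>x. \<chi> i. f i x)"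
proof -
  have "(\<lambda>x. \<chi> i. f i x) = (\<lambda>x. \<Sum>i\<in>UNIV. f i x *\<^sub>R axis i 1)"
    by (auto simp: vec_eq_iff axis_def sum.delta' if_distrib cong: if_cong)
  then show ?thesis
    using assms by (auto intro!: Ck_on_sum Ck_on_scaleR Ck_on_const)
qed

text \<open>The derivative of \<open>g\<close> is taken in the direction
  \<open>frechet_derivative f (at x) v\<close>, which depends on \<open>x\<close>, while
  \<open>Ck_on\<close> controls fixed directions only. Expanding this direction in the basis of the
  middle space leaves fixed directions \<open>b\<close> with scalar coefficients of class
  C^k.\<close>

lemma Ck_on_compose:
  fixes f :: "'a::real_normed_vector \<Rightarrow> 'b::euclidean_space" and g :: "'b \<Rightarrow> 'c::real_normed_vector"
  assumes "open S" "open T" "f ` S \<subseteq> T"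
  shows "Ck_on k T g \<Longrightarrow> Ck_on k S f \<Longrightarrow> Ck_on k S (\<lambda>x. g (f x))"
proof (induction k arbitrary: g)
  case 0
  then show ?case using assms by (auto intro: continuous_on_compose2)
next
  case (Suc k)
  let ?D = "\<lambda>x v. \<Sum>b\<in>Basis. (frechet_derivative f (at x) v \<bullet> b) *\<^sub>R frechet_derivative g (at (f x)) b"
  show ?case
  proof (rule Ck_on_SucI[OF assms(1), where f'="?D"])
    fix x assume "x \<in> S"
    then have "f x \<in> T" using assms by auto
    note df = Ck_on_SucD(1)[OF Suc.prems(2) \<open>x \<in> S\<close>] and dg = Ck_on_SucD(1)[OF Suc.prems(1) \<open>f x \<in> T\<close>]
    have "frechet_derivative g (at (f x)) (frechet_derivative f (at x) v) = ?D x v" for v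
    proof -
      interpret bounded_linear "frechet_derivative g (at (f x))"
        using dg has_derivative_bounded_linear by blast
      show ?thesis
        by (subst euclidean_representation[of "frechet_derivative f (at x) v", symmetric]) (simp only: sum scaleR)
    qed
    then show "((\<lambda>x. g (f x)) has_derivative ?D x) (at x)"
      using has_derivative_compose[OF df dg] by (simp add: fun_eq_iff)
  next
    fix v
    show "Ck_on k S (\<lambda>x. ?D x v)"
      using Suc.prems assms Ck_on_Suc_imp[OF Suc.prems(2)]
      by (intro Ck_on_sum Ck_on_scaleR Ck_on_inner Ck_on_const Suc.IH) auto
  qed
qed

lemma Ck_on_inverse:
  fixes f :: "'a::real_normed_vector \<Rightarrow> real"
  assumes "open S" "\<And>x. x \<in> S \<Longrightarrow> f x \<noteq> 0"
  shows "Ck_on k S f \<Longrightarrow> Ck_on k S (\<lambda>x. inverse (f x))"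
proof (induction k)
  case 0
  then show ?case using assms by (auto intro: continuous_on_inverse)
next
  case (Suc k)
  show ?case
  proof (rule Ck_on_SucI[OF assms(1)])
    fix x assume "x \<in> S"
    then show "((\<lambda>x. inverse (f x)) has_derivative
        (\<lambda>v. - (inverse (f x) * frechet_derivative f (at x) v * inverse (f x)))) (at x)"
      using assms(2) by (intro Deriv.has_derivative_inverse Ck_on_SucD(1)[OF Suc.prems]) auto
  next
    fix v
    show "Ck_on k S (\<lambda>x. - (inverse (f x) * frechet_derivative f (at x) v * inverse (f x)))"
      by (intro Ck_on_minus Ck_on_mult assms(1) Ck_on_SucD(2)[OF Suc.prems] Suc.IH
          Ck_on_Suc_imp[OF Suc.prems])
  qed
qed

lemma Ck_on_divide:
  fixes f g :: "'a::real_normed_vector \<Rightarrow> real"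
  assumes "open S" "\<And>x. x \<in> S \<Longrightarrow> g x \<noteq> 0" "Ck_on k S f" "Ck_on k S g"
  shows "Ck_on k S (\<lambda>x. f x / g x)"
  unfolding divide_inverse using assms by (intro Ck_on_mult Ck_on_inverse)

lemma Ck_on_power2:
  fixes f :: "'a::real_normed_vector \<Rightarrow> real"
  assumes "open S" "Ck_on k S f" shows "Ck_on k S (\<lambda>x. (f x)\<^sup>2)"
  unfolding power2_eq_square using assms by (intro Ck_on_mult)

lemma Ck_on_sqrt:
  fixes f :: "'a::real_normed_vector \<Rightarrow> real"
  assumes "open S" "\<And>x. x \<in> S \<Longrightarrow> f x > 0"
  shows "Ck_on k S f \<Longrightarrow> Ck_on k S (\<lambda>x. sqrt (f x))"
proof (induction k)
  case 0
  then show ?case by (auto intro: continuous_on_real_sqrt)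
next
  case (Suc k)
  have "sqrt (f x) \<noteq> 0" if "x \<in> S" for x using assms(2)[OF that] by simp
  \<comment> \<open>The derivative is written in terms of \<open>sqrt (f x)\<close> itself, so that
    the induction hypothesis covers it.\<close>
  then have *: "Ck_on k S (\<lambda>x. frechet_derivative f (at x) v * (inverse (sqrt (f x)) / 2))" for v
    using assms Suc.prems Ck_on_Suc_imp[OF Suc.prems]
    by (intro Ck_on_mult Ck_on_divide Ck_on_inverse Ck_on_const Suc.IH) auto
  have "((\<lambda>x. sqrt (f x)) has_derivative
     (\<lambda>v. frechet_derivative f (at x) v * (inverse (sqrt (f x)) / 2))) (at x)" if "x \<in> S" for x
    using has_derivative_compose[OF Ck_on_SucD(1)[OF Suc.prems that]
        DERIV_real_sqrt[OF assms(2)[OF that], unfolded has_field_derivative_def]]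
    by (simp add: mult.commute)
  then show ?case
    by (intro Ck_on_SucI[OF assms(1) _ *]) auto
qed

lemma Ck_on_norm:
  fixes f :: "'a::real_normed_vector \<Rightarrow> 'b::real_inner"
  assumes "open S" "\<And>x. x \<in> S \<Longrightarrow> f x \<noteq> 0" "Ck_on k S f"
  shows "Ck_on k S (\<lambda>x. norm (f x))"
  unfolding norm_eq_sqrt_inner using assms
  by (intro Ck_on_sqrt Ck_on_inner) auto

lemma smooth_on_Ck: "smooth_on S f \<Longrightarrow> Ck_on k S f"
  by (simp add: smooth_on_def)

lemma smooth_on_frechet_derivative:
  "smooth_on S f \<Longrightarrow> smooth_on S (\<lambda>x. frechet_derivative f (at x) v)"
  unfolding smooth_on_def using Ck_on_SucD(2) by blast

lemma smooth_on_has_derivative: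
  assumes "smooth_on S f" "x \<in> S"
  shows "(f has_derivative frechet_derivative f (at x)) (at x)"
  using Ck_on_SucD(1)[OF _ assms(2), of 0] assms(1) smooth_on_Ck by blast

section \<open>A bump function of class C^1\<close>

lemma pos_part_square_has_real_derivative:
  "((\<lambda>s::real. (max 0 s)\<^sup>2) has_real_derivative 2 * max 0 s) (at s)"
proof (cases "s = 0")
  case True
  \<comment> \<open>Caratheodory's criterion at 0: the slope function is \<open>max 0 z\<close>,
    which is continuous with value 0 there.\<close>
  have "(max 0 z)\<^sup>2 - (max 0 (0::real))\<^sup>2 = max 0 z * (z - 0)" for z :: real
    by (auto simp: power2_eq_square max_def)
  moreover have "isCont (\<lambda>z::real. max 0 z) 0"
    by (intro continuous_intros)
  ultimately have "((\<lambda>s::real. (max 0 s)\<^sup>2) has_real_derivative 0) (at 0)"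
    unfolding CARAT_DERIV by (intro exI[where x="\<lambda>z. max 0 z"]) auto
  then show ?thesis using True by simp
next
  case False
  then consider "s < 0" | "s > 0" by linarith
  then show ?thesis
  proof cases
    case 1
    have "((\<lambda>s::real. (max 0 s)\<^sup>2) has_real_derivative 0) (at s)"
      by (rule has_field_derivative_transform_within_open[where S="{..<0}" and f="\<lambda>_. 0"])
         (use 1 in auto)
    then show ?thesis using 1 by simp
  next
    case 2
    have "((\<lambda>s::real. (max 0 s)\<^sup>2) has_real_derivative 2 * s) (at s)"
      by (rule has_field_derivative_transform_within_open[where S="{0<..}" and f="\<lambda>s. s\<^sup>2"])
         (use 2 in \<open>auto intro!: derivative_eq_intros\<close>)
    then show ?thesis using 2 by simp
  qed
qed

text \<open>Squaring the positive part gives class C^1 by elementary means. This is the regularity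
  that the local formulas ask of the functions and fields to which they are applied, since these are
  differentiated once.\<close>

definition bump :: "'a::real_inner \<Rightarrow> real \<Rightarrow> 'a \<Rightarrow> real" where
  "bump p r x = (max 0 (r\<^sup>2 - (x - p) \<bullet> (x - p)))\<^sup>2"

lemma bump_nonneg: "bump p r x \<ge> 0"
  by (simp add: bump_def)

lemma bump_pos_iff: "r > 0 \<Longrightarrow> bump p r x > 0 \<longleftrightarrow> x \<in> ball p r"
proof -
  assume "r > 0"
  have "bump p r x > 0 \<longleftrightarrow> (x - p) \<bullet> (x - p) < r\<^sup>2"
    by (auto simp: bump_def max_def)
  also have "\<dots> \<longleftrightarrow> norm (x - p) < r"
    using \<open>r > 0\<close> by (simp add: norm_lt_square)
  finally show ?thesis by (simp add: dist_norm norm_minus_commute)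
qed

lemma bump_eq_0: "r > 0 \<Longrightarrow> x \<notin> ball p r \<Longrightarrow> bump p r x = 0"
  using bump_pos_iff[of r p x] bump_nonneg[of p r x] by linarith

lemma Ck_on_1_bump: "open S \<Longrightarrow> Ck_on 1 S (\<lambda>x::'a::euclidean_space. bump p r x)"
proof -
  assume "open S"
  have "Ck_on (Suc 0) UNIV (\<lambda>s::real. (max 0 s)\<^sup>2)"
  proof (rule Ck_on_SucI[where f'="\<lambda>s v. (2 * max 0 s) * v"])
    show "((\<lambda>s::real. (max 0 s)\<^sup>2) has_derivative (\<lambda>v. 2 * max 0 s * v)) (at s)" for s
      using pos_part_square_has_real_derivative by (simp add: has_field_derivative_def)
    show "Ck_on 0 UNIV (\<lambda>s. 2 * max 0 s * v)" for v :: real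
      unfolding Ck_on.simps by (intro continuous_intros)
  qed simp
  moreover have "Ck_on (Suc 0) S (\<lambda>x::'a. r\<^sup>2 - (x - p) \<bullet> (x - p))"
    by (intro Ck_on_diff Ck_on_inner Ck_on_const Ck_on_id \<open>open S\<close>)
  ultimately have "Ck_on (Suc 0) S (\<lambda>x::'a. (max 0 (r\<^sup>2 - (x - p) \<bullet> (x - p)))\<^sup>2)"
    by (rule Ck_on_compose[OF \<open>open S\<close> open_UNIV subset_UNIV])
  then show ?thesis
    unfolding bump_def One_nat_def .
qed

subsection \<open>Symmetry of second derivatives\<close>

text \<open>Two applications of the mean value theorem, along \<open>u\<close> and then along
  \<open>v\<close>, turn the quotient into the mixed derivative at a point near \<open>x\<close>,
  and this derivative is continuous. The numerator is symmetric in \<open>u\<close> and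
  \<open>v\<close>, which gives \<open>frechet_derivative_commute\<close> by uniqueness of
  limits.\<close>

lemma second_difference_quotient_tendsto:
  fixes f :: "'a::real_normed_vector \<Rightarrow> real"
  assumes "open S" "Ck_on 2 S f" "x \<in> S"
  shows "((\<lambda>h. (f (x + h *\<^sub>R u + h *\<^sub>R v) - f (x + h *\<^sub>R u) - f (x + h *\<^sub>R v) + f x) / h\<^sup>2) \<longlongrightarrow>
          frechet_derivative (\<lambda>y. frechet_derivative f (at y) u) (at x) v) (at_right 0)"
proof -
  define g where "g y = frechet_derivative f (at y) u" for y
  define K where "K y = frechet_derivative g (at y) v" for y
  have C2: "Ck_on (Suc (Suc 0)) S f" using assms(2) by (simp add: numeral_2_eq_2)
  have C1: "Ck_on (Suc 0) S g" unfolding g_def using C2 Ck_on_SucD(2) by blast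
  have contK: "continuous_on S K" unfolding K_def using C1 Ck_on_SucD(2) Ck_on.simps(1) by blast
  have df: "((\<lambda>s. f (z + s *\<^sub>R u)) has_real_derivative g (z + s *\<^sub>R u)) (at s)"
    if "z + s *\<^sub>R u \<in> S" for z s
  proof -
    have L: "((\<lambda>s. z + s *\<^sub>R u) has_derivative (\<lambda>h. h *\<^sub>R u)) (at s)"
      by (auto intro!: derivative_eq_intros)
    interpret F: linear "frechet_derivative f (at (z + s *\<^sub>R u))"
      using Ck_on_SucD(1)[OF C2 that] has_derivative_linear by blast
    show ?thesis
      by (rule has_derivative_imp_has_field_derivative[OF
            has_derivative_compose[OF L Ck_on_SucD(1)[OF C2 that]]])
         (simp add: g_def F.scaleR)
  qed
  have dg: "((\<lambda>s. g (z + s *\<^sub>R v)) has_real_derivative K (z + s *\<^sub>R v)) (at s)"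
    if "z + s *\<^sub>R v \<in> S" for z s
  proof -
    have L: "((\<lambda>s. z + s *\<^sub>R v) has_derivative (\<lambda>h. h *\<^sub>R v)) (at s)"
      by (auto intro!: derivative_eq_intros)
    interpret F: linear "frechet_derivative g (at (z + s *\<^sub>R v))"
      using Ck_on_SucD(1)[OF C1 that] has_derivative_linear by blast
    show ?thesis
      by (rule has_derivative_imp_has_field_derivative[OF
            has_derivative_compose[OF L Ck_on_SucD(1)[OF C1 that]]])
         (simp add: K_def F.scaleR)
  qed
  let ?Q = "\<lambda>h. (f (x + h *\<^sub>R u + h *\<^sub>R v) - f (x + h *\<^sub>R u) - f (x + h *\<^sub>R v) + f x) / h\<^sup>2"
  have "(?Q \<longlongrightarrow> K x) (at_right 0)"
  proof (rule tendstoI)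
    fix \<epsilon> :: real assume "\<epsilon> > 0"
    obtain d0 where d0: "d0 > 0" "ball x d0 \<subseteq> S" using assms(1,3) openE by blast
    obtain d1 where d1: "d1 > 0" "\<And>y. y \<in> S \<Longrightarrow> dist y x < d1 \<Longrightarrow> dist (K y) (K x) < \<epsilon>"
      using contK assms(3) \<open>\<epsilon> > 0\<close> unfolding continuous_on_iff by blast
    define d where "d = min d0 d1"
    \<comment> \<open>For \<open>h < c\<close> all points x + s u + r v with \<open>s\<close> and
      \<open>r\<close> in [0, h] stay within distance \<open>d\<close> of \<open>x\<close>; the
      summand 1 keeps the denominator positive.\<close>
    define c where "c = d / (norm u + norm v + 1)"
    have "d > 0" using d0 d1 by (simp add: d_def)
    have np: "norm u + norm v + 1 > 0" by (smt (verit) norm_ge_zero)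
    then have "c > 0" using \<open>d > 0\<close> by (simp add: c_def)
    have near: "x + s *\<^sub>R u + r *\<^sub>R v \<in> S" "dist (K (x + s *\<^sub>R u + r *\<^sub>R v)) (K x) < \<epsilon>"
      if "0 \<le> s" "s \<le> h" "0 \<le> r" "r \<le> h" "h < c" for s r h
    proof -
      have "norm (s *\<^sub>R u + r *\<^sub>R v) \<le> s * norm u + r * norm v"
        using norm_triangle_ineq[of "s *\<^sub>R u" "r *\<^sub>R v"] that by simp
      also have "\<dots> \<le> h * norm u + h * norm v"
        using that by (intro add_mono mult_right_mono) auto
      also have "\<dots> \<le> h * (norm u + norm v + 1)" using that by (simp add: algebra_simps)
      also have "\<dots> < d" using that(5) np by (simp add: c_def field_simps)
      finally have "dist (x + s *\<^sub>R u + r *\<^sub>R v) x < d"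
        by (simp add: dist_norm add.assoc)
      then show "x + s *\<^sub>R u + r *\<^sub>R v \<in> S" using d0 by (auto simp: d_def dist_commute)
      then show "dist (K (x + s *\<^sub>R u + r *\<^sub>R v)) (K x) < \<epsilon>"
        using \<open>dist _ x < d\<close> d1 by (auto simp: d_def)
    qed
    have "dist (?Q h) (K x) < \<epsilon>" if h: "0 < h" "h < c" for h
    proof -
      let ?p = "\<lambda>s. f (x + h *\<^sub>R v + s *\<^sub>R u) - f (x + s *\<^sub>R u)"
      have "\<exists>s. 0 < s \<and> s < h \<and> ?p h - ?p 0 = (h - 0) * (g (x + h *\<^sub>R v + s *\<^sub>R u) - g (x + s *\<^sub>R u))"
      proof (rule MVT2)
        fix s assume "0 \<le> s" "s \<le> h"
        then show "(?p has_real_derivative g (x + h *\<^sub>R v + s *\<^sub>R u) - g (x + s *\<^sub>R u)) (at s)"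
          using near(1)[of s h h] near(1)[of s h 0] h
          by (intro DERIV_diff df) (auto simp: algebra_simps)
      qed (use h in auto)
      then obtain s where s: "0 < s" "s < h"
        "?p h - ?p 0 = h * (g (x + s *\<^sub>R u + h *\<^sub>R v) - g (x + s *\<^sub>R u))"
        by (auto simp: algebra_simps)
      have "\<exists>r. 0 < r \<and> r < h \<and> g (x + s *\<^sub>R u + h *\<^sub>R v) - g (x + s *\<^sub>R u + 0 *\<^sub>R v)
          = (h - 0) * K (x + s *\<^sub>R u + r *\<^sub>R v)"
        using near(1)[of s h] h s by (intro MVT2 dg) auto
      then obtain r where r: "0 < r" "r < h" "?p h - ?p 0 = h * (h * K (x + s *\<^sub>R u + r *\<^sub>R v))"
        using s(3) by auto
      then have "?Q h = K (x + s *\<^sub>R u + r *\<^sub>R v)"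
        using h by (simp add: power2_eq_square field_simps add_ac)
      then show ?thesis using near(2)[of s h r] s r h by simp
    qed
    then show "\<forall>\<^sub>F h in at_right 0. dist (?Q h) (K x) < \<epsilon>"
      using \<open>c > 0\<close> unfolding eventually_at_right_field by blast
  qed
  then show ?thesis unfolding K_def g_def .
qed

lemma frechet_derivative_commute:
  fixes f :: "'a::real_normed_vector \<Rightarrow> real"
  assumes "open S" "Ck_on 2 S f" "x \<in> S"
  shows "frechet_derivative (\<lambda>y. frechet_derivative f (at y) u) (at x) v
       = frechet_derivative (\<lambda>y. frechet_derivative f (at y) v) (at x) u"
proof (rule tendsto_unique[OF _ second_difference_quotient_tendsto[OF assms]])
  have "f (x + h *\<^sub>R v + h *\<^sub>R u) - f (x + h *\<^sub>R v) - f (x + h *\<^sub>R u)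
      = f (x + h *\<^sub>R u + h *\<^sub>R v) - f (x + h *\<^sub>R u) - f (x + h *\<^sub>R v)" for h
    by (simp add: add.assoc add.commute[of "h *\<^sub>R u"])
  then show "((\<lambda>h. (f (x + h *\<^sub>R u + h *\<^sub>R v) - f (x + h *\<^sub>R u) - f (x + h *\<^sub>R v) + f x) / h\<^sup>2) \<longlongrightarrow>
          frechet_derivative (\<lambda>y. frechet_derivative f (at y) v) (at x) u) (at_right 0)"
    using second_difference_quotient_tendsto[OF assms, of v u] by (simp only:)
qed simp

subsection \<open>The surface measure on a patch with a smooth left inverse\<close>

text \<open>The change of variables theorem that is applied here speaks of absolutely integrable
  functions. As an inequality the statement is trivial when the right side is infinite; otherwise
  both sides equal the same real number \<open>r\<close>.\<close>

lemma nn_integral_change_of_variables_le: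
  fixes g :: "real^'n::{finite,wellorder} \<Rightarrow> real^'n::_" and f :: "real^'n::_ \<Rightarrow> real"
  assumes S: "S \<in> sets borel"
    and der: "\<And>x. x \<in> S \<Longrightarrow> (g has_derivative g' x) (at x within S)"
    and inj: "inj_on g S"
    and meas: "(\<lambda>y. indicator (g ` S) y * f y) \<in> borel_measurable borel"
    and nn: "\<And>y. y \<in> g ` S \<Longrightarrow> 0 \<le> f y"
  shows "(\<integral>\<^sup>+x. ennreal (\<bar>det (matrix (g' x))\<bar> * f (g x)) * indicator S x \<partial>lborel)
       \<le> (\<integral>\<^sup>+y. ennreal (f y) * indicator (g ` S) y \<partial>lborel)"
proof (cases "(\<integral>\<^sup>+y. ennreal (f y) * indicator (g ` S) y \<partial>lborel) = \<infinity>")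
  case False
  define F where "F y = indicator (g ` S) y * f y" for y
  have eq: "ennreal (F y) = ennreal (f y) * indicator (g ` S) y" for y
    by (simp add: F_def indicator_def)
  then have int_eq: "(\<integral>\<^sup>+y. ennreal (f y) * indicator (g ` S) y \<partial>lborel) = (\<integral>\<^sup>+y. ennreal (F y) \<partial>lborel)"
    by simp
  with False obtain r where r: "0 \<le> r" "(\<integral>\<^sup>+y. ennreal (F y) \<partial>lborel) = ennreal r"
    by (metis ennreal_cases infinity_ennreal_def)
  have Fnn: "0 \<le> F y" for y using nn by (simp add: F_def indicator_def)
  have "(F has_integral r) UNIV"
    using nn_integral_has_integral[OF _ Fnn r(2,1)] meas by (simp add: F_def[abs_def])
  moreover have "F = (\<lambda>y. if y \<in> g ` S then f y else 0)"
    by (auto simp: F_def)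
  ultimately have f: "(f has_integral r) (g ` S)"
    by (simp add: has_integral_restrict_UNIV)
  then have "f absolutely_integrable_on (g ` S)"
    by (intro nonnegative_absolutely_integrable_1 nn) (auto simp: integrable_on_def)
  \<comment> \<open>That theorem takes functions with values in a Cartesian space, so
    \<open>f\<close> is wrapped into \<open>real^1\<close>.\<close>
  then have "(\<lambda>y. vec (f y) :: real^1) absolutely_integrable_on (g ` S) \<and>
      integral (g ` S) (\<lambda>y. vec (f y) :: real^1) = vec r"
    using f unfolding absolutely_integrable_on_1_iff integral_on_1_eq by (auto simp: integral_unique)
  then have "(\<lambda>x. \<bar>det (matrix (g' x))\<bar> *\<^sub>R (vec (f (g x)) :: real^1)) absolutely_integrable_on S \<and>
      integral S (\<lambda>x. \<bar>det (matrix (g' x))\<bar> *\<^sub>R (vec (f (g x)) :: real^1)) = vec r"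
    using has_absolute_integral_change_of_variables[of S g g' "\<lambda>y. vec (f y) :: real^1" "vec r"] S der inj
    by auto
  then have "(\<lambda>x. \<bar>det (matrix (g' x))\<bar> * f (g x)) absolutely_integrable_on S"
    "integral S (\<lambda>x. \<bar>det (matrix (g' x))\<bar> * f (g x)) = r"
    unfolding absolutely_integrable_on_1_iff integral_on_1_eq by (auto simp: vec_eq_iff)
  then have "((\<lambda>x. \<bar>det (matrix (g' x))\<bar> * f (g x)) has_integral r) S"
    using set_lebesgue_integral_eq_integral(1) has_integral_integral by fastforce
  then have "(\<integral>\<^sup>+x. ennreal (\<bar>det (matrix (g' x))\<bar> * f (g x)) * indicator S x \<partial>lborel) = ennreal r"
    by (intro nn_integral_has_integral_lebesgue') (auto simp: nn)
  then show ?thesis using r int_eq by simp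
qed simp

lemma local_parametrizationD:
  assumes "local_parametrization S U \<psi>"
  shows "open U" "smooth_on U \<psi>" "inj_on \<psi> U" "continuous_on U \<psi>" "\<psi> ` U \<subseteq> S"
    "y \<in> U \<Longrightarrow> (\<psi> has_derivative frechet_derivative \<psi> (at y)) (at y)"
    "continuous_on U (area_element \<psi>)"
    "\<exists>V. open V \<and> \<psi> ` U = S \<inter> V"
proof -
  have U: "open U" and sm: "smooth_on U \<psi>"
    using assms by (auto simp: local_parametrization_def)
  then show "open U" "smooth_on U \<psi>" by auto
  show "inj_on \<psi> U"
    using assms unfolding local_parametrization_def homeomorphism_def inj_on_def by metis
  show "continuous_on U \<psi>" using sm Ck_on_continuous smooth_on_Ck by blast
  show "\<psi> ` U \<subseteq> S" "\<exists>V. open V \<and> \<psi> ` U = S \<inter> V"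
    using assms unfolding local_parametrization_def openin_open by auto
  show "y \<in> U \<Longrightarrow> (\<psi> has_derivative frechet_derivative \<psi> (at y)) (at y)"
    using smooth_on_has_derivative[OF sm] .
  have "continuous_on U (\<lambda>y. frechet_derivative \<psi> (at y) v)" for v
    using Ck_on_continuous smooth_on_Ck smooth_on_frechet_derivative[OF sm] by blast
  then show "continuous_on U (area_element \<psi>)"
    unfolding area_element_def by (intro continuous_on_norm continuous_on_cross)
qed

lemma local_parametrization_patch_borel:
  assumes "local_parametrization S U \<psi>" "closed S"
  shows "\<psi> ` U \<in> sets borel"
  using local_parametrizationD(8)[OF assms(1)] assms(2) by auto

lemma local_parametrization_vimage_borel:
  assumes "local_parametrization S U \<psi>" "B \<in> sets borel"
  shows "U \<inter> \<psi> -` B \<in> sets borel"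
proof -
  have "\<psi> \<in> borel_measurable (restrict_space borel U)"
    using local_parametrizationD(4)[OF assms(1)] by (rule borel_measurable_continuous_on_restrict)
  from measurable_sets[OF this assms(2)] local_parametrizationD(1)[OF assms(1)]
  show ?thesis by (auto simp: sets_restrict_space_iff space_restrict_space Int_commute)
qed

lemma local_parametrization_measurable:
  assumes "local_parametrization S U \<psi>"
  shows "\<psi> \<in> restrict_space lborel U \<rightarrow>\<^sub>M borel"
    "area_element \<psi> \<in> borel_measurable (restrict_space lborel U)"
  using borel_measurable_continuous_on_restrict[OF local_parametrizationD(4)[OF assms]]
    borel_measurable_continuous_on_restrict[OF local_parametrizationD(7)[OF assms]]
  by (auto cong: measurable_cong_sets simp: sets_restrict_space)

lemma emeasure_patch_measure:
  assumes \<psi>: "local_parametrization S U \<psi>" and B: "B \<in> sets borel"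
  shows "emeasure (patch_measure U \<psi>) B
    = (\<integral>\<^sup>+y. ennreal (area_element \<psi> y) * indicator (U \<inter> \<psi> -` B) y \<partial>lborel)"
proof -
  note [measurable] = local_parametrization_measurable[OF \<psi>]
  have U: "U \<in> sets borel" using local_parametrizationD(1)[OF \<psi>] by auto
  let ?R = "restrict_space lborel U"
  have V: "U \<inter> \<psi> -` B \<in> sets ?R"
    using local_parametrization_vimage_borel[OF \<psi> B] U by (auto simp: sets_restrict_space_iff)
  have "emeasure (patch_measure U \<psi>) B = emeasure (density ?R (\<lambda>y. ennreal (area_element \<psi> y))) (U \<inter> \<psi> -` B)"
    unfolding patch_measure_def
    by (subst emeasure_distr) (auto simp: B space_restrict_space Int_commute measurable_density_eq1)
  also have "\<dots> = (\<integral>\<^sup>+y. ennreal (area_element \<psi> y) * indicator (U \<inter> \<psi> -` B) y \<partial>?R)"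
    using V local_parametrization_measurable(2)[OF \<psi>] by (intro emeasure_density) auto
  also have "\<dots> = (\<integral>\<^sup>+y. ennreal (area_element \<psi> y) * indicator (U \<inter> \<psi> -` B) y \<partial>lborel)"
    using U by (subst nn_integral_restrict_space) (auto intro!: nn_integral_cong simp: indicator_def)
  finally show ?thesis .
qed

lemma cross3_linear_combination:
  "cross3 (a *\<^sub>R x + b *\<^sub>R y) (c *\<^sub>R x + d *\<^sub>R y) = (a * d - b * c) *\<^sub>R cross3 x y"
  by (simp add: cross3_simps forall_3)

text \<open>By the chain rule the tangent vectors of \<psi> are combinations of those of
  \<open>g\<close>, with the columns of the matrix of \<open>T'\<close> as coefficients. The cross
  product is bilinear and alternating, so it picks up the determinant.\<close>

lemma area_element_compose:
  fixes T :: "real^2 \<Rightarrow> real^2"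
  assumes T: "(T has_derivative T') (at y)"
    and g: "(g has_derivative g') (at (T y))"
    and eq: "open W" "y \<in> W" "\<And>z. z \<in> W \<Longrightarrow> \<psi> z = g (T z)"
  shows "area_element \<psi> y = \<bar>det (matrix T')\<bar> * area_element g (T y)"
proof -
  have "((\<lambda>z. g (T z)) has_derivative (\<lambda>v. g' (T' v))) (at y)"
    by (rule has_derivative_compose[OF T g])
  then have "(\<psi> has_derivative (\<lambda>v. g' (T' v))) (at y)"
    by (rule has_derivative_transform_within_open[OF _ eq(1,2)]) (simp add: eq(3))
  then have \<psi>: "frechet_derivative \<psi> (at y) = (\<lambda>v. g' (T' v))"
    using frechet_derivative_at by metis
  have g'': "frechet_derivative g (at (T y)) = g'"
    using frechet_derivative_at g by metis
  interpret linear g' using g has_derivative_linear by blast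
  have T'v: "T' v = (T' v $ 1) *\<^sub>R axis 1 1 + (T' v $ 2) *\<^sub>R axis 2 1" for v
    by (simp add: vec_eq_iff forall_2 axis_def)
  have "g' (T' v) = (T' v $ 1) *\<^sub>R g' (axis 1 1) + (T' v $ 2) *\<^sub>R g' (axis 2 1)" for v
    using arg_cong[OF T'v, of g'] by (simp only: add scaleR)
  then have "cross3 (g' (T' (axis 1 1))) (g' (T' (axis 2 1)))
      = det (matrix T') *\<^sub>R cross3 (g' (axis 1 1)) (g' (axis 2 1))"
    by (simp add: cross3_linear_combination det_2 matrix_def)
  then show ?thesis
    by (simp add: area_element_def \<psi> g'')
qed

text \<open>The left inverse \<open>L\<close> is differentiable on the whole space, so the
  transition map \<open>T\<close> from \<xi> to \<psi> is differentiable simply as the composition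
  of \<open>L\<close> with \<xi>. The two area elements are then related by the Jacobian determinant
  of \<open>T\<close>.\<close>

lemma patch_measure_le_patch_measure:
  assumes S: "closed S" and \<psi>: "local_parametrization S V \<psi>"
    and L: "\<And>x. (L has_derivative L') (at x)" "\<And>y. y \<in> V \<Longrightarrow> L (\<psi> y) = y"
    and \<xi>: "local_parametrization S U \<xi>"
    and B: "B \<in> sets borel" "B \<subseteq> \<psi> ` V"
  shows "emeasure (patch_measure U \<xi>) B \<le> emeasure (patch_measure V \<psi>) B"
proof -
  obtain Q where Q: "open Q" "\<psi> ` V = S \<inter> Q"
    using local_parametrizationD(8)[OF \<psi>] by blast
  \<comment> \<open>The patch of \<psi> is relatively open in \<open>S\<close>, so the equation
    \<open>\<xi> y = \<psi> (T y)\<close> holds on an open set around every point of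
    \<open>E\<close> and can be differentiated there.\<close>
  define W where "W = U \<inter> \<xi> -` Q"
  have W: "open W"
    unfolding W_def using local_parametrizationD(1,4)[OF \<xi>] Q(1)
    by (metis Int_commute continuous_on_open_vimage)
  define T where "T y = L (\<xi> y)" for y
  have sub: "\<xi> y \<in> \<psi> ` V" if "y \<in> W" for y
    using that local_parametrizationD(5)[OF \<xi>] Q(2) by (auto simp: W_def)
  have TV: "T y \<in> V \<and> \<xi> y = \<psi> (T y)" if y: "y \<in> W" for y
    using sub[OF y] L(2) by (auto simp: T_def)
  define T' where "T' y v = L' (frechet_derivative \<xi> (at y) v)" for y v
  have dT: "(T has_derivative T' y) (at y)" if "y \<in> U" for y
    unfolding T_def[abs_def] T'_def[abs_def]
    by (rule has_derivative_compose[OF local_parametrizationD(6)[OF \<xi> that] L(1)])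
  define E where "E = U \<inter> \<xi> -` B"
  have EW: "E \<subseteq> W"
    using B(2) Q by (auto simp: E_def W_def)
  have E: "E \<in> sets borel"
    unfolding E_def by (rule local_parametrization_vimage_borel[OF \<xi> B(1)])
  have inj: "inj_on T E"
    unfolding inj_on_def using TV EW local_parametrizationD(3)[OF \<xi>]
    by (metis (no_types, lifting) E_def IntD1 inj_onD subset_iff)
  have TE: "T ` E = V \<inter> \<psi> -` (B \<inter> \<xi> ` U)"
  proof
    show "T ` E \<subseteq> V \<inter> \<psi> -` (B \<inter> \<xi> ` U)"
      using TV EW by (force simp: E_def)
    show "V \<inter> \<psi> -` (B \<inter> \<xi> ` U) \<subseteq> T ` E"
    proof
      fix z assume z: "z \<in> V \<inter> \<psi> -` (B \<inter> \<xi> ` U)"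
      then obtain y where y: "y \<in> U" "\<psi> z = \<xi> y" by auto
      then have "y \<in> E" "T y = z" using z L(2)[of z] by (auto simp: E_def T_def)
      then show "z \<in> T ` E" by auto
    qed
  qed
  have TE_borel: "T ` E \<in> sets borel"
    unfolding TE using B(1) local_parametrization_patch_borel[OF \<xi> S]
    by (intro local_parametrization_vimage_borel[OF \<psi>]) auto
  have TEV: "T ` E \<subseteq> V" using TE by auto
  have "emeasure (patch_measure U \<xi>) B = (\<integral>\<^sup>+y. ennreal (area_element \<xi> y) * indicator E y \<partial>lborel)"
    unfolding E_def by (rule emeasure_patch_measure[OF \<xi> B(1)])
  also have "\<dots> = (\<integral>\<^sup>+y. ennreal (\<bar>det (matrix (T' y))\<bar> * area_element \<psi> (T y)) * indicator E y \<partial>lborel)"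
  proof (intro nn_integral_cong)
    fix y
    show "ennreal (area_element \<xi> y) * indicator E y
        = ennreal (\<bar>det (matrix (T' y))\<bar> * area_element \<psi> (T y)) * indicator E y"
    proof (cases "y \<in> E")
      case True
      then have "y \<in> W" "y \<in> U" using EW by (auto simp: E_def)
      have "area_element \<xi> y = \<bar>det (matrix (T' y))\<bar> * area_element \<psi> (T y)"
        using TV \<open>y \<in> W\<close>
        by (intro area_element_compose[OF dT[OF \<open>y \<in> U\<close>] local_parametrizationD(6)[OF \<psi>] W]) auto
      then show ?thesis by simp
    qed simp
  qed
  also have "\<dots> \<le> (\<integral>\<^sup>+z. ennreal (area_element \<psi> z) * indicator (T ` E) z \<partial>lborel)"
  proof (rule nn_integral_change_of_variables_le[OF E _ inj])
    show "(T has_derivative T' y) (at y within E)" if "y \<in> E" for y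
      using dT that by (auto simp: E_def intro: has_derivative_at_withinI)
    have "continuous_on (T ` E) (area_element \<psi>)"
      using local_parametrizationD(7)[OF \<psi>] TEV continuous_on_subset by blast
    then show "(\<lambda>y. indicator (T ` E) y * area_element \<psi> y) \<in> borel_measurable borel"
      using borel_measurable_continuous_on_indicator[OF TE_borel] by fastforce
  qed (simp add: area_element_def)
  also have "\<dots> \<le> (\<integral>\<^sup>+z. ennreal (area_element \<psi> z) * indicator (V \<inter> \<psi> -` B) z \<partial>lborel)"
    using TE by (intro nn_integral_mono mult_left_mono) (auto simp: indicator_def)
  also have "\<dots> = emeasure (patch_measure V \<psi>) B"
    by (rule emeasure_patch_measure[OF \<psi> B(1), symmetric])
  finally show ?thesis .
qed

text \<open>The upper bound is obtained from the measure that is the given patch measure on the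
  patch and gives infinite mass to every point outside of it.\<close>

lemma emeasure_surface_measure_patch:
  assumes S: "closed S" and \<psi>: "local_parametrization S V \<psi>"
    and L: "\<And>x. (L has_derivative L') (at x)" "\<And>y. y \<in> V \<Longrightarrow> L (\<psi> y) = y"
    and B: "B \<in> sets borel" "B \<subseteq> \<psi> ` V"
  shows "emeasure (surface_measure S) B = emeasure (patch_measure V \<psi>) B"
proof (rule antisym)
  have P: "\<psi> ` V \<in> sets borel" by (rule local_parametrization_patch_borel[OF \<psi> S])
  define C :: "(real^3) measure" where "C = distr (count_space UNIV) borel (\<lambda>x. x)"
  have C: "emeasure C A = emeasure (count_space UNIV) A" if "A \<in> sets borel" for A
    unfolding C_def using that by (subst emeasure_distr) auto
  have setsC [simp]: "sets C = sets borel" by (simp add: C_def)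
  define N where "N = density C (\<lambda>x. \<infinity> * indicator (- \<psi> ` V) x)"
  have N: "emeasure N A = \<infinity> * emeasure C (A - \<psi> ` V)" if "A \<in> sets borel" for A
  proof -
    have "emeasure N A = (\<integral>\<^sup>+x. \<infinity> * indicator (- \<psi> ` V) x * indicator A x \<partial>C)"
      unfolding N_def
      by (rule emeasure_density) (use that P in \<open>auto simp: measurable_cong_sets[OF setsC refl]\<close>)
    also have "\<dots> = (\<integral>\<^sup>+x. \<infinity> * indicator (A - \<psi> ` V) x \<partial>C)"
      by (intro nn_integral_cong) (auto simp: indicator_def)
    finally show ?thesis using that P by (simp add: nn_integral_cmult_indicator)
  qed
  define \<mu> where "\<mu> = measure_of UNIV (sets borel) (\<lambda>A. emeasure (patch_measure V \<psi>) A + emeasure N A)"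
  have sets\<mu>: "sets \<mu> = sets borel"
    unfolding \<mu>_def by (metis sets.sets_measure_of_eq space_borel)
  have \<mu>: "emeasure \<mu> A = emeasure (patch_measure V \<psi>) A + emeasure N A" if A: "A \<in> sets borel" for A
  proof (rule emeasure_measure_of[OF \<mu>_def])
    show "countably_additive (sets \<mu>) (\<lambda>A. emeasure (patch_measure V \<psi>) A + emeasure N A)"
    proof (rule countably_additiveI)
      fix F :: "nat \<Rightarrow> (real^3) set"
      assume F: "range F \<subseteq> sets \<mu>" "disjoint_family F"
      have "(\<Sum>i. emeasure (patch_measure V \<psi>) (F i)) = emeasure (patch_measure V \<psi>) (\<Union>i. F i)"
        "(\<Sum>i. emeasure N (F i)) = emeasure N (\<Union>i. F i)"
        using F sets\<mu> by (auto intro!: suminf_emeasure simp: N_def)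
      then show "(\<Sum>i. emeasure (patch_measure V \<psi>) (F i) + emeasure N (F i))
        = emeasure (patch_measure V \<psi>) (\<Union>i. F i) + emeasure N (\<Union>i. F i)"
        by (subst suminf_add[symmetric]) auto
    qed
  qed (use A sets\<mu> in \<open>auto simp: positive_def\<close>)
  have le: "patch_measure U \<xi> \<le> \<mu>" if \<xi>: "local_parametrization S U \<xi>" for U \<xi>
  proof -
    have "emeasure (patch_measure U \<xi>) A \<le> emeasure \<mu> A" if A: "A \<in> sets borel" for A
    proof (cases "A \<subseteq> \<psi> ` V")
      case True
      then show ?thesis
        using patch_measure_le_patch_measure[OF S \<psi> L \<xi> A True] \<mu>[OF A]
        by (simp add: add_increasing2 order_trans)
    next
      case False
      then have "emeasure C (A - \<psi> ` V) \<noteq> 0"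
        using A P by (subst C) (auto simp: emeasure_count_space_eq_0)
      then have "emeasure N A = \<infinity>" using N[OF A] by (simp add: ennreal_top_mult)
      then show ?thesis using \<mu>[OF A] by simp
    qed
    then show ?thesis using sets\<mu> by (subst le_measure) auto
  qed
  then have "surface_measure S \<le> \<mu>"
    unfolding surface_measure_def by (intro SUP_least) auto
  then have "emeasure (surface_measure S) B \<le> emeasure \<mu> B"
    using sets\<mu> B by (subst (asm) le_measure) auto
  also have "\<dots> = emeasure (patch_measure V \<psi>) B"
    using B \<mu>[OF B(1)] N[OF B(1)] by (simp add: Diff_eq_empty_iff[THEN iffD2])
  finally show "emeasure (surface_measure S) B \<le> emeasure (patch_measure V \<psi>) B" .
  show "emeasure (patch_measure V \<psi>) B \<le> emeasure (surface_measure S) B"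
    using patch_measure_le_surface_measure[OF \<psi>] B by (subst (asm) le_measure) auto
qed

text \<open>A function that vanishes on \<open>S\<close> off the patch only sees the Borel subsets
  of the patch, on which the surface measure and the patch measure agree. Both are therefore
  weighted with the indicator of the patch, after which they are equal
  (\<open>dens\<close>).\<close>

lemma surface_integral_patch:
  fixes f :: "real^3 \<Rightarrow> real"
  assumes S: "closed S" and \<psi>: "local_parametrization S V \<psi>"
    and L: "\<And>x. (L has_derivative L') (at x)" "\<And>y. y \<in> V \<Longrightarrow> L (\<psi> y) = y"
    and f: "continuous_on (\<psi> ` V) f" "\<And>x. x \<in> S - \<psi> ` V \<Longrightarrow> f x = 0"
  shows "surface_integral S f = (LINT y:V|lborel. area_element \<psi> y * f (\<psi> y))"
    and "set_integrable (surface_measure S) S f \<longleftrightarrow>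
         set_integrable lborel V (\<lambda>y. area_element \<psi> y * f (\<psi> y))"
proof -
  let ?\<sigma> = "surface_measure S" and ?P = "\<psi> ` V" and ?\<pi> = "patch_measure V \<psi>"
  note [measurable] = local_parametrization_measurable[OF \<psi>]
  have P [measurable]: "?P \<in> sets borel" by (rule local_parametrization_patch_borel[OF \<psi> S])
  have V: "V \<in> sets borel" using local_parametrizationD(1)[OF \<psi>] by auto
  have fm [measurable]: "(\<lambda>x. indicator ?P x *\<^sub>R f x) \<in> borel_measurable borel"
    by (rule borel_measurable_continuous_on_indicator[OF P f(1)])
  have ind: "indicator S x *\<^sub>R f x = indicator ?P x *\<^sub>R f x" for x
    using f(2)[of x] local_parametrizationD(5)[OF \<psi>] by (auto simp: indicator_def)
  have dens: "density ?\<sigma> (\<lambda>x. ennreal (indicator ?P x)) = density ?\<pi> (\<lambda>x. ennreal (indicator ?P x))"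
  proof (rule measure_eqI)
    fix A assume "A \<in> sets (density ?\<sigma> (\<lambda>x. ennreal (indicator ?P x)))"
    then have A: "A \<in> sets borel" by simp
    have "emeasure ?\<sigma> (?P \<inter> A) = emeasure ?\<pi> (?P \<inter> A)"
      using A P by (intro emeasure_surface_measure_patch[OF S \<psi> L]) auto
    then show "emeasure (density ?\<sigma> (\<lambda>x. ennreal (indicator ?P x))) A
        = emeasure (density ?\<pi> (\<lambda>x. ennreal (indicator ?P x))) A"
      using A P by (simp add: ennreal_indicator emeasure_restricted)
  qed simp
  define h where "h x = indicator ?P x *\<^sub>R f x" for x
  have hm [measurable]: "h \<in> borel_measurable borel" unfolding h_def[abs_def] by (rule fm)
  have hh: "indicator ?P x *\<^sub>R h x = h x" for x by (simp add: h_def indicator_def)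
  have meas: "h \<in> borel_measurable ?\<sigma>" "h \<in> borel_measurable ?\<pi>"
    "(indicator ?P :: _ \<Rightarrow> real) \<in> borel_measurable ?\<sigma>" "(indicator ?P :: _ \<Rightarrow> real) \<in> borel_measurable ?\<pi>"
    using hm borel_measurable_indicator[OF P]
    by (simp_all add: measurable_cong_sets[OF sets_surface_measure refl]
        measurable_cong_sets[OF sets_patch_measure refl])
  have i\<sigma>: "integral\<^sup>L ?\<sigma> h = integral\<^sup>L ?\<pi> h" "integrable ?\<sigma> h \<longleftrightarrow> integrable ?\<pi> h"
    using integral_density[OF meas(1,3)] integral_density[OF meas(2,4)]
      integrable_density[OF meas(1,3)] integrable_density[OF meas(2,4)]
    by (simp_all add: dens hh[unfolded real_scaleR_def])
  let ?R = "restrict_space lborel V"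
  have \<psi>m: "\<psi> \<in> density ?R (\<lambda>y. ennreal (area_element \<psi> y)) \<rightarrow>\<^sub>M borel"
    by (simp add: measurable_density_eq1)
  have h\<psi>: "(\<lambda>y. h (\<psi> y)) \<in> borel_measurable ?R" by measurable
  have nn: "AE y in ?R. 0 \<le> area_element \<psi> y" by (simp add: area_element_def)
  have eq: "indicator V y *\<^sub>R (area_element \<psi> y *\<^sub>R h (\<psi> y))
      = indicator V y *\<^sub>R (area_element \<psi> y * f (\<psi> y))" for y
    by (auto simp: h_def indicator_def)
  have V': "V \<inter> space lborel \<in> sets lborel" using V by simp
  have "integral\<^sup>L ?\<pi> h = integral\<^sup>L ?R (\<lambda>y. area_element \<psi> y *\<^sub>R h (\<psi> y))"
    unfolding patch_measure_def integral_distr[OF \<psi>m hm]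
    by (rule integral_density[OF h\<psi> _ nn]) measurable
  also have "\<dots> = (LINT y:V|lborel. area_element \<psi> y * f (\<psi> y))"
    unfolding integral_restrict_space[OF V'] set_lebesgue_integral_def eq ..
  finally show "surface_integral S f = (LINT y:V|lborel. area_element \<psi> y * f (\<psi> y))"
    unfolding surface_integral_def set_lebesgue_integral_def ind h_def[symmetric] i\<sigma> .
  have "integrable ?\<pi> h \<longleftrightarrow> integrable ?R (\<lambda>y. area_element \<psi> y *\<^sub>R h (\<psi> y))"
    unfolding patch_measure_def integrable_distr_eq[OF \<psi>m hm]
    by (rule integrable_density[OF h\<psi> _ nn]) measurable
  also have "\<dots> \<longleftrightarrow> set_integrable lborel V (\<lambda>y. area_element \<psi> y * f (\<psi> y))"
    unfolding integrable_restrict_space[OF V'] set_integrable_def eq ..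
  finally show "set_integrable ?\<sigma> S f \<longleftrightarrow> set_integrable lborel V (\<lambda>y. area_element \<psi> y * f (\<psi> y))"
    unfolding set_integrable_def ind h_def[symmetric] i\<sigma> .
qed

subsection \<open>Orthonormal frames\<close>

text \<open>The orientation is part of the notion because the area element is the norm of a cross
  product that is computed in the frame.\<close>

definition right_frame :: "real^3 \<Rightarrow> real^3 \<Rightarrow> real^3 \<Rightarrow> bool" where
  "right_frame e1 e2 e3 \<longleftrightarrow> e1 \<bullet> e1 = 1 \<and> e2 \<bullet> e2 = 1 \<and> e3 \<bullet> e3 = 1 \<and>
     e1 \<bullet> e2 = 0 \<and> e1 \<bullet> e3 = 0 \<and> e2 \<bullet> e3 = 0 \<and> cross3 e1 e2 = e3"

lemma right_frame_exists:
  fixes n :: "real^3"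
  assumes "norm n = 1"
  shows "\<exists>e1 e2. right_frame e1 e2 n"
proof -
  obtain A where A: "rotation_matrix A" "A *v (axis 3 1) = n"
    using rotation_matrix_exists_basis[OF _ assms, of 3] by auto
  then have "orthogonal_transformation ((*v) A)"
    by (simp add: rotation_matrix_def orthogonal_transformation_matrix)
  then have inn: "(A *v x) \<bullet> (A *v y) = x \<bullet> y" for x y
    by (simp add: orthogonal_transformation_def)
  define e1 where "e1 = A *v (axis 1 1)"
  have e1: "e1 \<bullet> e1 = 1" "e1 \<bullet> n = 0"
    unfolding e1_def A(2)[symmetric] inn by (simp_all add: inner_axis_axis)
  have n: "n \<bullet> n = 1" using assms by (simp add: norm_eq_1)
  have L: "cross3 x (cross3 y z) = (x \<bullet> z) *\<^sub>R y - (x \<bullet> y) *\<^sub>R z" for x y z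
    by (simp add: Lagrange)
  \<comment> \<open>The second vector is \<open>cross3 n e1\<close>, for which the orientation
    \<open>cross3 e1 (cross3 n e1) = n\<close> is Lagrange's identity.\<close>
  have "cross3 n e1 \<bullet> cross3 n e1 = 1"
    using e1 n by (simp add: dot_cross inner_commute)
  then have "right_frame e1 (cross3 n e1) n"
    using e1 n unfolding right_frame_def
    by (simp add: L dot_cross_self inner_commute)
  then show ?thesis by blast
qed

text \<open>Orthonormality says that the matrix with rows \<open>e1\<close>, \<open>e2\<close>,
  \<open>e3\<close> has its transpose as a right inverse. For square matrices this is also a left
  inverse, and that is the expansion.\<close>

lemma right_frame_expand:
  assumes "right_frame e1 e2 e3"
  shows "(x \<bullet> e1) *\<^sub>R e1 + (x \<bullet> e2) *\<^sub>R e2 + (x \<bullet> e3) *\<^sub>R e3 = x"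
proof -
  define M :: "real^3^3" where "M = vector [e1, e2, e3]"
  have M: "M $ 1 = e1" "M $ 2 = e2" "M $ 3 = e3" by (simp_all add: M_def)
  have "M ** transpose M = mat 1"
    using assms unfolding right_frame_def
    by (simp add: vec_eq_iff forall_3 matrix_matrix_mult_def transpose_def mat_def M
        inner_vec_def sum_3 mult.commute)
  then have "transpose M ** M = mat 1"
    by (simp add: matrix_left_right_inverse)
  then have "transpose M *v (M *v x) = x"
    by (simp add: matrix_vector_mul_assoc)
  moreover have "transpose M *v (M *v x) = (x \<bullet> e1) *\<^sub>R e1 + (x \<bullet> e2) *\<^sub>R e2 + (x \<bullet> e3) *\<^sub>R e3"
    by (simp add: vec_eq_iff forall_3 matrix_vector_mult_def transpose_def M inner_vec_def sum_3
        mult.commute)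
  ultimately show ?thesis by simp
qed

lemma axis_nth_if: "axis i (x::real) $ j = (if j = i then x else 0)"
  by (simp add: axis_def)

lemma right_frame_trace:
  assumes "right_frame e1 e2 e3"
  shows "trace J = (J *v e1) \<bullet> e1 + (J *v e2) \<bullet> e2 + (J *v e3) \<bullet> e3"
proof -
  \<comment> \<open>The completeness relation: the outer products of the frame vectors with
    themselves add up to the unit matrix.\<close>
  have E: "e1 $ i * e1 $ j + e2 $ i * e2 $ j + e3 $ i * e3 $ j = (if i = j then 1 else 0)" for i j
    using arg_cong[OF right_frame_expand[OF assms, of "axis i 1"], of "\<lambda>x. x $ j"]
    by (simp add: inner_axis' axis_nth_if split: if_splits)
  have "(J *v e1) \<bullet> e1 + (J *v e2) \<bullet> e2 + (J *v e3) \<bullet> e3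
      = (\<Sum>i\<in>UNIV. \<Sum>j\<in>UNIV. J $ i $ j * (e1 $ i * e1 $ j + e2 $ i * e2 $ j + e3 $ i * e3 $ j))"
    by (simp add: matrix_vector_mult_def inner_vec_def sum_3 algebra_simps)
  also have "\<dots> = trace J"
    unfolding E by (simp add: trace_def if_distrib sum.delta cong: if_cong)
  finally show ?thesis by simp
qed

lemma right_frame_inner_expand:
  assumes "right_frame e1 e2 e3"
  shows "x \<bullet> y = (x \<bullet> e1) * (y \<bullet> e1) + (x \<bullet> e2) * (y \<bullet> e2) + (x \<bullet> e3) * (y \<bullet> e3)"
proof -
  have "x \<bullet> y = ((x \<bullet> e1) *\<^sub>R e1 + (x \<bullet> e2) *\<^sub>R e2 + (x \<bullet> e3) *\<^sub>R e3) \<bullet> y"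
    by (simp only: right_frame_expand[OF assms])
  then show ?thesis
    unfolding inner_add_left inner_scaleR_left
    by (simp only: inner_commute[of e1 y] inner_commute[of e2 y] inner_commute[of e3 y])
qed

subsection \<open>Moving level sets as graphs\<close>

definition plane_lift :: "real^3 \<Rightarrow> real^3 \<Rightarrow> real^2 \<Rightarrow> real^3" where
  "plane_lift e1 e2 y = (y $ 1) *\<^sub>R e1 + (y $ 2) *\<^sub>R e2"

definition plane_proj :: "real^3 \<Rightarrow> real^3 \<Rightarrow> real^3 \<Rightarrow> real^2" where
  "plane_proj e1 e2 x = vector [x \<bullet> e1, x \<bullet> e2]"

lemma bounded_linear_plane_lift: "bounded_linear (plane_lift e1 e2)"
  unfolding linear_conv_bounded_linear[symmetric]
  by (rule linearI) (auto simp: plane_lift_def algebra_simps)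

lemma bounded_linear_plane_proj: "bounded_linear (plane_proj e1 e2)"
  unfolding linear_conv_bounded_linear[symmetric]
  by (rule linearI) (auto simp: plane_proj_def vec_eq_iff forall_2 inner_left_distrib)

lemma plane_proj_nth [simp]: "plane_proj e1 e2 x $ 1 = x \<bullet> e1" "plane_proj e1 e2 x $ 2 = x \<bullet> e2"
  by (simp_all add: plane_proj_def)

lemma plane_lift_inner:
  assumes "right_frame e1 e2 e3"
  shows "plane_lift e1 e2 y \<bullet> e1 = y $ 1" "plane_lift e1 e2 y \<bullet> e2 = y $ 2" "plane_lift e1 e2 y \<bullet> e3 = 0"
  using assms unfolding plane_lift_def right_frame_def inner_add_left inner_scaleR_left
  by (simp_all add: inner_commute[of e2 e1])

lemma plane_lift_proj:
  assumes "right_frame e1 e2 e3"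
  shows "plane_lift e1 e2 (plane_proj e1 e2 x) = x - (x \<bullet> e3) *\<^sub>R e3"
  using right_frame_expand[OF assms, of x] by (simp add: plane_lift_def algebra_simps)

text \<open>Replacing the third coordinate of \<open>x\<close> by \<open>\<Phi> (x, t)\<close> is a local diffeomorphism of space-time.
  Its inverse, restricted to the plane where this coordinate vanishes, parametrizes the zero sets.\<close>

definition straighten_inv :: "((real^3) \<times> real \<Rightarrow> real) \<Rightarrow> real^3 \<Rightarrow> (real^3) \<times> real \<Rightarrow> (real^3) \<times> real \<Rightarrow> (real^3) \<times> real" where
  "straighten_inv d e3 z w = (fst w - (fst w \<bullet> e3) *\<^sub>R e3 +
     ((fst w \<bullet> e3 - d (fst w - (fst w \<bullet> e3) *\<^sub>R e3, snd w)) / d (e3, 0)) *\<^sub>R e3, snd w)"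

text \<open>\<open>f'\<close> is the derivative of the straightening map when \<open>d\<close> is
  that of \<Phi>. It keeps time and the components orthogonal to \<open>e3\<close> and makes
  \<open>d w\<close> the new \<open>e3\<close>-component, so the old one is recovered by a division
  by \<open>d (e3, 0)\<close>.\<close>

lemma straighten_inverse:
  assumes "linear d" "d (e3, 0) \<noteq> 0" "e3 \<bullet> e3 = 1"
  defines "f' \<equiv> \<lambda>w. (fst w + (d w - fst w \<bullet> e3) *\<^sub>R e3, snd w)"
  shows "straighten_inv d e3 z (f' w) = w" "f' (straighten_inv d e3 z w) = w"
proof -
  interpret linear d by fact
  have d: "d (v - c *\<^sub>R e3, \<tau>) = d (v, \<tau>) - c * d (e3, 0)"
    "d (v + c *\<^sub>R e3, \<tau>) = d (v, \<tau>) + c * d (e3, 0)" for v c \<tau>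
    using diff[of "(v, \<tau>)" "c *\<^sub>R (e3, 0)"] add[of "(v, \<tau>)" "c *\<^sub>R (e3, 0)"] scaleR[of c "(e3, 0)"]
    by simp_all
  obtain v \<tau> where w: "w = (v, \<tau>)" by fastforce
  have "(v + (d w - v \<bullet> e3) *\<^sub>R e3) \<bullet> e3 = d w"
    using assms(3) by (simp add: inner_add_left)
  then have 1: "fst (f' w) \<bullet> e3 = d w" "fst (f' w) - (d w) *\<^sub>R e3 = v - (v \<bullet> e3) *\<^sub>R e3" "snd (f' w) = \<tau>"
    by (simp_all add: f'_def w algebra_simps)
  have "(d w - d (v - (v \<bullet> e3) *\<^sub>R e3, \<tau>)) / d (e3, 0) = v \<bullet> e3"
    using assms(2) by (simp add: d w)
  then show "straighten_inv d e3 z (f' w) = w"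
    unfolding straighten_inv_def 1 by (simp add: w)
  define c where "c = (v \<bullet> e3 - d (v - (v \<bullet> e3) *\<^sub>R e3, \<tau>)) / d (e3, 0)"
  have S: "straighten_inv d e3 z w = (v - (v \<bullet> e3) *\<^sub>R e3 + c *\<^sub>R e3, \<tau>)"
    by (simp add: straighten_inv_def w c_def)
  have "d (v - (v \<bullet> e3) *\<^sub>R e3 + c *\<^sub>R e3, \<tau>) = v \<bullet> e3"
    unfolding d(2) using assms(2) by (simp add: c_def)
  moreover have "(v - (v \<bullet> e3) *\<^sub>R e3 + c *\<^sub>R e3) \<bullet> e3 = c"
    using assms(3) by (simp add: inner_add_left inner_diff_left)
  ultimately show "f' (straighten_inv d e3 z w) = w"
    unfolding f'_def S by (simp add: w algebra_simps)
qed

text \<open>The box is the same at all times in the interval, so that integrals over the moving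
  surfaces have a fixed domain. \<open>W\<close> is an open neighbourhood of the closed box times
  the interval, \<open>Q\<close> is a region in which the zero sets are exactly the graphs over the
  open box, and a function supported in \<open>cball p \<rho>\<close> sees only this region.
  \<open>chart_derivative\<close> is implicit differentiation of \<Phi> = 0.\<close>

locale level_set_chart =
  fixes \<Phi> :: "(real^3) \<times> real \<Rightarrow> real" and \<Omega> :: "((real^3) \<times> real) set" and p :: "real^3" and t0 :: real
    and e1 e2 e3 :: "real^3" and \<psi> :: "(real^2) \<times> real \<Rightarrow> real^3" and W :: "((real^2) \<times> real) set"
    and a b :: "real^2" and \<delta> \<rho> :: real and Q :: "((real^3) \<times> real) set"
  assumes open_dom: "open \<Omega>" and smooth: "smooth_on \<Omega> \<Phi>"
    and frame: "right_frame e1 e2 e3"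
    and open_W: "open W" and smooth_chart: "smooth_on W \<psi>"
    and \<delta>_pos: "\<delta> > 0" and \<rho>_pos: "\<rho> > 0" and box_W: "cbox a b \<times> {t0 - \<delta>..t0 + \<delta>} \<subseteq> W"
    and chart: "\<And>y t. (y, t) \<in> W \<Longrightarrow> (\<psi> (y, t), t) \<in> \<Omega> \<and> \<Phi> (\<psi> (y, t), t) = 0 \<and>
        frechet_derivative \<Phi> (at (\<psi> (y, t), t)) (e3, 0) > 0 \<and> plane_proj e1 e2 (\<psi> (y, t) - p) = y"
    and chart_derivative: "\<And>y t. (y, t) \<in> W \<Longrightarrow> (\<psi> has_derivative (\<lambda>h. plane_lift e1 e2 (fst h) -
        (frechet_derivative \<Phi> (at (\<psi> (y, t), t)) (plane_lift e1 e2 (fst h), snd h) /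
         frechet_derivative \<Phi> (at (\<psi> (y, t), t)) (e3, 0)) *\<^sub>R e3)) (at (y, t))"
    and open_Q: "open Q"
    and chart_image: "\<And>t. t \<in> {t0 - \<delta>..t0 + \<delta>} \<Longrightarrow>
        (\<lambda>y. \<psi> (y, t)) ` box a b = {x. (x, t) \<in> Q \<and> \<Phi> (x, t) = 0}"
    and ball_Q: "cball p \<rho> \<times> {t0 - \<delta>..t0 + \<delta>} \<subseteq> Q"

lemma moving_level_set_chart:
  fixes \<Phi> :: "(real^3) \<times> real \<Rightarrow> real"
  assumes \<Omega>: "open \<Omega>" and \<Phi>: "smooth_on \<Omega> \<Phi>" and p: "(p, t0) \<in> \<Omega>" "\<Phi> (p, t0) = 0"
    and e: "right_frame e1 e2 e3" and pos: "frechet_derivative \<Phi> (at (p, t0)) (e3, 0) > 0"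
  shows "\<exists>\<rho> \<delta> \<psi> W a b Q. level_set_chart \<Phi> \<Omega> p t0 e1 e2 e3 \<psi> W a b \<delta> \<rho> Q"
proof -
  define d where "d z = frechet_derivative \<Phi> (at z)" for z
  have d\<Phi>: "(\<Phi> has_derivative d z) (at z)" if "z \<in> \<Omega>" for z
    unfolding d_def by (rule smooth_on_has_derivative[OF \<Phi> that])
  have smd: "Ck_on k \<Omega> (\<lambda>z. d z v)" for k v
    unfolding d_def by (intro smooth_on_Ck smooth_on_frechet_derivative \<Phi>)
  define X where "X = {z \<in> \<Omega>. d z (e3, 0) > 0}"
  have "X = (\<lambda>z. d z (e3, 0)) -` {0<..} \<inter> \<Omega>" by (auto simp: X_def)
  moreover have "open ((\<lambda>z. d z (e3, 0)) -` {0<..} \<inter> \<Omega>)"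
    by (rule continuous_on_open_vimage[OF \<Omega>, THEN iffD1, rule_format])
       (use Ck_on_continuous[OF smd] in auto)
  ultimately have X: "open X" by simp
  have XO: "X \<subseteq> \<Omega>" and pX: "(p, t0) \<in> X" using p pos by (auto simp: X_def d_def)
  have e33: "e3 \<bullet> e3 = 1" using e by (simp add: right_frame_def)
  \<comment> \<open>The \<open>e3\<close>-component of \<open>x - p\<close> is replaced by the value
    of \<Phi>. The derivative is invertible on \<open>X\<close>, where the derivative of \<Phi>
    along \<open>e3\<close> is positive.\<close>
  define f where "f z = (fst z + (\<Phi> z - (fst z - p) \<bullet> e3) *\<^sub>R e3, snd z)" for z
  define f' where "f' z w = (fst w + (d z w - fst w \<bullet> e3) *\<^sub>R e3, snd w)" for z w
  have lin: "linear (d z)" if "z \<in> X" for z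
    using d\<Phi> XO that has_derivative_linear by blast
  have df: "(f has_derivative f' z) (at z)" if "z \<in> X" for z
  proof -
    have z: "z \<in> \<Omega>" using XO that by auto
    have "((\<lambda>z. (fst z + (\<Phi> z - (fst z - p) \<bullet> e3) *\<^sub>R e3, snd z)) has_derivative
        (\<lambda>w. (fst w + (d z w - (fst w - 0) \<bullet> e3) *\<^sub>R e3, snd w))) (at z)"
      by (intro has_derivative_Pair has_derivative_add has_derivative_scaleR_left has_derivative_diff
          has_derivative_inner_left has_derivative_fst has_derivative_snd has_derivative_ident
          has_derivative_const d\<Phi>[OF z])
    then show ?thesis by (simp add: f_def[abs_def] f'_def[abs_def])
  qed
  define B where "B z = Blinfun (f' z)" for z
  have B: "blinfun_apply (B z) = f' z" if "z \<in> X" for z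
    unfolding B_def using df[OF that] by (intro bounded_linear_Blinfun_apply has_derivative_bounded_linear)
  have contB: "continuous_on X B"
  proof (rule continuous_on_blinfun_componentwise)
    fix i :: "(real^3) \<times> real"
    have "continuous_on X (\<lambda>z. d z i)" using Ck_on_continuous[OF smd] XO continuous_on_subset by blast
    then have "continuous_on X (\<lambda>z. f' z i)"
      unfolding f'_def by (intro continuous_intros)
    then show "continuous_on X (\<lambda>z. blinfun_apply (B z) i)"
      using B by (metis (no_types, lifting) continuous_on_cong)
  qed
  define G where "G z = straighten_inv (d z) e3 z" for z
  have Gf: "G z (f' z w) = w" "f' z (G z w) = w" if "z \<in> X" for z w
    using straighten_inverse[OF lin[OF that] _ e33, of z w] that
    by (auto simp: G_def f'_def[abs_def] X_def)
  have lf': "linear (f' z)" if "z \<in> X" for z using df[OF that] has_derivative_linear by blast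
  have "linear (G (p, t0))"
  proof (rule linearI)
    show "G (p, t0) (x + y) = G (p, t0) x + G (p, t0) y" for x y
      using Gf(1)[OF pX, of "G (p, t0) x + G (p, t0) y"] by (simp add: linear_add[OF lf'[OF pX]] Gf[OF pX])
    show "G (p, t0) (c *\<^sub>R x) = c *\<^sub>R G (p, t0) x" for c x
      using Gf(1)[OF pX, of "c *\<^sub>R G (p, t0) x"] by (simp add: linear_scale[OF lf'[OF pX]] Gf[OF pX])
  qed
  then have "bounded_linear (G (p, t0))" by (simp add: linear_conv_bounded_linear)
  then have "blinfun_apply (Blinfun (G (p, t0))) = G (p, t0)" by (rule bounded_linear_Blinfun_apply)
  then have inv0: "Blinfun (G (p, t0)) o\<^sub>L B (p, t0) = id_blinfun"
    by (intro blinfun_eqI) (simp add: B[OF pX] Gf[OF pX])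
  obtain U' V g g' where U': "open U'" "U' \<subseteq> X" "(p, t0) \<in> U'" and V: "open V" "f (p, t0) \<in> V"
    and hom: "homeomorphism U' V f g"
    and dg: "\<And>w. w \<in> V \<Longrightarrow> (g has_derivative g' w) (at w)"
    and g': "\<And>w. w \<in> V \<Longrightarrow> g' w = inv (blinfun_apply (B (g w)))"
    using inverse_function_theorem[OF X _ contB pX inv0, of f] df B by metis
  have gV: "g w \<in> U'" "f (g w) = w" if "w \<in> V" for w
    using hom that by (auto simp: homeomorphism_def)
  have gU: "f z \<in> V" "g (f z) = z" if "z \<in> U'" for z
    using hom that by (auto simp: homeomorphism_def)
  have dg: "(g has_derivative G (g w)) (at w)" if w: "w \<in> V" for w
  proof -
    have gX: "g w \<in> X" using gV(1)[OF w] U'(2) by blast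
    have "inv (f' (g w)) = G (g w)"
      by (rule inv_unique_comp) (auto simp: fun_eq_iff Gf[OF gX])
    then show ?thesis using dg[OF w] g'[OF w] B[OF gX] by simp
  qed
  have smG: "Ck_on k X (\<lambda>z. G z w)" for k w
  proof -
    have "Ck_on k X (\<lambda>z. (fst w - (fst w \<bullet> e3) *\<^sub>R e3 +
     ((fst w \<bullet> e3 - d z (fst w - (fst w \<bullet> e3) *\<^sub>R e3, snd w)) / d z (e3, 0)) *\<^sub>R e3, snd w))"
      using X XO by (intro Ck_on_Pair Ck_on_add Ck_on_scaleR Ck_on_divide Ck_on_diff Ck_on_const
          Ck_on_subset[OF smd]) (auto simp: X_def)
    then show ?thesis by (simp add: G_def straighten_inv_def)
  qed
  \<comment> \<open>Bootstrapping: the derivative of \<open>g\<close> at \<open>w\<close> is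
    \<open>G (g w)\<close> with smooth \<open>G\<close>, so class C^k of \<open>g\<close> gives
    class C^(k+1).\<close>
  have smg: "Ck_on k V g" for k
  proof (induction k)
    case 0
    then show ?case using hom by (simp add: homeomorphism_def)
  next
    case (Suc k)
    show ?case
    proof (rule Ck_on_SucI[OF V(1) dg])
      show "Ck_on k V (\<lambda>w. G (g w) v)" for v
        using gV U' by (intro Ck_on_compose[OF V(1) X _ smG Suc]) auto
    qed
  qed
  \<comment> \<open>\<open>A\<close> sends the plane times the time axis to the points of the
    straightened space-time at which the coordinate that stands for \<Phi> is zero. The chart is the
    spatial part of the inverse map there.\<close>
  define A where "A z = (p + plane_lift e1 e2 (fst z), snd z)" for z :: "(real^2) \<times> real"
  have dA: "(A has_derivative (\<lambda>h. (0 + plane_lift e1 e2 (fst h), snd h))) (at z)" for z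
    unfolding A_def
    by (intro has_derivative_Pair has_derivative_add has_derivative_const has_derivative_snd
        has_derivative_ident bounded_linear.has_derivative[OF bounded_linear_plane_lift] has_derivative_fst)
  have smA: "Ck_on k S A" if "open S" for k S
    unfolding A_def
    by (intro Ck_on_Pair Ck_on_add Ck_on_const Ck_on_snd Ck_on_fst Ck_on_id that
        Ck_on_bounded_linear[OF bounded_linear_plane_lift])
  define W where "W = A -` V"
  have W: "open W"
    unfolding W_def using Ck_on_continuous[OF smA[OF open_UNIV]] V(1) open_vimage by blast
  define \<psi> where "\<psi> z = fst (g (A z))" for z
  have sm\<psi>: "smooth_on W \<psi>"
    unfolding smooth_on_def
  proof
    fix k
    show "Ck_on k W \<psi>"
      unfolding \<psi>_def[abs_def]
      using Ck_on_fst[OF W Ck_on_compose[OF W V(1) _ smg smA[OF W]]] by (auto simp: W_def)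
  qed
  have props: "g (A (y, t)) = (\<psi> (y, t), t)" "(\<psi> (y, t), t) \<in> U'" "\<Phi> (\<psi> (y, t), t) = 0"
    "plane_proj e1 e2 (\<psi> (y, t) - p) = y" if yt: "(y, t) \<in> W" for y t
  proof -
    have "A (y, t) \<in> V" using yt by (simp add: W_def)
    note g = gV[OF this]
    have "snd (g (A (y, t))) = t" using arg_cong[OF g(2), of snd] by (simp add: f_def A_def)
    then show gA: "g (A (y, t)) = (\<psi> (y, t), t)" by (simp add: \<psi>_def prod_eq_iff)
    then show "(\<psi> (y, t), t) \<in> U'" using g by simp
    have eq: "\<psi> (y, t) + (\<Phi> (\<psi> (y, t), t) - (\<psi> (y, t) - p) \<bullet> e3) *\<^sub>R e3 = p + plane_lift e1 e2 y"
      using arg_cong[OF g(2)[unfolded gA], of fst] by (simp add: f_def A_def)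
    show "\<Phi> (\<psi> (y, t), t) = 0"
      using arg_cong[OF eq, of "\<lambda>x. x \<bullet> e3"]
      by (simp add: inner_left_distrib inner_diff_left e33 plane_lift_inner[OF e])
    have e0: "e3 \<bullet> e1 = 0" "e3 \<bullet> e2 = 0" using e by (simp_all add: right_frame_def inner_commute)
    show "plane_proj e1 e2 (\<psi> (y, t) - p) = y"
      using arg_cong[OF eq, of "\<lambda>x. x \<bullet> e1"] arg_cong[OF eq, of "\<lambda>x. x \<bullet> e2"]
      by (simp add: vec_eq_iff forall_2 inner_left_distrib inner_diff_left e0 plane_lift_inner[OF e])
  qed
  have d\<psi>: "(\<psi> has_derivative (\<lambda>h. plane_lift e1 e2 (fst h) -
        (d (\<psi> (y, t), t) (plane_lift e1 e2 (fst h), snd h) / d (\<psi> (y, t), t) (e3, 0)) *\<^sub>R e3)) (at (y, t))"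
    if yt: "(y, t) \<in> W" for y t
  proof -
    have AV: "A (y, t) \<in> V" using yt by (simp add: W_def)
    have "(\<psi> has_derivative (\<lambda>h. fst (G (g (A (y, t))) (0 + plane_lift e1 e2 (fst h), snd h)))) (at (y, t))"
      unfolding \<psi>_def[abs_def]
      by (rule has_derivative_fst[OF has_derivative_compose[OF dA dg[OF AV]]])
    then show ?thesis
      by (simp add: G_def straighten_inv_def props[OF yt] plane_lift_inner[OF e])
  qed
  have "A (0, t0) = f (p, t0)"
    by (simp add: A_def f_def p plane_lift_def)
  then have "(0, t0) \<in> W" using V by (simp add: W_def)
  then obtain W1 W2 where W12: "open W1" "open W2" "(0, t0) \<in> W1 \<times> W2" "W1 \<times> W2 \<subseteq> W"
    using open_prod_elim[OF W] by blast
  then have "0 \<in> W1" by auto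
  obtain a b where ab: "cbox a b \<subseteq> W1" "0 \<in> box a b"
    using open_contains_cbox[OF W12(1) \<open>0 \<in> W1\<close>] .
  obtain \<delta>1 where \<delta>1: "\<delta>1 > 0" "cball t0 \<delta>1 \<subseteq> W2"
    using W12 open_contains_cball[of W2] by auto
  \<comment> \<open>Requiring the projection of a point to lie in the open box makes the zero set
    within \<open>Q\<close> exactly the graph over that box.\<close>
  define Q where "Q = U' \<inter> (\<lambda>z. plane_proj e1 e2 (fst z - p)) -` box a b"
  have "continuous_on UNIV (\<lambda>z::(real^3) \<times> real. plane_proj e1 e2 (fst z - p))"
    by (intro bounded_linear.continuous_on[OF bounded_linear_plane_proj] continuous_intros)
  then have Q: "open Q"
    unfolding Q_def using U'(1) by (intro open_Int open_vimage[OF open_box])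
  have pp0: "plane_proj e1 e2 0 = 0" by (simp add: vec_eq_iff forall_2)
  have "(p, t0) \<in> Q" using U' ab by (simp add: Q_def pp0)
  then obtain Q1 Q2 where Q12: "open Q1" "open Q2" "(p, t0) \<in> Q1 \<times> Q2" "Q1 \<times> Q2 \<subseteq> Q"
    using open_prod_elim[OF Q] by blast
  obtain \<rho> where \<rho>: "\<rho> > 0" "cball p \<rho> \<subseteq> Q1" using Q12 open_contains_cball[of Q1] by auto
  obtain \<delta>2 where \<delta>2: "\<delta>2 > 0" "cball t0 \<delta>2 \<subseteq> Q2" using Q12 open_contains_cball[of Q2] by auto
  define \<delta> where "\<delta> = min \<delta>1 \<delta>2"
  have \<delta>: "\<delta> > 0" using \<delta>1 \<delta>2 by (simp add: \<delta>_def)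
  have \<delta>W: "{t0 - \<delta>..t0 + \<delta>} \<subseteq> W2" and \<delta>Q: "{t0 - \<delta>..t0 + \<delta>} \<subseteq> Q2"
    using \<delta>1(2) \<delta>2(2) by (auto simp: \<delta>_def subset_iff dist_real_def)
  have "level_set_chart \<Phi> \<Omega> p t0 e1 e2 e3 \<psi> W a b \<delta> \<rho> Q"
  proof (rule level_set_chart.intro[OF \<Omega> \<Phi> e W sm\<psi> \<delta> \<rho>(1) _ _ _ Q])
    show sub: "cbox a b \<times> {t0 - \<delta>..t0 + \<delta>} \<subseteq> W" using ab \<delta>W W12 by blast
    show "cball p \<rho> \<times> {t0 - \<delta>..t0 + \<delta>} \<subseteq> Q" using \<rho> \<delta>Q Q12 by blast
    show "(\<psi> (y, t), t) \<in> \<Omega> \<and> \<Phi> (\<psi> (y, t), t) = 0 \<and>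
        frechet_derivative \<Phi> (at (\<psi> (y, t), t)) (e3, 0) > 0 \<and> plane_proj e1 e2 (\<psi> (y, t) - p) = y"
      if "(y, t) \<in> W" for y t
      using props[OF that] U' XO by (auto simp: X_def d_def)
    show "(\<psi> has_derivative (\<lambda>h. plane_lift e1 e2 (fst h) -
        (frechet_derivative \<Phi> (at (\<psi> (y, t), t)) (plane_lift e1 e2 (fst h), snd h) /
         frechet_derivative \<Phi> (at (\<psi> (y, t), t)) (e3, 0)) *\<^sub>R e3)) (at (y, t))" if "(y, t) \<in> W" for y t
      using d\<psi>[OF that] by (simp add: d_def)
    fix t assume t: "t \<in> {t0 - \<delta>..t0 + \<delta>}"
    show "(\<lambda>y. \<psi> (y, t)) ` box a b = {x. (x, t) \<in> Q \<and> \<Phi> (x, t) = 0}"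
    proof safe
      fix y assume "y \<in> box a b"
      moreover then have "(y, t) \<in> W" using sub t box_subset_cbox by blast
      ultimately show "(\<psi> (y, t), t) \<in> Q" "\<Phi> (\<psi> (y, t), t) = 0"
        using props by (auto simp: Q_def)
    next
      fix x assume x: "(x, t) \<in> Q" "\<Phi> (x, t) = 0"
      define y where "y = plane_proj e1 e2 (x - p)"
      have y: "y \<in> box a b" and xU: "(x, t) \<in> U'" using x by (auto simp: Q_def y_def)
      have "f (x, t) = A (y, t)"
        using x by (simp add: f_def A_def y_def plane_lift_proj[OF e])
      then have "\<psi> (y, t) = x" using gU[OF xU] by (simp add: \<psi>_def)
      then show "x \<in> (\<lambda>y. \<psi> (y, t)) ` box a b" using y by blast
    qed
  qed
  then show ?thesis by blast
qed

subsection \<open>Integrals of derivatives of compactly supported functions\<close>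

text \<open>The integral of a function with compact support is invariant under translations, so the
  derivative of the translated integral, which is the integral of the derivative, vanishes.\<close>

lemma integral_derivative_compact_support:
  fixes Z :: "'a::euclidean_space \<Rightarrow> real"
  assumes U: "open U" "cbox a b \<subseteq> U" and Z: "Ck_on 1 U Z"
    and C: "compact C" "C \<subseteq> box a b" "\<And>y. y \<in> U - C \<Longrightarrow> Z y = 0"
  shows "integral (cbox a b) (\<lambda>y. frechet_derivative Z (at y) v) = 0"
proof -
  \<comment> \<open>Extension of \<open>Z\<close> by zero. It is differentiable everywhere because
    \<open>U\<close> and the complement of \<open>C\<close> cover the space and \<open>Z\<close>
    vanishes on their overlap.\<close>
  define X where "X y = (if y \<in> U then Z y else 0)" for y
  have C1: "Ck_on (Suc 0) U Z" using Z by simp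
  have CU: "C \<subseteq> U" using C(2) U(2) box_subset_cbox by blast
  have oC: "open (- C)" using C(1) compact_imp_closed by blast
  define D where "D y = (if y \<in> U then frechet_derivative Z (at y) v else 0)" for y
  have dX: "(X has_derivative (\<lambda>h. if y \<in> U then frechet_derivative Z (at y) h else 0)) (at y)" for y
  proof (cases "y \<in> U")
    case True
    have "(X has_derivative frechet_derivative Z (at y)) (at y)"
      by (rule has_derivative_transform_within_open[OF Ck_on_SucD(1)[OF C1 True] U(1) True])
         (simp add: X_def)
    then show ?thesis using True by simp
  next
    case False
    then have "y \<in> - C" using CU by auto
    have "(X has_derivative (\<lambda>h. 0)) (at y)"
      by (rule has_derivative_transform_within_open[OF has_derivative_const[of 0] oC \<open>y \<in> - C\<close>])
         (use C(3) in \<open>auto simp: X_def\<close>)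
    then show ?thesis using False by simp
  qed
  have D0: "D y = 0" if "y \<notin> C" for y
  proof (cases "y \<in> U")
    case True
    have o: "open (U - C)" "y \<in> U - C" using that True U(1) C(1) by (auto intro: open_Diff compact_imp_closed)
    have "(Z has_derivative (\<lambda>h. 0)) (at y)"
      by (rule has_derivative_transform_within_open[OF has_derivative_const[of 0] o])
         (use C(3) in auto)
    from frechet_derivative_at[OF this, symmetric] show ?thesis by (simp add: D_def)
  qed (simp add: D_def)
  have contD: "continuous_on UNIV D"
  proof -
    have "continuous_on U D"
      using Ck_on_SucD(2)[OF C1, of v] by (auto simp: D_def cong: continuous_on_cong)
    moreover have "continuous_on (- C) D \<longleftrightarrow> continuous_on (- C) (\<lambda>y. 0 :: real)"
      by (rule continuous_on_cong) (use D0 in auto)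
    ultimately have "continuous_on (U \<union> - C) D"
      by (intro continuous_on_open_Un U(1) oC) auto
    moreover have "U \<union> - C = UNIV" using CU by blast
    ultimately show ?thesis by simp
  qed
  have contX: "continuous_on UNIV X"
    using dX by (intro continuous_at_imp_continuous_on) (auto intro: has_derivative_continuous)
  have X0: "X y = 0" if "y \<notin> cbox a b" for y
    using that C(2,3) box_subset_cbox[of a b] by (auto simp: X_def subset_iff)
  \<comment> \<open>One box that contains all translates of \<open>cbox a b\<close> by - s v with
    |s| at most 1, so that differentiation in \<open>s\<close> takes place over a fixed
    domain.\<close>
  have "compact ((\<lambda>(y, s). y - s *\<^sub>R v) ` (cbox a b \<times> {-1..1}))"
    by (intro compact_continuous_image compact_Times)
       (auto simp: split_beta intro!: continuous_intros)
  then have "bounded ((\<lambda>(y, s). y - s *\<^sub>R v) ` (cbox a b \<times> {-1..1}))"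
    by (rule compact_imp_bounded)
  then obtain A B where AB: "(\<lambda>(y, s). y - s *\<^sub>R v) ` (cbox a b \<times> {-1..1::real}) \<subseteq> cbox A B"
    using bounded_subset_cbox_symmetric by metis
  have const: "integral (cbox A B) (\<lambda>y. X (y + s *\<^sub>R v)) = integral (cbox a b) X"
    if s: "s \<in> {-1<..<1}" for s
  proof (rule integral_unique)
    have "(X has_integral integral (cbox a b) X) (cbox a b)"
      by (intro integrable_integral integrable_continuous continuous_on_subset[OF contX]) auto
    then have "((\<lambda>y. X (y + s *\<^sub>R v)) has_integral integral (cbox a b) X) (cbox (a - s *\<^sub>R v) (b - s *\<^sub>R v))"
      using has_integral_shift_cbox_iff[of X "s *\<^sub>R v" "integral (cbox a b) X" "a - s *\<^sub>R v" "b - s *\<^sub>R v"]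
      by (simp add: o_def add.commute)
    then show "((\<lambda>y. X (y + s *\<^sub>R v)) has_integral integral (cbox a b) X) (cbox A B)"
    proof (rule has_integral_on_superset)
      have tr: "y + s *\<^sub>R v \<in> cbox a b \<longleftrightarrow> y \<in> cbox (a - s *\<^sub>R v) (b - s *\<^sub>R v)" for y
        by (simp add: mem_box inner_add_left inner_diff_left algebra_simps)
      show "X (y + s *\<^sub>R v) = 0" if "y \<notin> cbox (a - s *\<^sub>R v) (b - s *\<^sub>R v)" for y
        using that X0 tr by blast
      show "cbox (a - s *\<^sub>R v) (b - s *\<^sub>R v) \<subseteq> cbox A B"
      proof
        fix y assume "y \<in> cbox (a - s *\<^sub>R v) (b - s *\<^sub>R v)"
        then have "(y + s *\<^sub>R v, s) \<in> cbox a b \<times> {-1..1}" using tr s by auto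
        then show "y \<in> cbox A B" using AB by force
      qed
    qed
  qed
  have "((\<lambda>s. integral (cbox A B) (\<lambda>y. X (y + s *\<^sub>R v))) has_field_derivative
      integral (cbox A B) (\<lambda>y. D (y + 0 *\<^sub>R v))) (at (0::real) within {-1<..<1})"
  proof (rule leibniz_rule_field_derivative)
    fix s y assume "s \<in> {-1<..<1::real}" "y \<in> cbox A B"
    have L: "((\<lambda>s. y + s *\<^sub>R v) has_derivative (\<lambda>h. h *\<^sub>R v)) (at s)"
      by (auto intro!: derivative_eq_intros)
    interpret linear "\<lambda>h. if y + s *\<^sub>R v \<in> U then frechet_derivative Z (at (y + s *\<^sub>R v)) h else 0"
      using dX has_derivative_linear by blast
    have "((\<lambda>s. X (y + s *\<^sub>R v)) has_real_derivative D (y + s *\<^sub>R v)) (at s)"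
      by (rule has_derivative_imp_has_field_derivative[OF has_derivative_compose[OF L dX]])
         (use scaleR[of _ v] in \<open>auto simp: D_def\<close>)
    then show "((\<lambda>s. X (y + s *\<^sub>R v)) has_real_derivative D (y + s *\<^sub>R v)) (at s within {-1<..<1})"
      by (rule has_field_derivative_at_within)
  next
    show "(\<lambda>y. X (y + s *\<^sub>R v)) integrable_on cbox A B" for s
      by (intro integrable_continuous continuous_on_compose2[OF contX] continuous_intros) auto
    show "continuous_on ({-1<..<1} \<times> cbox A B) (\<lambda>(s, y). D (y + s *\<^sub>R v))"
      unfolding split_beta by (intro continuous_on_compose2[OF contD] continuous_intros) auto
  qed auto
  then have "((\<lambda>s. integral (cbox A B) (\<lambda>y. X (y + s *\<^sub>R v))) has_field_derivative
      integral (cbox A B) D) (at 0)"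
    by (subst (asm) at_within_open) auto
  moreover have "((\<lambda>s. integral (cbox A B) (\<lambda>y. X (y + s *\<^sub>R v))) has_field_derivative 0) (at 0)"
    by (rule has_field_derivative_transform_within_open[OF DERIV_const[of "integral (cbox a b) X"], where S="{-1<..<1}"])
       (use const in auto)
  ultimately have "integral (cbox A B) D = 0" by (rule DERIV_unique)
  moreover have "integral (cbox A B) D = integral (cbox a b) D"
  proof (rule integral_unique[OF has_integral_on_superset])
    show "(D has_integral integral (cbox a b) D) (cbox a b)"
      by (intro integrable_integral integrable_continuous continuous_on_subset[OF contD]) auto
    show "D y = 0" if "y \<notin> cbox a b" for y
      using D0 that C(2) box_subset_cbox by blast
    have "(y, 0) \<in> cbox a b \<times> {-1..1::real}" if "y \<in> cbox a b" for y using that by simp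
    then show "cbox a b \<subseteq> cbox A B" using AB by force
  qed
  moreover have "integral (cbox a b) D = integral (cbox a b) (\<lambda>y. frechet_derivative Z (at y) v)"
    using U(2) by (intro integral_cong) (auto simp: D_def)
  ultimately show ?thesis by simp
qed

subsection \<open>Spatial gradients in space-time\<close>

definition space_grad :: "((real^3) \<times> real \<Rightarrow> real) \<Rightarrow> (real^3) \<times> real \<Rightarrow> real^3" where
  "space_grad f z = (\<chi> i. frechet_derivative f (at z) (axis i 1, 0))"

lemma vector_derivative_expand:
  fixes d :: "real^3 \<Rightarrow> 'b::real_vector"
  assumes "linear d"
  shows "d v = (\<Sum>i\<in>UNIV. (v $ i) *\<^sub>R d (axis i 1))"
proof -
  interpret linear d by fact
  have "d v = d (\<Sum>i\<in>UNIV. (v $ i) *\<^sub>R axis i 1)"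
    using basis_expansion[of v] by (simp add: scalar_mult_eq_scaleR)
  then show ?thesis by (simp only: sum scaleR)
qed

lemma space_grad_inner:
  assumes "(f has_derivative frechet_derivative f (at z)) (at z)"
  shows "space_grad f z \<bullet> v = frechet_derivative f (at z) (v, 0)"
proof -
  interpret linear "frechet_derivative f (at z)" using assms has_derivative_linear by blast
  have "linear (\<lambda>v. frechet_derivative f (at z) (v, 0))"
  proof (rule linearI)
    show "frechet_derivative f (at z) (x + y, 0)
      = frechet_derivative f (at z) (x, 0) + frechet_derivative f (at z) (y, 0)" for x y
      using add[of "(x, 0)" "(y, 0)"] by simp
    show "frechet_derivative f (at z) (c *\<^sub>R x, 0) = c *\<^sub>R frechet_derivative f (at z) (x, 0)" for c x
      using scaleR[of c "(x, 0)"] by simp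
  qed
  from vector_derivative_expand[OF this, of v] show ?thesis
    by (simp add: space_grad_def inner_vec_def mult.commute)
qed

lemma has_derivative_space_slice:
  assumes "(f has_derivative f') (at (x, t))"
  shows "((\<lambda>x. f (x, t)) has_derivative (\<lambda>v. f' (v, 0))) (at x)"
proof -
  have "((\<lambda>x. (x, t)) has_derivative (\<lambda>v. (v, 0))) (at x)"
    by (intro has_derivative_Pair has_derivative_ident has_derivative_const)
  from has_derivative_compose[OF this, of f f'] assms show ?thesis by simp
qed

lemma has_derivative_time_slice:
  assumes "(f has_derivative f') (at (x, t))"
  shows "((\<lambda>t. f (x, t)) has_derivative (\<lambda>s. f' (0, s))) (at t)"
proof -
  have "((\<lambda>t. (x, t)) has_derivative (\<lambda>s. (0, s))) (at t)"
    by (intro has_derivative_Pair has_derivative_ident has_derivative_const)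
  from has_derivative_compose[OF this, of f f'] assms show ?thesis by simp
qed

lemma open_space_slice: "open S \<Longrightarrow> open {x. (x, t) \<in> S}"
proof -
  assume "open S"
  moreover have "continuous_on UNIV (\<lambda>x. (x, t))" by (intro continuous_intros)
  ultimately have "open ((\<lambda>x. (x, t)) -` S)" by (rule open_vimage)
  then show ?thesis by (simp add: vimage_def)
qed

lemma Ck_on_space_slice:
  fixes f :: "'a::euclidean_space \<times> real \<Rightarrow> 'b::real_normed_vector"
  assumes "open S" "Ck_on k S f"
  shows "Ck_on k {x. (x, t) \<in> S} (\<lambda>x. f (x, t))"
  using open_space_slice[OF assms(1)]
  by (intro Ck_on_compose[OF _ assms(1) _ assms(2)] Ck_on_Pair Ck_on_id Ck_on_const) auto

lemma divergence_right_frame: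
  assumes "right_frame e1 e2 e3" "(Y has_derivative Y') (at x)"
  shows "divergence Y x = Y' e1 \<bullet> e1 + Y' e2 \<bullet> e2 + Y' e3 \<bullet> e3"
proof -
  have "(Y has_derivative (\<lambda>h. jacobian Y (at x) *v h)) (at x)"
    using assms(2) jacobian_works unfolding differentiable_def by blast
  then have "Y' = (\<lambda>h. jacobian Y (at x) *v h)"
    using assms(2) has_derivative_unique by blast
  then show ?thesis
    unfolding divergence_def right_frame_trace[OF assms(1)] by simp
qed

subsection \<open>Surface integrals in a graph chart of a moving level set\<close>

lemma cross3_diff_scaleR:
  "cross3 (x - c *\<^sub>R z) (y - d *\<^sub>R z) = cross3 x y - d *\<^sub>R cross3 x z - c *\<^sub>R cross3 z y"
  by (simp add: cross3_simps forall_3)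

context level_set_chart
begin

lemma e3_orth: "e3 \<bullet> e1 = 0" "e3 \<bullet> e2 = 0" "e3 \<bullet> e3 = 1"
  using frame unfolding right_frame_def by (simp_all add: inner_commute)

abbreviation "d\<Phi> z \<equiv> frechet_derivative \<Phi> (at z)"

lemma d\<Phi>: "z \<in> \<Omega> \<Longrightarrow> (\<Phi> has_derivative d\<Phi> z) (at z)"
  by (rule smooth_on_has_derivative[OF smooth])

lemma Ck_d\<Phi>: "Ck_on k \<Omega> (\<lambda>z. d\<Phi> z v)"
  by (intro smooth_on_Ck smooth_on_frechet_derivative smooth)

lemma space_grad_inner_frame: "z \<in> \<Omega> \<Longrightarrow> space_grad \<Phi> z \<bullet> v = d\<Phi> z (v, 0)"
  by (rule space_grad_inner[OF d\<Phi>])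

lemma Ck_space_grad: "Ck_on k \<Omega> (space_grad \<Phi>)"
  unfolding space_grad_def[abs_def] by (intro Ck_on_vec_lambda open_dom Ck_d\<Phi>)

text \<open>The surface element of a graph over the plane orthogonal to \<open>e3\<close>: the
  reciprocal of the cosine of the angle between its normal and \<open>e3\<close>.\<close>

definition area_factor :: "(real^3) \<times> real \<Rightarrow> real" where
  "area_factor z = norm (space_grad \<Phi> z) / d\<Phi> z (e3, 0)"

lemma chart_space_derivative:
  assumes "(y, t) \<in> W"
  shows "((\<lambda>y. \<psi> (y, t)) has_derivative (\<lambda>h. plane_lift e1 e2 h -
        (d\<Phi> (\<psi> (y, t), t) (plane_lift e1 e2 h, 0) / d\<Phi> (\<psi> (y, t), t) (e3, 0)) *\<^sub>R e3)) (at y)"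
proof -
  have "((\<lambda>y. (y, t)) has_derivative (\<lambda>v. (v, 0))) (at y)"
    by (intro has_derivative_Pair has_derivative_ident has_derivative_const)
  from has_derivative_compose[OF this chart_derivative[OF assms]] show ?thesis by simp
qed

lemma chart_area_element:
  assumes "(y, t) \<in> W"
  shows "area_element (\<lambda>y. \<psi> (y, t)) y = area_factor (\<psi> (y, t), t)"
proof -
  let ?z = "(\<psi> (y, t), t)"
  have z: "?z \<in> \<Omega>" and pos: "d\<Phi> ?z (e3, 0) > 0" using chart[OF assms] by auto
  define g where "g = space_grad \<Phi> ?z"
  have g: "d\<Phi> ?z (v, 0) = g \<bullet> v" for v using space_grad_inner_frame[OF z] by (simp add: g_def)
  define c1 c2 where "c1 = (g \<bullet> e1) / (g \<bullet> e3)" and "c2 = (g \<bullet> e2) / (g \<bullet> e3)"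
  have g3: "g \<bullet> e3 > 0" using pos g by simp
  have l: "plane_lift e1 e2 (axis 1 1) = e1" "plane_lift e1 e2 (axis 2 1) = e2"
    by (simp_all add: plane_lift_def axis_def)
  have fd: "frechet_derivative (\<lambda>y. \<psi> (y, t)) (at y) (axis 1 1) = e1 - c1 *\<^sub>R e3"
    "frechet_derivative (\<lambda>y. \<psi> (y, t)) (at y) (axis 2 1) = e2 - c2 *\<^sub>R e3"
    by (simp_all add: frechet_derivative_at[OF chart_space_derivative[OF assms], symmetric] l g c1_def c2_def)
  note fr = frame[unfolded right_frame_def]
  have e12: "cross3 e1 e2 = e3" using fr by simp
  have "cross3 e3 e1 = (e1 \<bullet> e1) *\<^sub>R e2 - (e1 \<bullet> e2) *\<^sub>R e1"
    unfolding e12[symmetric] using Lagrange[of e1 e1 e2] cross_skew[of "cross3 e1 e2" e1] by (simp add: inner_commute)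
  then have e31: "cross3 e3 e1 = e2" using fr by simp
  have "cross3 e2 e3 = (e2 \<bullet> e2) *\<^sub>R e1 - (e2 \<bullet> e1) *\<^sub>R e2"
    unfolding e12[symmetric] using Lagrange[of e2 e1 e2] by simp
  then have e23: "cross3 e2 e3 = e1" using fr by (simp add: inner_commute)
  have e13: "cross3 e1 e3 = - e2" and e32: "cross3 e3 e2 = - e1"
    using e31 e23 cross_skew[of e1 e3] cross_skew[of e3 e2] by simp_all
  have cr: "cross3 (e1 - c1 *\<^sub>R e3) (e2 - c2 *\<^sub>R e3) = e3 + c2 *\<^sub>R e2 + c1 *\<^sub>R e1"
    unfolding cross3_diff_scaleR by (simp add: e12 e13 e32)
  \<comment> \<open>The cross product of the two tangent vectors of the graph is the gradient of
    \<Phi>, scaled so that its \<open>e3\<close>-component is 1.\<close>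
  have "e3 + c2 *\<^sub>R e2 + c1 *\<^sub>R e1 = (1 / (g \<bullet> e3)) *\<^sub>R g"
    using right_frame_expand[OF frame, of "(1 / (g \<bullet> e3)) *\<^sub>R g"] g3
    by (simp add: c1_def c2_def add_ac)
  then have "norm (e3 + c2 *\<^sub>R e2 + c1 *\<^sub>R e1) = norm g / (g \<bullet> e3)"
    using g3 by simp
  then show ?thesis
    unfolding area_element_def fd cr area_factor_def by (simp add: g_def g)
qed

lemma box_W': "t \<in> {t0 - \<delta>..t0 + \<delta>} \<Longrightarrow> y \<in> cbox a b \<Longrightarrow> (y, t) \<in> W"
  using box_W by blast

lemma smooth_chart_slice: "smooth_on {y. (y, t) \<in> W} (\<lambda>y. \<psi> (y, t))"
  unfolding smooth_on_def using Ck_on_space_slice[OF open_W smooth_on_Ck[OF smooth_chart]] by blast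

text \<open>Orthogonal projection to the plane is a left inverse of the chart, and its linear part
  is one of the derivative. This gives both the injectivity of the derivative and the continuous
  inverse.\<close>

lemma chart_local_parametrization:
  assumes t: "t \<in> {t0 - \<delta>..t0 + \<delta>}"
  shows "local_parametrization {x. \<Phi> (x, t) = 0} (box a b) (\<lambda>y. \<psi> (y, t))"
  unfolding local_parametrization_def
proof (intro conjI ballI)
  have yW: "(y, t) \<in> W" if "y \<in> box a b" for y
    using box_W'[OF t] that box_subset_cbox by blast
  have proj: "plane_proj e1 e2 (\<psi> (y, t) - p) = y" if "y \<in> box a b" for y
    using chart[OF yW[OF that]] by simp
  show "smooth_on (box a b) (\<lambda>y. \<psi> (y, t))"
    unfolding smooth_on_def
    using Ck_on_subset[OF smooth_on_Ck[OF smooth_chart_slice]] yW by blast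
  show "inj (frechet_derivative (\<lambda>y. \<psi> (y, t)) (at y))" if "y \<in> box a b" for y
  proof -
    let ?D = "\<lambda>h. plane_lift e1 e2 h - (d\<Phi> (\<psi> (y, t), t) (plane_lift e1 e2 h, 0) / d\<Phi> (\<psi> (y, t), t) (e3, 0)) *\<^sub>R e3"
    have "plane_proj e1 e2 (?D h) = h" for h
      by (simp add: vec_eq_iff forall_2 inner_diff_left e3_orth plane_lift_inner[OF frame])
    then have "inj ?D" by (rule inj_on_inverseI)
    then show ?thesis
      by (simp add: frechet_derivative_at[OF chart_space_derivative[OF yW[OF that]], symmetric])
  qed
  have im: "(\<lambda>y. \<psi> (y, t)) ` box a b = {x. \<Phi> (x, t) = 0} \<inter> {x. (x, t) \<in> Q}"
    using chart_image[OF t] by blast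
  show "openin (top_of_set {x. \<Phi> (x, t) = 0}) ((\<lambda>y. \<psi> (y, t)) ` box a b)"
    unfolding im by (rule openin_open_Int[OF open_space_slice[OF open_Q]])
  show "\<exists>\<theta>. homeomorphism (box a b) ((\<lambda>y. \<psi> (y, t)) ` box a b) (\<lambda>y. \<psi> (y, t)) \<theta>"
  proof (intro exI homeomorphismI)
    show "continuous_on (box a b) (\<lambda>y. \<psi> (y, t))"
      using Ck_on_continuous[OF smooth_on_Ck[OF smooth_chart_slice]]
      by (rule continuous_on_subset) (use yW in auto)
    show "continuous_on ((\<lambda>y. \<psi> (y, t)) ` box a b) (\<lambda>x. plane_proj e1 e2 (x - p))"
      by (intro bounded_linear.continuous_on[OF bounded_linear_plane_proj] continuous_intros)
  qed (use proj in auto)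
qed (rule open_box)

lemma continuous_on_area_factor:
  assumes t: "t \<in> {t0 - \<delta>..t0 + \<delta>}"
  shows "continuous_on (cbox a b) (\<lambda>y. area_factor (\<psi> (y, t), t))"
proof -
  have yW: "(y, t) \<in> W" if "y \<in> cbox a b" for y
    using box_W'[OF t that] .
  have c: "continuous_on (cbox a b) (\<lambda>y. (\<psi> (y, t), t))"
    using yW by (intro continuous_on_Pair continuous_on_const
        continuous_on_subset[OF Ck_on_continuous[OF smooth_on_Ck[OF smooth_chart_slice]]]) auto
  have sub: "(\<lambda>y. (\<psi> (y, t), t)) ` cbox a b \<subseteq> \<Omega>" using chart yW by auto
  have "d\<Phi> (\<psi> (y, t), t) (e3, 0) \<noteq> 0" if "y \<in> cbox a b" for y using chart[OF yW[OF that]] by simp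
  then show ?thesis
    unfolding area_factor_def
    using continuous_on_compose2[OF Ck_on_continuous[OF Ck_d\<Phi>[of 0 "(e3, 0)"]] c sub]
      continuous_on_compose2[OF Ck_on_continuous[OF Ck_space_grad[of 0]] c sub]
    by (intro continuous_on_divide continuous_on_norm) auto
qed

text \<open>The points of the zero set in \<open>cball p \<rho>\<close> lie in the patch by
  \<open>ball_Q\<close> and \<open>chart_image\<close>, so \<open>f\<close> vanishes on the rest of
  the surface. The integrand is continuous up to the closed box, which gives integrability.\<close>

lemma surface_integral_chart:
  assumes t: "t \<in> {t0 - \<delta>..t0 + \<delta>}" and cl: "closed {x. \<Phi> (x, t) = 0}"
    and f: "continuous_on {x. \<Phi> (x, t) = 0} f"
    and f0: "\<And>x. \<Phi> (x, t) = 0 \<Longrightarrow> x \<notin> cball p \<rho> \<Longrightarrow> f x = 0"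
  shows "set_integrable (surface_measure {x. \<Phi> (x, t) = 0}) {x. \<Phi> (x, t) = 0} f"
    and "surface_integral {x. \<Phi> (x, t) = 0} f
      = integral (cbox a b) (\<lambda>y. area_factor (\<psi> (y, t), t) * f (\<psi> (y, t)))"
proof -
  let ?S = "{x. \<Phi> (x, t) = 0}" and ?\<psi> = "\<lambda>y. \<psi> (y, t)"
  note lp = chart_local_parametrization[OF t]
  have yW: "(y, t) \<in> W" if "y \<in> cbox a b" for y
    using box_W'[OF t that] .
  have L: "((\<lambda>x. plane_proj e1 e2 (x - p)) has_derivative (\<lambda>h. plane_proj e1 e2 (h - 0))) (at x)" for x
    by (intro bounded_linear.has_derivative[OF bounded_linear_plane_proj] has_derivative_diff
        has_derivative_ident has_derivative_const)
  have proj: "plane_proj e1 e2 (?\<psi> y - p) = y" if "y \<in> box a b" for y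
    using chart[OF yW] that box_subset_cbox by blast
  have im: "?\<psi> ` box a b \<subseteq> ?S" using local_parametrizationD(5)[OF lp] .
  have "f x = 0" if "x \<in> ?S - ?\<psi> ` box a b" for x
    using that ball_Q t f0 unfolding chart_image[OF t] by blast
  note si = surface_integral_patch[OF cl lp L proj continuous_on_subset[OF f im] this]
  let ?h = "\<lambda>y. area_factor (\<psi> (y, t), t) * f (\<psi> (y, t))"
  have ae: "area_element ?\<psi> y = area_factor (\<psi> (y, t), t)" if "y \<in> box a b" for y
    using chart_area_element[OF yW] that box_subset_cbox by blast
  have c\<psi>: "continuous_on (cbox a b) ?\<psi>"
    using yW by (intro continuous_on_subset[OF Ck_on_continuous[OF smooth_on_Ck[OF smooth_chart_slice]]]) auto
  have cont: "continuous_on (cbox a b) ?h"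
  proof (intro continuous_on_mult continuous_on_area_factor[OF t])
    show "continuous_on (cbox a b) (\<lambda>y. f (\<psi> (y, t)))"
      by (rule continuous_on_compose2[OF f c\<psi>]) (use chart yW in auto)
  qed
  then have int: "set_integrable lborel (cbox a b) ?h"
    unfolding set_integrable_def by (intro borel_integrable_compact) auto
  then have intb: "set_integrable lborel (box a b) ?h"
    by (rule set_integrable_subset) (auto simp: box_subset_cbox)
  have eq: "(LINT y:box a b|lborel. area_element ?\<psi> y * f (?\<psi> y)) = (LINT y:box a b|lborel. ?h y)"
    by (rule set_lebesgue_integral_cong) (auto simp: ae)
  have eq': "set_integrable lborel (box a b) (\<lambda>y. area_element ?\<psi> y * f (?\<psi> y))
      \<longleftrightarrow> set_integrable lborel (box a b) ?h"
    by (rule set_integrable_cong) (auto simp: ae)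
  show "set_integrable (surface_measure ?S) ?S f"
    using si(2) eq' intb by blast
  have "surface_integral ?S f = integral (box a b) ?h"
    using si(1) eq set_borel_integral_eq_integral(2)[OF intb] by simp
  also have "\<dots> = integral (cbox a b) ?h"
    by (rule integral_open_interval)
  finally show "surface_integral ?S f = integral (cbox a b) ?h" .
qed

end

subsection \<open>Divergence theorem and transport formula in a chart\<close>

lemma continuous_on_divergence:
  fixes Y :: "real^'n \<Rightarrow> real^'n"
  assumes "Ck_on 1 S Y"
  shows "continuous_on S (divergence Y)"
proof -
  have "divergence Y = (\<lambda>x. \<Sum>i\<in>UNIV. frechet_derivative Y (at x) (axis i 1) $ i)"
    by (simp add: fun_eq_iff divergence_def trace_def jacobian_nth)
  moreover have "continuous_on S (\<lambda>x. frechet_derivative Y (at x) v)" for v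
    using assms by simp
  ultimately show ?thesis by (auto intro!: continuous_intros)
qed

lemma divergence_eq_0:
  fixes Y :: "real^3 \<Rightarrow> real^3"
  assumes "open S" "x \<in> S" "\<And>x. x \<in> S \<Longrightarrow> Y x = 0"
  shows "divergence Y x = 0"
proof -
  have "(Y has_derivative (\<lambda>h. 0)) (at x)"
    by (rule has_derivative_transform_within_open[OF has_derivative_const[of 0] assms(1,2)])
       (simp add: assms(3))
  from frechet_derivative_at[OF this, symmetric] show ?thesis
    by (simp add: divergence_def trace_def jacobian_nth)
qed

lemma open_preimage_Ck:
  assumes "Ck_on k S f" "open S" "open T"
  shows "open {x \<in> S. f x \<in> T}"
proof -
  have "open (f -` T \<inter> S)"
    using continuous_on_open_vimage[OF assms(2), of f] Ck_on_continuous[OF assms(1)] assms(3) by blast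
  then show ?thesis by (simp add: vimage_def Collect_conj_eq Int_commute)
qed

text \<open>The rate of change of \<open>\<integral> q d\<sigma>\<close> over the zero set of \<open>\<Phi> (\<cdot>, t)\<close> at a time \<open>t\<^sub>0\<close>
  at which \<open>\<Phi>\<close> is a distance function; then \<open>- \<Phi>\<^sub>t\<close> is the normal velocity.\<close>

definition transport_rate :: "((real^3) \<times> real \<Rightarrow> real) \<Rightarrow> real \<Rightarrow> ((real^3) \<times> real \<Rightarrow> real) \<Rightarrow> real^3 \<Rightarrow> real" where
  "transport_rate \<Phi> t0 q x = frechet_derivative q (at (x, t0)) (0, 1)
     - frechet_derivative \<Phi> (at (x, t0)) (0, 1) * divergence (\<lambda>x. q (x, t0) *\<^sub>R space_grad \<Phi> (x, t0)) x"

context level_set_chart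
begin

abbreviation "hess u z \<equiv> frechet_derivative (\<lambda>z. d\<Phi> z u) (at z)"

lemma has_derivative_d\<Phi>: "z \<in> \<Omega> \<Longrightarrow> ((\<lambda>z. d\<Phi> z u) has_derivative hess u z) (at z)"
  by (rule smooth_on_has_derivative[OF smooth_on_frechet_derivative[OF smooth]])

lemma hess_commute: "z \<in> \<Omega> \<Longrightarrow> hess u z v = hess v z u"
  by (rule frechet_derivative_commute[OF open_dom smooth_on_Ck[OF smooth]])

lemma linear_hess: "z \<in> \<Omega> \<Longrightarrow> linear (hess u z)"
  using has_derivative_d\<Phi> has_derivative_linear by blast

text \<open>The change of coordinates from x to (y, \<Phi>) has Jacobian determinant
  \<open>d\<Phi> z (e3, 0)\<close>. In the new coordinates \<open>Y\<close> has the components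
  \<open>Y x \<bullet> e1\<close>, \<open>Y x \<bullet> e2\<close> and
  \<open>Y x \<bullet> space_grad \<Phi> (x, t0)\<close>, the last of which is zero. By the formula
  for the divergence in curvilinear coordinates, the integrand is the planar divergence of the field
  with components \<open>Z e1\<close> and \<open>Z e2\<close>.\<close>

lemma chart_divergence:
  assumes N: "open N" "\<And>y. y \<in> cbox a b \<Longrightarrow> \<psi> (y, t0) \<in> N" "\<And>x. x \<in> N \<Longrightarrow> (x, t0) \<in> \<Omega>"
    and Y: "Ck_on 1 N Y" "\<And>x. x \<in> N \<Longrightarrow> Y x \<bullet> space_grad \<Phi> (x, t0) = 0"
    and Y0: "\<And>x. x \<in> N \<Longrightarrow> x \<notin> cball p \<rho> \<Longrightarrow> Y x = 0"
  shows "integral (cbox a b) (\<lambda>y. divergence Y (\<psi> (y, t0)) / d\<Phi> (\<psi> (y, t0), t0) (e3, 0)) = 0"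
proof -
  define d3 where "d3 x = d\<Phi> (x, t0) (e3, 0)" for x
  have t0: "t0 \<in> {t0 - \<delta>..t0 + \<delta>}" using \<delta>_pos by simp
  have NS: "N \<subseteq> {x. (x, t0) \<in> \<Omega>}" using N(3) by auto
  have Ckd: "Ck_on k N (\<lambda>x. d\<Phi> (x, t0) v)" for k v
    by (rule Ck_on_subset[OF Ck_on_space_slice[OF open_dom Ck_d\<Phi>] NS])
  define N' where "N' = {x \<in> N. d3 x \<in> {0<..}}"
  have N': "open N'"
    unfolding N'_def d3_def by (rule open_preimage_Ck[OF Ckd[of 0] N(1)]) simp
  have N'N: "N' \<subseteq> N" by (auto simp: N'_def)
  define U where "U = {y \<in> {y. (y, t0) \<in> W}. \<psi> (y, t0) \<in> N'}"
  have C\<psi>: "Ck_on k {y. (y, t0) \<in> W} (\<lambda>y. \<psi> (y, t0))" for k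
    using smooth_on_Ck[OF smooth_chart_slice] .
  have U: "open U"
    unfolding U_def by (rule open_preimage_Ck[OF C\<psi>[of 0] open_space_slice[OF open_W] N'])
  have bU: "cbox a b \<subseteq> U"
    using box_W'[OF t0] N(2) chart by (auto simp: U_def N'_def d3_def)
  have C\<psi>U: "Ck_on k U (\<lambda>y. \<psi> (y, t0))" for k
    by (rule Ck_on_subset[OF C\<psi>]) (auto simp: U_def)
  define X where "X v x = (Y x \<bullet> v) / d3 x" for v x
  have CX: "Ck_on 1 N' (X v)" for v
    unfolding X_def[abs_def]
  proof (rule Ck_on_divide[OF N'])
    show "Ck_on 1 N' (\<lambda>x. Y x \<bullet> v)"
      by (intro Ck_on_inner Ck_on_const N' Ck_on_subset[OF Y(1) N'N])
    show "Ck_on 1 N' d3"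
      unfolding d3_def[abs_def] by (rule Ck_on_subset[OF Ckd N'N])
  qed (simp add: N'_def)
  define Z where "Z v y = X v (\<psi> (y, t0))" for v y
  have CZ: "Ck_on 1 U (Z v)" for v
    unfolding Z_def[abs_def]
    by (rule Ck_on_compose[OF U N' _ CX C\<psi>U]) (auto simp: U_def)
  define C where "C = {y \<in> cbox a b. \<psi> (y, t0) \<in> cball p \<rho>}"
  have "continuous_on (cbox a b) (\<lambda>y. \<psi> (y, t0))"
    by (rule continuous_on_subset[OF Ck_on_continuous[OF C\<psi>U[of 0]] bU])
  then have "closed ((\<lambda>y. \<psi> (y, t0)) -` cball p \<rho> \<inter> cbox a b)"
    by (rule continuous_on_closed_vimage[OF closed_cbox, THEN iffD1, rule_format]) (rule closed_cball)
  moreover have "(\<lambda>y. \<psi> (y, t0)) -` cball p \<rho> \<inter> cbox a b = C" by (auto simp: C_def)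
  ultimately have clC: "closed C" by simp
  have "C \<subseteq> cbox a b" by (auto simp: C_def)
  then have C: "compact C"
    using compact_Int_closed[OF compact_cbox clC, of a b] by (simp only: Int_absorb1)
  \<comment> \<open>A point of the surface in the ball lies over the open box, and the projection
    determines its base point; so the support stays away from the boundary of the box.\<close>
  have Cb: "C \<subseteq> box a b"
  proof
    fix y assume y: "y \<in> C"
    then have yW: "(y, t0) \<in> W" using box_W'[OF t0] by (auto simp: C_def)
    have "\<psi> (y, t0) \<in> {x. (x, t0) \<in> Q \<and> \<Phi> (x, t0) = 0}"
      using y ball_Q t0 chart[OF yW] by (auto simp: C_def)
    then obtain y' where y': "y' \<in> box a b" "\<psi> (y, t0) = \<psi> (y', t0)"
      using chart_image[OF t0] by blast
    then have "(y', t0) \<in> W" using box_W'[OF t0] box_subset_cbox by blast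
    then have "y = y'" using chart[OF yW] chart[of y' t0] y'(2) by metis
    then show "y \<in> box a b" using y' by simp
  qed
  text \<open>The function \<open>Z v\<close> need not vanish on \<open>U - C\<close> outside of the box, so \<open>U\<close> is shrunk.\<close>
  define U' where "U' = {y \<in> U. \<psi> (y, t0) \<in> - cball p \<rho>} \<union> box a b"
  have U': "open U'"
    unfolding U'_def by (intro open_Un open_preimage_Ck[OF C\<psi>U[of 0] U] open_box) auto
  have U'U: "U' \<subseteq> U" using bU box_subset_cbox by (auto simp: U'_def)
  have bU': "cbox a b \<subseteq> U'" using Cb bU by (auto simp: U'_def C_def)
  have Z0: "Z v y = 0" if "y \<in> U' - C" for y v
  proof -
    have "\<psi> (y, t0) \<notin> cball p \<rho>" using that box_subset_cbox by (auto simp: U'_def C_def)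
    moreover have "\<psi> (y, t0) \<in> N" using that U'U N'N by (auto simp: U_def)
    ultimately show ?thesis using Y0 by (simp add: Z_def X_def)
  qed
  have int0: "integral (cbox a b) (\<lambda>y. frechet_derivative (Z v) (at y) w) = 0" for v w
    by (rule integral_derivative_compact_support[OF U' bU' Ck_on_subset[OF CZ U'U] C Cb Z0])
  have cont: "continuous_on (cbox a b) (\<lambda>y. frechet_derivative (Z v) (at y) w)" for v w
    using CZ[of v] by (intro continuous_on_subset[OF _ bU]) simp
  have eq: "divergence Y (\<psi> (y, t0)) / d\<Phi> (\<psi> (y, t0), t0) (e3, 0)
     = frechet_derivative (Z e1) (at y) (axis 1 1) + frechet_derivative (Z e2) (at y) (axis 2 1)"
    if y: "y \<in> cbox a b" for y
  proof -
    define x where "x = \<psi> (y, t0)"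
    have yW: "(y, t0) \<in> W" using box_W'[OF t0 y] .
    have xN': "x \<in> N'" and xN: "x \<in> N" using bU y N'N by (auto simp: U_def x_def)
    have z: "(x, t0) \<in> \<Omega>" using N(3)[OF xN] .
    define D where "D = frechet_derivative Y (at x)"
    have dY: "(Y has_derivative D) (at x)"
      using Y(1) Ck_on_SucD(1)[of 0 N Y x] xN by (simp add: D_def)
    interpret D: linear D using dY has_derivative_linear by blast
    define A where "A u v = hess (u, 0) (x, t0) (v, 0)" for u v
    have dd: "((\<lambda>x. d\<Phi> (x, t0) (u, 0)) has_derivative A u) (at x)" for u
      unfolding A_def by (rule has_derivative_space_slice[OF has_derivative_d\<Phi>[OF z]])
    interpret A3: linear "A e3" using dd has_derivative_linear by blast
    have sym: "A u v = A v u" for u v unfolding A_def by (rule hess_commute[OF z])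
    define c where "c u = d\<Phi> (x, t0) (u, 0)" for u
    have c3: "c e3 > 0" using chart[OF yW] by (simp add: c_def x_def)
    have dX: "(X v has_derivative (\<lambda>h. ((D h \<bullet> v) * c e3 - (Y x \<bullet> v) * A e3 h) / (c e3 * c e3))) (at x)" for v
      using has_derivative_divide'[OF has_derivative_inner_left[OF dY, of v] dd[of e3]] c3
      by (simp add: X_def[abs_def] d3_def c_def)
    have l: "plane_lift e1 e2 (axis 1 1) = e1" "plane_lift e1 e2 (axis 2 1) = e2"
      by (simp_all add: plane_lift_def axis_def)
    have fZ: "frechet_derivative (Z v) (at y) h =
        ((D (plane_lift e1 e2 h - (c (plane_lift e1 e2 h) / c e3) *\<^sub>R e3) \<bullet> v) * c e3
          - (Y x \<bullet> v) * A e3 (plane_lift e1 e2 h - (c (plane_lift e1 e2 h) / c e3) *\<^sub>R e3)) / (c e3 * c e3)" for v h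
    proof -
      have "((\<lambda>y. X v (\<psi> (y, t0))) has_derivative (\<lambda>h.
        ((D (plane_lift e1 e2 h - (c (plane_lift e1 e2 h) / c e3) *\<^sub>R e3) \<bullet> v) * c e3
          - (Y x \<bullet> v) * A e3 (plane_lift e1 e2 h - (c (plane_lift e1 e2 h) / c e3) *\<^sub>R e3)) / (c e3 * c e3))) (at y)"
        using has_derivative_compose[OF chart_space_derivative[OF yW] dX[unfolded x_def]]
        by (simp add: c_def x_def)
      from frechet_derivative_at[OF this, symmetric] show ?thesis
        by (simp add: Z_def[abs_def])
    qed
    have expand: "Y x \<bullet> space_grad \<Phi> (x, t0) =
        (Y x \<bullet> e1) * d\<Phi> (x, t0) (e1, 0) + (Y x \<bullet> e2) * d\<Phi> (x, t0) (e2, 0) + (Y x \<bullet> e3) * d\<Phi> (x, t0) (e3, 0)"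
      if "x \<in> N" for x
      using right_frame_inner_expand[OF frame, of "Y x" "space_grad \<Phi> (x, t0)"]
      by (simp only: space_grad_inner_frame[OF N(3)[OF that]])
    have T0: "(Y x \<bullet> e1) * c e1 + (Y x \<bullet> e2) * c e2 + (Y x \<bullet> e3) * c e3 = 0"
      using expand[OF xN] Y(2)[OF xN] by (simp add: c_def)
    have "((\<lambda>x. (Y x \<bullet> e1) * d\<Phi> (x, t0) (e1, 0) + (Y x \<bullet> e2) * d\<Phi> (x, t0) (e2, 0) + (Y x \<bullet> e3) * d\<Phi> (x, t0) (e3, 0))
      has_derivative (\<lambda>h. (Y x \<bullet> e1 * A e1 h + D h \<bullet> e1 * d\<Phi> (x, t0) (e1, 0)) + (Y x \<bullet> e2 * A e2 h + D h \<bullet> e2 * d\<Phi> (x, t0) (e2, 0))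
         + (Y x \<bullet> e3 * A e3 h + D h \<bullet> e3 * d\<Phi> (x, t0) (e3, 0)))) (at x)"
      by (intro has_derivative_add has_derivative_mult has_derivative_inner_left dY dd)
    moreover have "((\<lambda>x. (Y x \<bullet> e1) * d\<Phi> (x, t0) (e1, 0) + (Y x \<bullet> e2) * d\<Phi> (x, t0) (e2, 0) + (Y x \<bullet> e3) * d\<Phi> (x, t0) (e3, 0))
      has_derivative (\<lambda>h. 0)) (at x)"
      by (rule has_derivative_transform_within_open[OF has_derivative_const[of 0] N(1) xN])
         (use expand Y(2) in auto)
    ultimately have "(Y x \<bullet> e1 * A e1 e3 + D e3 \<bullet> e1 * c e1) + (Y x \<bullet> e2 * A e2 e3 + D e3 \<bullet> e2 * c e2)
         + (Y x \<bullet> e3 * A e3 e3 + D e3 \<bullet> e3 * c e3) = 0"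
      using has_derivative_unique by (fastforce simp: c_def dest: fun_cong[where x=e3])
    then have T1: "(Y x \<bullet> e1 * A e3 e1 + D e3 \<bullet> e1 * c e1) + (Y x \<bullet> e2 * A e3 e2 + D e3 \<bullet> e2 * c e2)
         + (Y x \<bullet> e3 * A e3 e3 + D e3 \<bullet> e3 * c e3) = 0"
      by (simp add: sym[of e1 e3] sym[of e2 e3])
    \<comment> \<open>Tangency (\<open>T0\<close>) eliminates the \<open>e3\<close>-component of
      \<open>Y\<close>, and tangency differentiated along \<open>e3\<close> (\<open>T1\<close>)
      eliminates the \<open>e3\<close>-derivative of that component. The rest is the quotient
      rule.\<close>
    have alg: "(y11 + y22 + y33) / c3 = ((y11 - c1 / c3 * y13) * c3 - Y1 * (a1 - c1 / c3 * a3)) / (c3 * c3)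
        + ((y22 - c2 / c3 * y23) * c3 - Y2 * (a2 - c2 / c3 * a3)) / (c3 * c3)"
      if "c3 > 0" "Y1 * c1 + Y2 * c2 + Y3 * c3 = 0"
        "(Y1 * a1 + y13 * c1) + (Y2 * a2 + y23 * c2) + (Y3 * a3 + y33 * c3) = 0"
      for y11 y22 y33 y13 y23 c1 c2 c3 Y1 Y2 Y3 a1 a2 a3 :: real
    proof -
      define k1 k2 where "k1 = c1 / c3" and "k2 = c2 / c3"
      have c: "c1 = k1 * c3" "c2 = k2 * c3" using that(1) by (simp_all add: k1_def k2_def)
      have "c3 * (Y1 * k1 + Y2 * k2 + Y3) = 0" using that(2) by (simp add: c algebra_simps)
      then have Y3: "Y3 = - (Y1 * k1 + Y2 * k2)" using that(1) by simp
      have "(y11 + y22 + y33) * c3 = (y11 - k1 * y13) * c3 - Y1 * (a1 - k1 * a3) + ((y22 - k2 * y23) * c3 - Y2 * (a2 - k2 * a3))"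
        using that(3) unfolding c Y3 by (simp add: algebra_simps)
      then show ?thesis
        using that(1) unfolding k1_def[symmetric] k2_def[symmetric] add_divide_distrib[symmetric]
        by (simp add: frac_eq_eq)
    qed
    have "divergence Y x / c e3 = frechet_derivative (Z e1) (at y) (axis 1 1) + frechet_derivative (Z e2) (at y) (axis 2 1)"
      unfolding divergence_right_frame[OF frame dY] fZ l D.diff D.scaleR A3.diff A3.scaleR
        inner_diff_left inner_scaleR_left real_scaleR_def
      by (rule alg[OF c3 T0 T1])
    then show ?thesis by (simp add: c_def x_def)
  qed
  have "integral (cbox a b) (\<lambda>y. divergence Y (\<psi> (y, t0)) / d\<Phi> (\<psi> (y, t0), t0) (e3, 0))
    = integral (cbox a b) (\<lambda>y. frechet_derivative (Z e1) (at y) (axis 1 1) + frechet_derivative (Z e2) (at y) (axis 2 1))"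
    by (rule integral_cong) (rule eq)
  also have "\<dots> = 0"
    by (subst integral_add) (auto intro!: integrable_continuous cont simp: int0)
  finally show ?thesis .
qed

end

lemma has_derivative_vec_lambda:
  fixes f :: "'i::finite \<Rightarrow> 'a::real_normed_vector \<Rightarrow> real"
  assumes "\<And>i. (f i has_derivative f' i) (at x)"
  shows "((\<lambda>x. \<chi> i. f i x) has_derivative (\<lambda>h. \<chi> i. f' i h)) (at x)"
proof -
  have eq: "(\<chi> i. g i) = (\<Sum>i\<in>UNIV. g i *\<^sub>R axis i 1)" for g :: "'i \<Rightarrow> real"
    by (simp add: vec_eq_iff axis_nth_if if_distrib cong: if_cong)
  show ?thesis
    unfolding eq by (intro has_derivative_sum has_derivative_scaleR_left assms)
qed

context level_set_chart
begin

text \<open>Over the fixed box one differentiates under the integral sign. The result is a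
  derivative along the path of a chart point, which moves parallel to \<open>e3\<close>; comparison
  with normal motion leaves a divergence that \<open>chart_divergence\<close> integrates to zero.
  For times closer to \<open>t0\<close> than \<eta> the surfaces stay in the domain \<open>D\<close>
  of \<open>q\<close>.\<close>

lemma chart_transport:
  assumes N: "open N" "{x. \<Phi> (x, t0) = 0} \<subseteq> N" "\<And>x. x \<in> N \<Longrightarrow> (x, t0) \<in> \<Omega>"
    and unit: "\<And>x. x \<in> N \<Longrightarrow> norm (space_grad \<Phi> (x, t0)) = 1"
    and D: "open D" "Ck_on 1 D q"
    and \<eta>: "0 < \<eta>" "\<eta> \<le> \<delta>" "\<And>x t. \<bar>t - t0\<bar> < \<eta> \<Longrightarrow> \<Phi> (x, t) = 0 \<Longrightarrow> (x, t) \<in> D"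
    and q0: "\<And>x t. (x, t) \<in> D \<Longrightarrow> x \<notin> cball p \<rho> \<Longrightarrow> q (x, t) = 0"
    and cl: "\<And>t. \<bar>t - t0\<bar> < \<eta> \<Longrightarrow> closed {x. \<Phi> (x, t) = 0}"
  shows "((\<lambda>t. surface_integral {x. \<Phi> (x, t) = 0} (\<lambda>x. q (x, t))) has_real_derivative
      surface_integral {x. \<Phi> (x, t0) = 0} (transport_rate \<Phi> t0 q)) (at t0)"
    and "set_integrable (surface_measure {x. \<Phi> (x, t0) = 0}) {x. \<Phi> (x, t0) = 0} (transport_rate \<Phi> t0 q)"
    and "\<bar>t - t0\<bar> < \<eta> \<Longrightarrow>
      set_integrable (surface_measure {x. \<Phi> (x, t) = 0}) {x. \<Phi> (x, t) = 0} (\<lambda>x. q (x, t))"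
proof -
  have t\<delta>: "t \<in> {t0 - \<delta>..t0 + \<delta>}" if "\<bar>t - t0\<bar> < \<eta>" for t using that \<eta> by auto
  have t0: "t0 \<in> {t0 - \<delta>..t0 + \<delta>}" "\<bar>t0 - t0\<bar> < \<eta>" using \<delta>_pos \<eta> by auto
  have dq: "(q has_derivative frechet_derivative q (at z)) (at z)" if "z \<in> D" for z
    using D(2) Ck_on_SucD(1)[of 0 D q z] that by simp
  have contq: "continuous_on {x. \<Phi> (x, t) = 0} (\<lambda>x. q (x, t))" if "\<bar>t - t0\<bar> < \<eta>" for t
    by (rule continuous_on_subset[OF Ck_on_continuous[OF Ck_on_space_slice[OF D]]])
       (use \<eta>(3)[OF that] in auto)
  have si: "set_integrable (surface_measure {x. \<Phi> (x, t) = 0}) {x. \<Phi> (x, t) = 0} (\<lambda>x. q (x, t))"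
    "surface_integral {x. \<Phi> (x, t) = 0} (\<lambda>x. q (x, t))
      = integral (cbox a b) (\<lambda>y. area_factor (\<psi> (y, t), t) * q (\<psi> (y, t), t))" if t: "\<bar>t - t0\<bar> < \<eta>" for t
    using surface_integral_chart[OF t\<delta>[OF t] cl[OF t] contq[OF t]] q0 \<eta>(3)[OF t] by auto
  then show "\<bar>t - t0\<bar> < \<eta> \<Longrightarrow>
      set_integrable (surface_measure {x. \<Phi> (x, t) = 0}) {x. \<Phi> (x, t) = 0} (\<lambda>x. q (x, t))"
    by blast

  define D' where "D' = {z \<in> D \<inter> \<Omega>. d\<Phi> z (e3, 0) \<in> {0<..}}"
  have D': "open D'"
    unfolding D'_def
    by (rule open_preimage_Ck[OF Ck_on_subset[OF Ck_d\<Phi>[of 0]]]) (use D(1) open_dom in auto)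
  have D'D: "D' \<subseteq> D" and D'\<Omega>: "D' \<subseteq> \<Omega>" by (auto simp: D'_def)
  have sg0: "space_grad \<Phi> z \<noteq> 0" if "z \<in> D'" for z
    using that space_grad_inner_frame[of z e3] by (auto simp: D'_def)
  have Cg: "Ck_on k D' (\<lambda>z. norm (space_grad \<Phi> z))" for k
    by (rule Ck_on_norm[OF D' sg0 Ck_on_subset[OF Ck_space_grad D'\<Omega>]])
  have Ca: "Ck_on k D' area_factor" for k
    unfolding area_factor_def[abs_def]
    by (rule Ck_on_divide[OF D' _ Cg Ck_on_subset[OF Ck_d\<Phi> D'\<Omega>]]) (simp add: D'_def)
  define B where "B z = area_factor z * q z" for z
  have CB: "Ck_on 1 D' B"
    unfolding B_def[abs_def] by (rule Ck_on_mult[OF D' Ca Ck_on_subset[OF D(2) D'D]])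
  define P where "P w = (\<psi> w, snd w)" for w
  have CP: "Ck_on k W P" for k
    unfolding P_def[abs_def]
    by (intro Ck_on_Pair open_W smooth_on_Ck[OF smooth_chart] Ck_on_snd Ck_on_id)
  define W' where "W' = {w \<in> W. P w \<in> D'}"
  have W': "open W'" unfolding W'_def by (rule open_preimage_Ck[OF CP[of 0] open_W D'])
  define K where "K w = B (P w)" for w
  have CK: "Ck_on 1 W' K"
    unfolding K_def[abs_def]
    by (rule Ck_on_compose[OF W' D' _ CB Ck_on_subset[OF CP]]) (auto simp: W'_def)
  define T where "T = {t0 - \<eta><..<t0 + \<eta>}"
  have T: "\<bar>t - t0\<bar> < \<eta> \<longleftrightarrow> t \<in> T" for t by (auto simp: T_def)
  have bW: "(y, t) \<in> W" and bW': "(y, t) \<in> W'" if "y \<in> cbox a b" "t \<in> T" for y t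
  proof -
    have t: "\<bar>t - t0\<bar> < \<eta>" using that T by simp
    show "(y, t) \<in> W" using box_W'[OF t\<delta>[OF t] that(1)] .
    then show "(y, t) \<in> W'" using chart \<eta>(3)[OF t] by (auto simp: W'_def D'_def P_def)
  qed
  have dK: "(K has_derivative frechet_derivative K (at w)) (at w)" if "w \<in> W'" for w
    using CK Ck_on_SucD(1)[of 0 W' K w] that by simp
  have contK': "continuous_on W' (\<lambda>w. frechet_derivative K (at w) (0, 1))"
    using CK by simp
  have J': "((\<lambda>t. integral (cbox a b) (\<lambda>y. K (y, t))) has_field_derivative
      integral (cbox a b) (\<lambda>y. frechet_derivative K (at (y, t0)) (0, 1))) (at t0 within T)"
  proof (rule leibniz_rule_field_derivative)
    fix t y assume ty: "t \<in> T" "y \<in> cbox a b"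
    interpret linear "frechet_derivative K (at (y, t))"
      using dK[OF bW'[OF ty(2,1)]] has_derivative_linear by blast
    have "s * frechet_derivative K (at (y, t)) (0, 1) = frechet_derivative K (at (y, t)) (0, s)" for s
      using scaleR[of s "(0, 1)"] by simp
    then have "((\<lambda>t. K (y, t)) has_field_derivative frechet_derivative K (at (y, t)) (0, 1)) (at t)"
      by (rule has_derivative_imp_has_field_derivative[OF has_derivative_time_slice[OF dK[OF bW'[OF ty(2,1)]]]])
    then show "((\<lambda>t. K (y, t)) has_field_derivative frechet_derivative K (at (y, t)) (0, 1)) (at t within T)"
      by (rule has_field_derivative_at_within)
  next
    fix t assume t: "t \<in> T"
    show "(\<lambda>y. K (y, t)) integrable_on cbox a b"
      by (intro integrable_continuous continuous_on_compose2[OF Ck_on_continuous[OF CK]] continuous_intros)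
         (use bW' t in auto)
  next
    have "continuous_on (T \<times> cbox a b) (\<lambda>z. frechet_derivative K (at (snd z, fst z)) (0, 1))"
    proof (rule continuous_on_compose2[OF contK'])
      show "continuous_on (T \<times> cbox a b) (\<lambda>z. (snd z, fst z))" by (intro continuous_intros)
      show "(\<lambda>z. (snd z, fst z)) ` (T \<times> cbox a b) \<subseteq> W'" using bW' by auto
    qed
    then show "continuous_on (T \<times> cbox a b) (\<lambda>(t, y). frechet_derivative K (at (y, t)) (0, 1))"
      by (simp add: split_beta)
  qed (use \<eta> in \<open>auto simp: T_def\<close>)
  have oT: "open T" and t0T: "t0 \<in> T" using \<eta> by (auto simp: T_def)
  have J'': "((\<lambda>t. surface_integral {x. \<Phi> (x, t) = 0} (\<lambda>x. q (x, t))) has_field_derivative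
      integral (cbox a b) (\<lambda>y. frechet_derivative K (at (y, t0)) (0, 1))) (at t0)"
  proof (rule has_field_derivative_transform_within_open[OF _ oT t0T])
    show "((\<lambda>t. integral (cbox a b) (\<lambda>y. K (y, t))) has_field_derivative
      integral (cbox a b) (\<lambda>y. frechet_derivative K (at (y, t0)) (0, 1))) (at t0)"
      using J' at_within_open[OF t0T oT] by simp
    show "integral (cbox a b) (\<lambda>y. K (y, t)) = surface_integral {x. \<Phi> (x, t) = 0} (\<lambda>x. q (x, t))"
      if "t \<in> T" for t
      using si(2)[of t] that T by (simp add: K_def B_def P_def)
  qed

  let ?S = "{x. \<Phi> (x, t0) = 0}" and ?R = "transport_rate \<Phi> t0 q"
  define N1 where "N1 = N \<inter> {x. (x, t0) \<in> D}"
  have N1: "open N1" unfolding N1_def by (intro open_Int N(1) open_space_slice D(1))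
  have SN1: "?S \<subseteq> N1" using N(2) \<eta>(3)[OF t0(2)] by (auto simp: N1_def)
  have N1\<Omega>: "N1 \<subseteq> {x. (x, t0) \<in> \<Omega>}" and N1D: "N1 \<subseteq> {x. (x, t0) \<in> D}" using N(3) by (auto simp: N1_def)
  have Cq1: "Ck_on 1 N1 (\<lambda>x. q (x, t0))"
    by (rule Ck_on_subset[OF Ck_on_space_slice[OF D] N1D])
  have Csg: "Ck_on k N1 (\<lambda>x. space_grad \<Phi> (x, t0))" for k
    by (rule Ck_on_subset[OF Ck_on_space_slice[OF open_dom Ck_space_grad] N1\<Omega>])
  have Cd1: "Ck_on k N1 (\<lambda>x. d\<Phi> (x, t0) v)" for k v
    by (rule Ck_on_subset[OF Ck_on_space_slice[OF open_dom Ck_d\<Phi>] N1\<Omega>])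
  define V where "V x = q (x, t0) *\<^sub>R space_grad \<Phi> (x, t0)" for x
  have CV: "Ck_on 1 N1 V"
    unfolding V_def[abs_def] by (rule Ck_on_scaleR[OF N1 Cq1 Csg])
  have contR: "continuous_on ?S ?R"
  proof (rule continuous_on_subset[OF _ SN1])
    have "continuous_on D (\<lambda>z. frechet_derivative q (at z) (0, 1))" using D(2) by simp
    then have "continuous_on N1 (\<lambda>x. frechet_derivative q (at (x, t0)) (0, 1))"
    proof (rule continuous_on_compose2)
      show "continuous_on N1 (\<lambda>x. (x, t0))" by (intro continuous_intros)
      show "(\<lambda>x. (x, t0)) ` N1 \<subseteq> D" by (auto simp: N1_def)
    qed
    then show "continuous_on N1 ?R"
      unfolding transport_rate_def[abs_def] V_def[symmetric]
      by (intro continuous_on_diff continuous_on_mult continuous_on_divergence[OF CV]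
          Ck_on_continuous[OF Cd1])
  qed
  have R0: "?R x = 0" if "\<Phi> (x, t0) = 0" "x \<notin> cball p \<rho>" for x
  proof -
    have xD: "(x, t0) \<in> D" using \<eta>(3)[OF t0(2) that(1)] .
    have o: "open (D \<inter> fst -` (- cball p \<rho>))" "(x, t0) \<in> D \<inter> fst -` (- cball p \<rho>)"
      using xD that(2) D(1) by (auto intro!: open_Int open_vimage_fst)
    have "(q has_derivative (\<lambda>h. 0)) (at (x, t0))"
      by (rule has_derivative_transform_within_open[OF has_derivative_const[of 0] o])
         (use q0 in auto)
    moreover have "divergence (\<lambda>x. q (x, t0) *\<^sub>R space_grad \<Phi> (x, t0)) x = 0"
      by (rule divergence_eq_0[OF open_space_slice[OF o(1), of t0]]) (use o(2) q0 in auto)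
    ultimately show ?thesis
      using frechet_derivative_at by (fastforce simp: transport_rate_def dest: fun_cong[where x="(0, 1)"])
  qed
  note siR = surface_integral_chart[OF t0(1) cl[OF t0(2)] contR R0]
  show "set_integrable (surface_measure ?S) ?S ?R" by (rule siR(1))

  text \<open>In the chart, points move along \<open>e3\<close> instead of the normal. This changes the integrand by
    the divergence of the tangential field \<open>Y\<close>.\<close>
  define d3 where "d3 x = d\<Phi> (x, t0) (e3, 0)" for x
  define \<tau> where "\<tau> x = d\<Phi> (x, t0) (0, 1)" for x
  define N2 where "N2 = {x \<in> N1. d3 x \<in> {0<..}}"
  have N2: "open N2" unfolding N2_def d3_def by (rule open_preimage_Ck[OF Cd1[of 0] N1]) simp
  have N21: "N2 \<subseteq> N1" by (auto simp: N2_def)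
  have d3n: "d3 x \<noteq> 0" if "x \<in> N2" for x using that by (auto simp: N2_def)
  \<comment> \<open>\<open>q\<close> times the difference between the velocity of a chart point,
    -(\<tau> / d3) e3, and the normal velocity vector, -\<tau> grad \<Phi>. Both have inner product
    -\<tau> with grad \<Phi>, because |grad \<Phi>| = 1, so the difference is tangential.\<close>
  define Y where "Y x = \<tau> x *\<^sub>R V x - ((q (x, t0) * \<tau> x) / d3 x) *\<^sub>R e3" for x
  have C\<tau>2: "Ck_on k N2 \<tau>" and Cd32: "Ck_on k N2 d3" for k
    unfolding \<tau>_def[abs_def] d3_def[abs_def] by (rule Ck_on_subset[OF Cd1 N21])+
  have CY: "Ck_on 1 N2 Y"
    unfolding Y_def[abs_def]
    by (rule Ck_on_diff[OF N2 Ck_on_scaleR[OF N2 C\<tau>2 Ck_on_subset[OF CV N21]]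
          Ck_on_scaleR[OF N2 Ck_on_divide[OF N2 d3n Ck_on_mult[OF N2 Ck_on_subset[OF Cq1 N21] C\<tau>2] Cd32]
            Ck_on_const[OF N2]]])
  have chN2: "\<psi> (y, t0) \<in> N2" if "y \<in> cbox a b" for y
    using chart[OF bW[OF that t0T]] SN1 by (auto simp: N2_def d3_def)
  have div0: "integral (cbox a b) (\<lambda>y. divergence Y (\<psi> (y, t0)) / d\<Phi> (\<psi> (y, t0), t0) (e3, 0)) = 0"
  proof (rule chart_divergence[OF N2 chN2 _ CY])
    show "(x, t0) \<in> \<Omega>" if "x \<in> N2" for x using that N21 N1\<Omega> by auto
    show "Y x = 0" if "x \<in> N2" "x \<notin> cball p \<rho>" for x
      using that N21 N1D q0 by (auto simp: Y_def V_def)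
    show "Y x \<bullet> space_grad \<Phi> (x, t0) = 0" if x: "x \<in> N2" for x
    proof -
      have xN: "x \<in> N" using x N21 by (auto simp: N1_def)
      have "space_grad \<Phi> (x, t0) \<bullet> space_grad \<Phi> (x, t0) = 1"
        using unit[OF xN] by (simp add: norm_eq_1)
      moreover have "e3 \<bullet> space_grad \<Phi> (x, t0) = d3 x"
        using space_grad_inner_frame[OF N(3)[OF xN], of e3] by (simp add: d3_def inner_commute)
      ultimately show ?thesis
        using d3n[OF x] by (simp add: Y_def V_def inner_diff_left)
    qed
  qed
  have eq: "frechet_derivative K (at (y, t0)) (0, 1)
      = area_factor (\<psi> (y, t0), t0) * ?R (\<psi> (y, t0)) + divergence Y (\<psi> (y, t0)) / d\<Phi> (\<psi> (y, t0), t0) (e3, 0)"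
    if y: "y \<in> cbox a b" for y
  proof -
    define x where "x = \<psi> (y, t0)"
    let ?z = "(x, t0)"
    have yW: "(y, t0) \<in> W" and yW': "(y, t0) \<in> W'" using bW bW' y t0T by auto
    have xN2: "x \<in> N2" and xN1: "x \<in> N1" and xN: "x \<in> N" and xD: "?z \<in> D" and z: "?z \<in> \<Omega>"
      using chN2[OF y] N21 N1\<Omega> by (auto simp: x_def N1_def)
    have zD': "?z \<in> D'" using yW' by (simp add: W'_def P_def x_def)
    define Dq where "Dq = frechet_derivative q (at ?z)"
    have dq: "(q has_derivative Dq) (at ?z)" unfolding Dq_def by (rule dq[OF xD])
    interpret Dq: linear Dq using dq has_derivative_linear by blast
    define g where "g = (\<lambda>z. norm (space_grad \<Phi> z))"
    have "Ck_on (Suc 0) D' g" using Cg by (simp add: g_def)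
    then have dg: "(g has_derivative frechet_derivative g (at ?z)) (at ?z)"
      using Ck_on_SucD(1) zD' by blast
    define Dg where "Dg = frechet_derivative g (at ?z)"
    note dg = dg[folded Dg_def]
    interpret Dg: linear Dg using dg has_derivative_linear by blast
    have g1: "g ?z = 1" using unit[OF xN] by (simp add: g_def)
    note dd3 = has_derivative_d\<Phi>[OF z, of "(e3, 0)"] and d\<tau> = has_derivative_d\<Phi>[OF z, of "(0, 1)"]
    interpret H3: linear "hess (e3, 0) ?z" by (rule linear_hess[OF z])
    interpret H\<tau>: linear "hess (0, 1) ?z" by (rule linear_hess[OF z])
    define c \<tau>0 where "c = d\<Phi> ?z (e3, 0)" and "\<tau>0 = d\<Phi> ?z (0, 1)"
    have c0: "c > 0" using xN2 by (simp add: N2_def d3_def c_def)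
    define S where "S = hess (0, 1) ?z (space_grad \<Phi> ?z, 0)"

    \<comment> \<open>At \<open>t0\<close> the norm of the gradient is locally constant in space.
      Its time derivative \<open>S\<close>, which is the derivative of \<Phi>_t along the gradient,
      remains and enters the derivative of the area factor.\<close>
    have Dg_space: "Dg (v, 0) = 0" for v
    proof -
      have "((\<lambda>x. g (x, t0)) has_derivative (\<lambda>v. Dg (v, 0))) (at x)"
        by (rule has_derivative_space_slice[OF dg])
      moreover have "((\<lambda>x. g (x, t0)) has_derivative (\<lambda>v. 0)) (at x)"
        by (rule has_derivative_transform_within_open[OF has_derivative_const[of 1] N(1) xN])
           (simp add: unit g_def)
      ultimately have "(\<lambda>v. Dg (v, 0)) = (\<lambda>v. 0)" by (rule has_derivative_unique)
      from fun_cong[OF this, of v] show ?thesis .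
    qed
    have Dg_time: "Dg (0, 1) = S"
    proof -
      have dsg: "((\<lambda>z. space_grad \<Phi> z) has_derivative (\<lambda>h. \<chi> i. hess (axis i 1, 0) ?z h)) (at ?z)"
        unfolding space_grad_def
        by (rule has_derivative_vec_lambda) (rule has_derivative_d\<Phi>[OF z])
      have "((\<lambda>z. space_grad \<Phi> z \<bullet> space_grad \<Phi> z) has_derivative
          (\<lambda>h. space_grad \<Phi> ?z \<bullet> (\<chi> i. hess (axis i 1, 0) ?z h) + (\<chi> i. hess (axis i 1, 0) ?z h) \<bullet> space_grad \<Phi> ?z)) (at ?z)"
        by (rule has_derivative_inner[OF dsg dsg])
      moreover have "((\<lambda>z. g z * g z) has_derivative (\<lambda>h. g ?z * Dg h + Dg h * g ?z)) (at ?z)"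
        by (rule has_derivative_mult[OF dg dg])
      moreover have "(\<lambda>z. g z * g z) = (\<lambda>z. space_grad \<Phi> z \<bullet> space_grad \<Phi> z)"
        by (simp add: g_def fun_eq_iff power2_norm_eq_inner[symmetric] power2_eq_square)
      ultimately have "(\<lambda>h. space_grad \<Phi> ?z \<bullet> (\<chi> i. hess (axis i 1, 0) ?z h) + (\<chi> i. hess (axis i 1, 0) ?z h) \<bullet> space_grad \<Phi> ?z)
        = (\<lambda>h. g ?z * Dg h + Dg h * g ?z)"
        by (simp only:) (rule has_derivative_unique)
      from fun_cong[OF this, of "(0, 1)"]
      have "Dg (0, 1) = (\<chi> i. hess (axis i 1, 0) ?z (0, 1)) \<bullet> space_grad \<Phi> ?z"
        by (simp add: g1 inner_commute)
      also have "(\<chi> i. hess (axis i 1, 0) ?z (0, 1)) = space_grad (\<lambda>z. d\<Phi> z (0, 1)) ?z"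
        by (simp add: space_grad_def vec_eq_iff hess_commute[OF z, of _ "(0, 1)"])
      also have "\<dots> \<bullet> space_grad \<Phi> ?z = S"
        unfolding S_def by (rule space_grad_inner[OF d\<tau>])
      finally show ?thesis .
    qed

    have dB: "(B has_derivative (\<lambda>h. area_factor ?z * Dq h +
        (Dg h * c - 1 * hess (e3, 0) ?z h) / (c * c) * q ?z)) (at ?z)"
    proof -
      have "(area_factor has_derivative (\<lambda>h. (Dg h * c - g ?z * hess (e3, 0) ?z h) / (c * c))) (at ?z)"
        using has_derivative_divide'[OF dg dd3] c0 by (simp add: area_factor_def[abs_def] g_def c_def)
      from has_derivative_mult[OF this dq] g1 show ?thesis
        unfolding B_def[abs_def] by (simp only:)
    qed
    \<comment> \<open>The space-time velocity of a chart point, from implicit differentiation of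
      \<Phi> = 0 along \<open>e3\<close>.\<close>
    define h where "h = (- (\<tau>0 / c)) *\<^sub>R (e3, 0) + (0, 1::real)"
    have pl0: "plane_lift e1 e2 0 = 0" by (simp add: plane_lift_def)
    have "(P has_derivative (\<lambda>h. (plane_lift e1 e2 (fst h) -
        (d\<Phi> ?z (plane_lift e1 e2 (fst h), snd h) / c) *\<^sub>R e3, snd h))) (at (y, t0))"
      unfolding P_def[abs_def] using chart_derivative[OF yW] unfolding x_def[symmetric] c_def[symmetric]
      by (intro has_derivative_Pair has_derivative_snd has_derivative_ident)
    from has_derivative_compose[OF this, of B] dB
    have "(K has_derivative (\<lambda>k. (\<lambda>h. area_factor ?z * Dq h +
        (Dg h * c - 1 * hess (e3, 0) ?z h) / (c * c) * q ?z) (plane_lift e1 e2 (fst k) -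
        (d\<Phi> ?z (plane_lift e1 e2 (fst k), snd k) / c) *\<^sub>R e3, snd k))) (at (y, t0))"
      unfolding K_def[abs_def] by (simp add: P_def x_def)
    from fun_cong[OF frechet_derivative_at[OF this], of "(0, 1)"]
    have "frechet_derivative K (at (y, t0)) (0, 1) = area_factor ?z * Dq h +
        (Dg h * c - hess (e3, 0) ?z h) / (c * c) * q ?z"
      by (simp add: pl0 h_def \<tau>0_def)
    moreover have "Dg h = S" unfolding h_def Dg.add Dg.scaleR by (simp add: Dg_space Dg_time)
    moreover have "Dq h = - (\<tau>0 / c) * Dq (e3, 0) + Dq (0, 1)"
      unfolding h_def Dq.add Dq.scaleR by simp
    moreover have "hess (e3, 0) ?z h = - (\<tau>0 / c) * hess (e3, 0) ?z (e3, 0) + hess (0, 1) ?z (e3, 0)"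
      unfolding h_def H3.add H3.scaleR by (simp add: hess_commute[OF z, of "(0, 1)" "(e3, 0)"])
    moreover have ar: "area_factor ?z = 1 / c"
      using g1 by (simp add: area_factor_def g_def c_def)
    ultimately have LHS: "frechet_derivative K (at (y, t0)) (0, 1) = (- (\<tau>0 / c) * Dq (e3, 0) + Dq (0, 1)) / c +
        (S * c - (- (\<tau>0 / c) * hess (e3, 0) ?z (e3, 0) + hess (0, 1) ?z (e3, 0))) / (c * c) * q ?z"
      by simp

    have dq': "((\<lambda>x. q (x, t0)) has_derivative (\<lambda>v. Dq (v, 0))) (at x)"
      by (rule has_derivative_space_slice[OF dq])
    have d\<tau>': "(\<tau> has_derivative (\<lambda>v. hess (0, 1) ?z (v, 0))) (at x)"
      unfolding \<tau>_def[abs_def] by (rule has_derivative_space_slice[OF d\<tau>])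
    have dd3': "(d3 has_derivative (\<lambda>v. hess (e3, 0) ?z (v, 0))) (at x)"
      unfolding d3_def[abs_def] by (rule has_derivative_space_slice[OF dd3])
    have "Ck_on (Suc 0) N1 V" using CV by simp
    then have dV: "(V has_derivative frechet_derivative V (at x)) (at x)"
      using Ck_on_SucD(1) xN1 by blast
    define DV where "DV = frechet_derivative V (at x)"
    note dV = dV[folded DV_def]
    have dY: "(Y has_derivative (\<lambda>v. (\<tau> x *\<^sub>R DV v + hess (0, 1) ?z (v, 0) *\<^sub>R V x) -
       (((q ?z * hess (0, 1) ?z (v, 0) + Dq (v, 0) * \<tau> x) * d3 x - (q ?z * \<tau> x) * hess (e3, 0) ?z (v, 0)) / (d3 x * d3 x)) *\<^sub>R e3)) (at x)"
      unfolding Y_def[abs_def]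
      by (intro has_derivative_diff has_derivative_scaleR has_derivative_scaleR_left
          has_derivative_divide' has_derivative_mult dV d\<tau>' dq' dd3' d3n[OF xN2])
    have cs: "\<tau> x = \<tau>0" "d3 x = c" by (simp_all add: \<tau>_def \<tau>0_def d3_def c_def)
    have lin: "linear (\<lambda>v. hess (0, 1) ?z (v, 0))" using d\<tau>' has_derivative_linear by blast
    \<comment> \<open>The term with \<open>S\<close> is matched by the derivative of \<tau> along
      \<open>V\<close>, which is one part of the divergence of \<tau> times
      \<open>V\<close>.\<close>
    have "q ?z * S = hess (0, 1) ?z (V x, 0)"
      using linear_scale[OF lin, of "q ?z" "space_grad \<Phi> ?z"] by (simp add: V_def S_def)
    also have "\<dots> = (V x \<bullet> e1) * hess (0, 1) ?z (e1, 0) + (V x \<bullet> e2) * hess (0, 1) ?z (e2, 0)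
        + (V x \<bullet> e3) * hess (0, 1) ?z (e3, 0)"
      using arg_cong[OF right_frame_expand[OF frame, of "V x"], of "\<lambda>v. hess (0, 1) ?z (v, 0)"]
      by (simp only: linear_add[OF lin] linear_scale[OF lin] real_scaleR_def)
    finally have qS: "q ?z * S = (V x \<bullet> e1) * hess (0, 1) ?z (e1, 0) + (V x \<bullet> e2) * hess (0, 1) ?z (e2, 0)
        + (V x \<bullet> e3) * hess (0, 1) ?z (e3, 0)" .
    have divY: "divergence Y x = \<tau>0 * divergence V x + q ?z * S -
       ((q ?z * hess (0, 1) ?z (e3, 0) + Dq (e3, 0) * \<tau>0) * c - (q ?z * \<tau>0) * hess (e3, 0) ?z (e3, 0)) / (c * c)"
      unfolding divergence_right_frame[OF frame dY] divergence_right_frame[OF frame dV] qS cs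
      by (simp add: inner_diff_left inner_add_left e3_orth algebra_simps)
    have R: "?R x = Dq (0, 1) - \<tau>0 * divergence V x"
      by (simp add: transport_rate_def Dq_def \<tau>0_def V_def[abs_def])
    have alg: "(- (T / c) * q3 + qt) / c + (S * c - (- (T / c) * \<alpha> + \<beta>)) / (c * c) * Q
      = 1 / c * (qt - T * d) + (T * d + Q * S - ((Q * \<beta> + q3 * T) * c - (Q * T) * \<alpha>) / (c * c)) / c"
      if "c > 0" for T c q3 qt S \<alpha> \<beta> Q d :: real
      using that by (simp add: field_simps)
    show ?thesis
      unfolding x_def[symmetric] LHS ar R divY c_def[symmetric] by (rule alg[OF c0])
  qed
  let ?DK = "\<lambda>y. frechet_derivative K (at (y, t0)) (0, 1)" and ?AR = "\<lambda>y. area_factor (\<psi> (y, t0), t0) * ?R (\<psi> (y, t0))"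
  have i1: "?DK integrable_on cbox a b"
    by (intro integrable_continuous continuous_on_compose2[OF contK'] continuous_intros) (use bW' t0T in auto)
  have i2: "?AR integrable_on cbox a b"
  proof (intro integrable_continuous continuous_on_mult continuous_on_area_factor[OF t0(1)])
    have "continuous_on (cbox a b) (\<lambda>y. \<psi> (y, t0))"
      by (rule continuous_on_subset[OF Ck_on_continuous[OF smooth_on_Ck[OF smooth_chart_slice]]])
         (use bW t0T in auto)
    then show "continuous_on (cbox a b) (\<lambda>y. ?R (\<psi> (y, t0)))"
      by (rule continuous_on_compose2[OF contR]) (use bW t0T chart in auto)
  qed
  have "integral (cbox a b) ?DK - integral (cbox a b) ?AR = integral (cbox a b) (\<lambda>y. ?DK y - ?AR y)"
    by (rule integral_diff[OF i1 i2, symmetric])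
  also have "\<dots> = integral (cbox a b) (\<lambda>y. divergence Y (\<psi> (y, t0)) / d\<Phi> (\<psi> (y, t0), t0) (e3, 0))"
    by (rule integral_cong) (simp add: eq)
  finally have "integral (cbox a b) ?DK = surface_integral ?S ?R"
    using div0 siR(2) by simp
  then show "((\<lambda>t. surface_integral {x. \<Phi> (x, t) = 0} (\<lambda>x. q (x, t))) has_real_derivative
      surface_integral ?S ?R) (at t0)"
    using J'' by simp
qed

end

text \<open>With |grad \<Phi>| = 1 the area factor reduces to the weight
  \<open>1 / d\<Phi> z (e3, 0)\<close> that occurs in \<open>chart_divergence\<close>.\<close>

lemma (in level_set_chart) chart_surface_divergence:
  assumes N: "open N" "{x. \<Phi> (x, t0) = 0} \<subseteq> N" "\<And>x. x \<in> N \<Longrightarrow> (x, t0) \<in> \<Omega>"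
    and unit: "\<And>x. x \<in> N \<Longrightarrow> norm (space_grad \<Phi> (x, t0)) = 1"
    and Y: "Ck_on 1 N Y" "\<And>x. x \<in> N \<Longrightarrow> Y x \<bullet> space_grad \<Phi> (x, t0) = 0"
    and Y0: "\<And>x. x \<in> N \<Longrightarrow> x \<notin> cball p \<rho> \<Longrightarrow> Y x = 0"
    and cl: "closed {x. \<Phi> (x, t0) = 0}"
  shows "set_integrable (surface_measure {x. \<Phi> (x, t0) = 0}) {x. \<Phi> (x, t0) = 0} (divergence Y)"
    and "surface_integral {x. \<Phi> (x, t0) = 0} (divergence Y) = 0"
proof -
  have t0: "t0 \<in> {t0 - \<delta>..t0 + \<delta>}" using \<delta>_pos by auto
  have D0: "divergence Y x = 0" if "\<Phi> (x, t0) = 0" "x \<notin> cball p \<rho>" for x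
  proof (rule divergence_eq_0)
    show "open (N - cball p \<rho>)" using N(1) by (intro open_Diff) auto
  qed (use that N(2) Y0 in auto)
  note si = surface_integral_chart[OF t0 cl continuous_on_subset[OF continuous_on_divergence[OF Y(1)] N(2)] D0]
  show "set_integrable (surface_measure {x. \<Phi> (x, t0) = 0}) {x. \<Phi> (x, t0) = 0} (divergence Y)"
    by (rule si(1))
  have \<psi>N: "\<psi> (y, t0) \<in> N" if "y \<in> cbox a b" for y
    using chart[OF box_W'[OF t0 that]] N(2) by auto
  note si(2)
  also have "integral (cbox a b) (\<lambda>y. area_factor (\<psi> (y, t0), t0) * divergence Y (\<psi> (y, t0)))
      = integral (cbox a b) (\<lambda>y. divergence Y (\<psi> (y, t0)) / d\<Phi> (\<psi> (y, t0), t0) (e3, 0))"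
    by (rule integral_cong) (simp add: area_factor_def unit \<psi>N)
  finally show "surface_integral {x. \<Phi> (x, t0) = 0} (divergence Y) = 0"
    using chart_divergence[OF N(1) \<psi>N N(3) Y Y0] by simp
qed

subsection \<open>Globalization\<close>

lemma divergence_sum:
  fixes Y :: "'i \<Rightarrow> real^3 \<Rightarrow> real^3"
  assumes "open S" "x \<in> S" "\<And>i. i \<in> A \<Longrightarrow> Ck_on 1 S (Y i)"
    and "\<And>x. x \<in> S \<Longrightarrow> Z x = (\<Sum>i\<in>A. Y i x)"
  shows "divergence Z x = (\<Sum>i\<in>A. divergence (Y i) x)"
proof -
  have "(Y i has_derivative frechet_derivative (Y i) (at x)) (at x)" if "i \<in> A" for i
    using assms(3)[OF that] Ck_on_SucD(1)[of 0 S "Y i" x] assms(2) by simp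
  then have "((\<lambda>x. \<Sum>i\<in>A. Y i x) has_derivative (\<lambda>h. \<Sum>i\<in>A. frechet_derivative (Y i) (at x) h)) (at x)"
    by (rule has_derivative_sum)
  then have "(Z has_derivative (\<lambda>h. \<Sum>i\<in>A. frechet_derivative (Y i) (at x) h)) (at x)"
    by (rule has_derivative_transform_within_open[OF _ assms(1,2)]) (simp add: assms(4))
  from frechet_derivative_at[OF this, symmetric]
  have "divergence Z x = (\<Sum>k\<in>UNIV. \<Sum>i\<in>A. frechet_derivative (Y i) (at x) (axis k 1) $ k)"
    by (simp add: divergence_def trace_def jacobian_nth)
  also have "\<dots> = (\<Sum>i\<in>A. divergence (Y i) x)"
    by (subst sum.swap) (simp add: divergence_def trace_def jacobian_nth)
  finally show ?thesis .
qed

lemma surface_integral_sum: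
  assumes "\<And>i. i \<in> A \<Longrightarrow> set_integrable (surface_measure S) S (f i)"
    and "\<And>x. x \<in> S \<Longrightarrow> g x = (\<Sum>i\<in>A. f i x)"
  shows "set_integrable (surface_measure S) S g"
    and "surface_integral S g = (\<Sum>i\<in>A. surface_integral S (f i))"
proof -
  have eq: "indicator S x *\<^sub>R g x = (\<Sum>i\<in>A. indicator S x *\<^sub>R f i x)" for x
    using assms(2)[of x] by (cases "x \<in> S") auto
  show "set_integrable (surface_measure S) S g"
    using assms(1) unfolding set_integrable_def eq by (rule Bochner_Integration.integrable_sum)
  show "surface_integral S g = (\<Sum>i\<in>A. surface_integral S (f i))"
    using assms(1) unfolding set_integrable_def surface_integral_def set_lebesgue_integral_def eq
    by (rule Bochner_Integration.integral_sum)
qed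

locale moving_level_set =
  fixes \<Phi> :: "(real^3) \<times> real \<Rightarrow> real" and I :: "real set" and t0 :: real
    and K N :: "(real^3) set"
  assumes open_I: "open I" and t0_I: "t0 \<in> I" and smooth_\<Phi>: "smooth_on (UNIV \<times> I) \<Phi>"
    and compact_K: "compact K" and level_set_K: "\<And>t. t \<in> I \<Longrightarrow> {x. \<Phi> (x, t) = 0} \<subseteq> K"
    and open_N: "open N" and level_set_N: "{x. \<Phi> (x, t0) = 0} \<subseteq> N"
    and unit_grad: "\<And>x. x \<in> N \<Longrightarrow> norm (space_grad \<Phi> (x, t0)) = 1"
begin

abbreviation "\<Gamma> t \<equiv> {x. \<Phi> (x, t) = 0}"

lemma open_space_time: "open ((UNIV :: (real^3) set) \<times> I)"
  by (intro open_Times open_UNIV open_I)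

lemma closed_level_set: "t \<in> I \<Longrightarrow> closed (\<Gamma> t)"
proof -
  assume t: "t \<in> I"
  have "Ck_on 0 {x. (x, t) \<in> UNIV \<times> I} (\<lambda>x. \<Phi> (x, t))"
    by (rule Ck_on_space_slice[OF open_space_time smooth_on_Ck[OF smooth_\<Phi>]])
  then have "continuous_on UNIV (\<lambda>x. \<Phi> (x, t))" using t by simp
  then show ?thesis by (intro closed_Collect_eq continuous_on_const)
qed

lemma compact_level_set: "t \<in> I \<Longrightarrow> compact (\<Gamma> t)"
  using closed_level_set level_set_K compact_K
  by (metis compact_Int_closed inf.absorb_iff2)

lemma chart_at:
  assumes "p \<in> \<Gamma> t0"
  shows "\<exists>\<rho> \<delta> e1 e2 e3 \<psi> W a b Q. level_set_chart \<Phi> (UNIV \<times> I) p t0 e1 e2 e3 \<psi> W a b \<delta> \<rho> Q"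
proof -
  let ?n = "space_grad \<Phi> (p, t0)"
  have n: "norm ?n = 1" using assms level_set_N unit_grad by blast
  then obtain e1 e2 where e: "right_frame e1 e2 ?n" using right_frame_exists by blast
  have z: "(p, t0) \<in> UNIV \<times> I" using t0_I by simp
  have "frechet_derivative \<Phi> (at (p, t0)) (?n, 0) = ?n \<bullet> ?n"
    using space_grad_inner[OF smooth_on_has_derivative[OF smooth_\<Phi> z], of ?n] by simp
  then have pos: "frechet_derivative \<Phi> (at (p, t0)) (?n, 0) > 0" using n by (simp add: norm_eq_1)
  have p0: "\<Phi> (p, t0) = 0" using assms by simp
  show ?thesis
    using moving_level_set_chart[OF open_space_time smooth_\<Phi> z p0 e pos] by blast
qed

text \<open>\<rho> and \<delta> stay visible because the balls form the cover behind the partition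
  of unity, and the least \<delta> bounds the time interval in the transport formula.\<close>

definition has_chart :: "real^3 \<Rightarrow> real \<Rightarrow> real \<Rightarrow> bool" where
  "has_chart p \<rho> \<delta> \<longleftrightarrow> (\<exists>e1 e2 e3 \<psi> W a b Q. level_set_chart \<Phi> (UNIV \<times> I) p t0 e1 e2 e3 \<psi> W a b \<delta> \<rho> Q)"

text \<open>Bumps divided by their sum, which is positive on the union \<open>U\<close> of the
  balls. Having sum 1 on an open set, rather than on the surface alone, lets the resulting
  decompositions be differentiated.\<close>

lemma partition_of_unity:
  obtains P \<rho> \<delta> U \<kappa> where "finite P" "open U" "\<Gamma> t0 \<subseteq> U"
    "\<And>p. p \<in> P \<Longrightarrow> has_chart p (\<rho> p) (\<delta> p)"
    "\<And>p. p \<in> P \<Longrightarrow> Ck_on 1 U (\<kappa> p)" "\<And>p. p \<in> P \<Longrightarrow> \<delta> p > 0"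
    "\<And>p x. p \<in> P \<Longrightarrow> x \<notin> cball p (\<rho> p) \<Longrightarrow> \<kappa> p x = 0"
    "\<And>x. x \<in> U \<Longrightarrow> (\<Sum>p\<in>P. \<kappa> p x) = (1::real)"
proof -
  have "\<exists>\<rho> \<delta>. has_chart p \<rho> \<delta>" if "p \<in> \<Gamma> t0" for p
    unfolding has_chart_def by (rule chart_at[OF that])
  then obtain \<rho> \<delta> where ch: "\<And>p. p \<in> \<Gamma> t0 \<Longrightarrow> has_chart p (\<rho> p) (\<delta> p)" by metis
  have pos: "\<rho> p > 0" "\<delta> p > 0" if p: "p \<in> \<Gamma> t0" for p
  proof -
    obtain e1 e2 e3 \<psi> W a b Q where "level_set_chart \<Phi> (UNIV \<times> I) p t0 e1 e2 e3 \<psi> W a b (\<delta> p) (\<rho> p) Q"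
      using ch[OF p] unfolding has_chart_def by blast
    then interpret level_set_chart \<Phi> "UNIV \<times> I" p t0 e1 e2 e3 \<psi> W a b "\<delta> p" "\<rho> p" Q .
    show "\<rho> p > 0" "\<delta> p > 0" by (rule \<rho>_pos, rule \<delta>_pos)
  qed
  have "\<Gamma> t0 \<subseteq> (\<Union>p\<in>\<Gamma> t0. ball p (\<rho> p))" using pos by fastforce
  then obtain P where P: "P \<subseteq> \<Gamma> t0" "finite P" "\<Gamma> t0 \<subseteq> (\<Union>p\<in>P. ball p (\<rho> p))"
    using compactE_image[OF compact_level_set[OF t0_I], of "\<Gamma> t0" "\<lambda>p. ball p (\<rho> p)"] by auto
  define U where "U = (\<Union>p\<in>P. ball p (\<rho> p))"
  have U: "open U" by (auto simp: U_def)
  define \<beta> where "\<beta> x = (\<Sum>p\<in>P. bump p (\<rho> p) x)" for x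
  have \<beta>: "\<beta> x \<noteq> 0" if x: "x \<in> U" for x
  proof -
    obtain p where p: "p \<in> P" "x \<in> ball p (\<rho> p)" using x by (auto simp: U_def)
    then have "bump p (\<rho> p) x > 0" using bump_pos_iff[of "\<rho> p" p x] pos P(1) by blast
    then have "\<beta> x > 0"
      unfolding \<beta>_def using P(2) p(1) bump_nonneg by (intro sum_pos2[of P p]) auto
    then show ?thesis by simp
  qed
  define \<kappa> where "\<kappa> p x = bump p (\<rho> p) x / \<beta> x" for p x
  show thesis
  proof (rule that[OF P(2) U, of \<rho> \<delta> \<kappa>])
    show "\<Gamma> t0 \<subseteq> U" using P(3) by (simp add: U_def)
    show "has_chart p (\<rho> p) (\<delta> p)" if "p \<in> P" for p using ch that P(1) by blast
    show "\<delta> p > 0" if "p \<in> P" for p using pos that P(1) by blast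
    show "Ck_on 1 U (\<kappa> p)" for p
      unfolding \<kappa>_def[abs_def]
    proof (rule Ck_on_divide[OF U \<beta> Ck_on_1_bump[OF U]])
      show "Ck_on 1 U \<beta>"
        unfolding \<beta>_def[abs_def] by (rule Ck_on_sum[OF U Ck_on_1_bump[OF U]])
    qed
    show "\<kappa> p x = 0" if "p \<in> P" "x \<notin> cball p (\<rho> p)" for p x
      using that pos P(1) bump_eq_0[of "\<rho> p" x p] by (auto simp: \<kappa>_def)
    show "(\<Sum>p\<in>P. \<kappa> p x) = 1" if "x \<in> U" for x
      using \<beta>[OF that] by (simp add: \<kappa>_def sum_divide_distrib[symmetric] \<beta>_def[symmetric])
  qed
qed

text \<open>The points of the zero sets outside \<open>D\<close>, at times in a closed interval
  around \<open>t0\<close>, form a compact set, because all the surfaces lie in \<open>K\<close>.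
  Its projection to the time axis is closed and does not contain \<open>t0\<close>.\<close>

lemma level_sets_stay_close:
  assumes "open D" "\<And>x. x \<in> \<Gamma> t0 \<Longrightarrow> (x, t0) \<in> D"
  shows "\<exists>\<eta>>0. \<forall>t. \<bar>t - t0\<bar> < \<eta> \<longrightarrow> t \<in> I \<and> (\<forall>x\<in>\<Gamma> t. (x, t) \<in> D)"
proof -
  obtain r where r: "r > 0" "cball t0 r \<subseteq> I"
    using open_I t0_I open_contains_cball by blast
  define E where "E = {z \<in> K \<times> cball t0 r. \<Phi> z = 0} - D"
  have cK: "compact (K \<times> cball t0 r)" by (intro compact_Times compact_K compact_cball)
  have "continuous_on (K \<times> cball t0 r) \<Phi>"
    by (rule continuous_on_subset[OF Ck_on_continuous[OF smooth_on_Ck[OF smooth_\<Phi>]]]) (use r in auto)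
  then have "closed {z \<in> K \<times> cball t0 r. \<Phi> z = 0}"
    by (rule continuous_closed_preimage_constant) (rule compact_imp_closed[OF cK])
  then have "closed E" unfolding E_def using assms(1) by (rule closed_Diff)
  moreover have "E \<subseteq> K \<times> cball t0 r" by (auto simp: E_def)
  ultimately have "compact E" using cK compact_Int_closed[of "K \<times> cball t0 r" E] by (simp add: Int_absorb1)
  then have "compact (snd ` E)" by (intro compact_continuous_image continuous_on_snd continuous_on_id)
  then have o: "open (- (snd ` E))" using compact_imp_closed by blast
  moreover have "t0 \<in> - (snd ` E)" using assms(2) by (auto simp: E_def)
  ultimately obtain e where e: "e > 0" "ball t0 e \<subseteq> - (snd ` E)"
    using open_contains_ball by blast
  have "t \<in> I \<and> (\<forall>x\<in>\<Gamma> t. (x, t) \<in> D)" if t: "\<bar>t - t0\<bar> < min r e" for t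
  proof -
    have tr: "t \<in> cball t0 r" and te: "t \<in> ball t0 e" using t by (auto simp: dist_real_def)
    then have tI: "t \<in> I" using r by blast
    have "(x, t) \<in> D" if x: "x \<in> \<Gamma> t" for x
    proof (rule ccontr)
      assume "(x, t) \<notin> D"
      then have "(x, t) \<in> E" using x tr level_set_K[OF tI] by (auto simp: E_def)
      then have "t \<in> snd ` E" by force
      then show False using te e(2) by blast
    qed
    then show ?thesis using tI by blast
  qed
  moreover have "min r e > 0" using r e by simp
  ultimately show ?thesis by blast
qed

text \<open>A cut-off multiple of a tangential field is tangential, so each piece falls under the
  chart result. Near the surface the pieces add up to \<open>Y\<close>, so the gradients of the
  cut-offs never have to be computed.\<close>

theorem surface_integral_divergence:
  assumes Y: "Ck_on 1 N Y" "\<And>x. x \<in> N \<Longrightarrow> Y x \<bullet> space_grad \<Phi> (x, t0) = 0"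
  shows "set_integrable (surface_measure (\<Gamma> t0)) (\<Gamma> t0) (divergence Y)"
    and "surface_integral (\<Gamma> t0) (divergence Y) = 0"
proof -
  obtain P \<rho> \<delta> U \<kappa> where P: "finite P" and U: "open U" "\<Gamma> t0 \<subseteq> U"
    and ch: "\<And>p. p \<in> P \<Longrightarrow> has_chart p (\<rho> p) (\<delta> p)"
    and \<kappa>: "\<And>p. p \<in> P \<Longrightarrow> Ck_on 1 U (\<kappa> p)"
      "\<And>p x. p \<in> P \<Longrightarrow> x \<notin> cball p (\<rho> p) \<Longrightarrow> \<kappa> p x = 0"
      "\<And>x. x \<in> U \<Longrightarrow> (\<Sum>p\<in>P. \<kappa> p x) = (1::real)"
    using partition_of_unity by metis
  define N' where "N' = N \<inter> U"
  have N': "open N'" "\<Gamma> t0 \<subseteq> N'" "N' \<subseteq> N" "N' \<subseteq> U"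
    using open_N U level_set_N by (auto simp: N'_def)
  have CY: "Ck_on 1 N' (\<lambda>x. \<kappa> p x *\<^sub>R Y x)" if "p \<in> P" for p
    by (rule Ck_on_scaleR[OF N'(1) Ck_on_subset[OF \<kappa>(1)[OF that] N'(4)] Ck_on_subset[OF Y(1) N'(3)]])
  have loc: "set_integrable (surface_measure (\<Gamma> t0)) (\<Gamma> t0) (divergence (\<lambda>x. \<kappa> p x *\<^sub>R Y x))
      \<and> surface_integral (\<Gamma> t0) (divergence (\<lambda>x. \<kappa> p x *\<^sub>R Y x)) = 0" if p: "p \<in> P" for p
  proof -
    obtain e1 e2 e3 \<psi> W a b Q where "level_set_chart \<Phi> (UNIV \<times> I) p t0 e1 e2 e3 \<psi> W a b (\<delta> p) (\<rho> p) Q"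
      using ch[OF p] unfolding has_chart_def by blast
    then interpret level_set_chart \<Phi> "UNIV \<times> I" p t0 e1 e2 e3 \<psi> W a b "\<delta> p" "\<rho> p" Q .
    show ?thesis
      using chart_surface_divergence[OF N'(1,2) _ _ CY[OF p] _ _ closed_level_set[OF t0_I]]
        t0_I unit_grad N'(3) Y(2) \<kappa>(2)[OF p] by (auto simp: subset_iff)
  qed
  have sum: "divergence Y x = (\<Sum>p\<in>P. divergence (\<lambda>x. \<kappa> p x *\<^sub>R Y x) x)" if "x \<in> \<Gamma> t0" for x
  proof (rule divergence_sum[OF N'(1) _ CY])
    show "Y x = (\<Sum>p\<in>P. \<kappa> p x *\<^sub>R Y x)" if "x \<in> N'" for x
      using \<kappa>(3)[of x] that N'(4) by (simp add: scaleR_sum_left[symmetric] subset_iff)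
  qed (use that N' in auto)
  show "set_integrable (surface_measure (\<Gamma> t0)) (\<Gamma> t0) (divergence Y)"
    by (rule surface_integral_sum(1)[OF _ sum]) (use loc in blast)
  show "surface_integral (\<Gamma> t0) (divergence Y) = 0"
    using surface_integral_sum(2)[of P "\<Gamma> t0" "\<lambda>p. divergence (\<lambda>x. \<kappa> p x *\<^sub>R Y x)" "divergence Y"] loc sum
    by simp
qed

theorem surface_integral_transport:
  assumes D: "open D" "Ck_on 1 D q" "\<And>x. x \<in> \<Gamma> t0 \<Longrightarrow> (x, t0) \<in> D"
  shows "((\<lambda>t. surface_integral (\<Gamma> t) (\<lambda>x. q (x, t))) has_real_derivative
      surface_integral (\<Gamma> t0) (transport_rate \<Phi> t0 q)) (at t0)"
    and "set_integrable (surface_measure (\<Gamma> t0)) (\<Gamma> t0) (transport_rate \<Phi> t0 q)"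
proof -
  obtain P \<rho> \<delta> U \<kappa> where P: "finite P" and U: "open U" "\<Gamma> t0 \<subseteq> U"
    and ch: "\<And>p. p \<in> P \<Longrightarrow> has_chart p (\<rho> p) (\<delta> p)"
    and \<kappa>1: "\<And>p. p \<in> P \<Longrightarrow> Ck_on 1 U (\<kappa> p)"
    and \<delta>: "\<And>p. p \<in> P \<Longrightarrow> \<delta> p > 0"
    and \<kappa>0: "\<And>p x. p \<in> P \<Longrightarrow> x \<notin> cball p (\<rho> p) \<Longrightarrow> \<kappa> p x = 0"
    and \<kappa>_sum: "\<And>x. x \<in> U \<Longrightarrow> (\<Sum>p\<in>P. \<kappa> p x) = (1::real)"
    by (rule partition_of_unity, rule that)
  define D1 where "D1 = D \<inter> U \<times> I"
  have D1: "open D1" "D1 \<subseteq> D" and D1U: "\<And>z. z \<in> D1 \<Longrightarrow> fst z \<in> U"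
    using D(1) U(1) open_I by (auto simp: D1_def open_Int open_Times)
  define Q where "Q p z = \<kappa> p (fst z) * q z" for p z
  have CQ: "Ck_on 1 D1 (Q p)" if "p \<in> P" for p
    unfolding Q_def[abs_def]
  proof (rule Ck_on_mult[OF D1(1) _ Ck_on_subset[OF D(2) D1(2)]])
    show "Ck_on 1 D1 (\<lambda>z. \<kappa> p (fst z))"
      by (rule Ck_on_compose[OF D1(1) U(1) _ \<kappa>1[OF that] Ck_on_fst[OF D1(1) Ck_on_id[OF D1(1)]]])
         (use D1U in auto)
  qed
  have Qsum: "q z = (\<Sum>p\<in>P. Q p z)" if "z \<in> D1" for z
    using \<kappa>_sum[OF D1U[OF that]] by (simp add: Q_def sum_distrib_right[symmetric])
  have "(x, t0) \<in> D1" if "x \<in> \<Gamma> t0" for x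
    using D(3)[OF that] U(2) that t0_I by (auto simp: D1_def)
  then obtain \<eta>0 where \<eta>0: "\<eta>0 > 0" "\<And>t. \<bar>t - t0\<bar> < \<eta>0 \<Longrightarrow> t \<in> I"
    "\<And>t x. \<bar>t - t0\<bar> < \<eta>0 \<Longrightarrow> x \<in> \<Gamma> t \<Longrightarrow> (x, t) \<in> D1"
    using level_sets_stay_close[OF D1(1)] by blast
  \<comment> \<open>Within this distance from \<open>t0\<close> the surfaces stay where the cut-offs
    add up to 1, and all of the finitely many charts are valid.\<close>
  define \<eta> where "\<eta> = Min (insert \<eta>0 (\<delta> ` P))"
  have \<eta>: "\<eta> > 0" "\<eta> \<le> \<eta>0" "\<And>p. p \<in> P \<Longrightarrow> \<eta> \<le> \<delta> p"
    using P \<eta>0(1) \<delta> by (auto simp: \<eta>_def)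
  have loc: "((\<lambda>t. surface_integral (\<Gamma> t) (\<lambda>x. Q p (x, t))) has_real_derivative
        surface_integral (\<Gamma> t0) (transport_rate \<Phi> t0 (Q p))) (at t0)"
      "set_integrable (surface_measure (\<Gamma> t0)) (\<Gamma> t0) (transport_rate \<Phi> t0 (Q p))"
      "\<And>t. \<bar>t - t0\<bar> < \<eta> \<Longrightarrow> set_integrable (surface_measure (\<Gamma> t)) (\<Gamma> t) (\<lambda>x. Q p (x, t))"
    if p: "p \<in> P" for p
  proof -
    obtain e1 e2 e3 \<psi> W a b R where "level_set_chart \<Phi> (UNIV \<times> I) p t0 e1 e2 e3 \<psi> W a b (\<delta> p) (\<rho> p) R"
      using ch[OF p] unfolding has_chart_def by blast
    then interpret level_set_chart \<Phi> "UNIV \<times> I" p t0 e1 e2 e3 \<psi> W a b "\<delta> p" "\<rho> p" R .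
    have h: "(x, t0) \<in> UNIV \<times> I" for x :: "real^3" using t0_I by simp
    have h2: "(x, t) \<in> D1" if "\<bar>t - t0\<bar> < \<eta>" "\<Phi> (x, t) = 0" for x t
      using \<eta>0(3)[of t x] that \<eta>(2) by auto
    have h3: "Q p (x, t) = 0" if "(x, t) \<in> D1" "x \<notin> cball p (\<rho> p)" for x t
      using \<kappa>0[OF p that(2)] by (simp add: Q_def)
    have h4: "closed (\<Gamma> t)" if "\<bar>t - t0\<bar> < \<eta>" for t
      using closed_level_set \<eta>0(2)[of t] that \<eta>(2) by auto
    note T = chart_transport[OF open_N level_set_N h unit_grad D1(1) CQ[OF p] \<eta>(1) \<eta>(3)[OF p] h2 h3 h4]
    show "((\<lambda>t. surface_integral (\<Gamma> t) (\<lambda>x. Q p (x, t))) has_real_derivative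
        surface_integral (\<Gamma> t0) (transport_rate \<Phi> t0 (Q p))) (at t0)"
      "set_integrable (surface_measure (\<Gamma> t0)) (\<Gamma> t0) (transport_rate \<Phi> t0 (Q p))"
      using T(1,2) by blast+
    show "set_integrable (surface_measure (\<Gamma> t)) (\<Gamma> t) (\<lambda>x. Q p (x, t))" if "\<bar>t - t0\<bar> < \<eta>" for t
      using T(3) that by blast
  qed
  have J: "surface_integral (\<Gamma> t) (\<lambda>x. q (x, t)) = (\<Sum>p\<in>P. surface_integral (\<Gamma> t) (\<lambda>x. Q p (x, t)))"
    if t: "\<bar>t - t0\<bar> < \<eta>" for t
    using t \<eta>(2) \<eta>0(3)[of t] by (intro surface_integral_sum(2) loc(3) Qsum) auto
  have rate: "transport_rate \<Phi> t0 q x = (\<Sum>p\<in>P. transport_rate \<Phi> t0 (Q p) x)" if x: "x \<in> \<Gamma> t0" for x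
  proof -
    have z: "(x, t0) \<in> D1" using \<eta>0(3)[of t0 x] \<eta>0(1) x by simp
    have dQ: "(Q p has_derivative frechet_derivative (Q p) (at (x, t0))) (at (x, t0))" if "p \<in> P" for p
      using CQ[OF that] Ck_on_SucD(1)[of 0 D1 "Q p"] z by simp
    have "((\<lambda>z. \<Sum>p\<in>P. Q p z) has_derivative
        (\<lambda>h. \<Sum>p\<in>P. frechet_derivative (Q p) (at (x, t0)) h)) (at (x, t0))"
      by (rule has_derivative_sum[OF dQ])
    then have "(q has_derivative (\<lambda>h. \<Sum>p\<in>P. frechet_derivative (Q p) (at (x, t0)) h)) (at (x, t0))"
      by (rule has_derivative_transform_within_open[OF _ D1(1) z]) (simp add: Qsum)
    from frechet_derivative_at[OF this, symmetric]
    have 1: "frechet_derivative q (at (x, t0)) (0, 1) = (\<Sum>p\<in>P. frechet_derivative (Q p) (at (x, t0)) (0, 1))"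
      by simp
    let ?S = "{x. (x, t0) \<in> D1}"
    have oS: "open ?S" by (rule open_space_slice[OF D1(1)])
    have Csg: "Ck_on 1 ?S (\<lambda>x. space_grad \<Phi> (x, t0))"
    proof (rule Ck_on_subset[OF Ck_on_space_slice[OF open_space_time]])
      show "Ck_on 1 (UNIV \<times> I) (space_grad \<Phi>)"
        unfolding space_grad_def[abs_def]
        by (intro Ck_on_vec_lambda open_space_time smooth_on_Ck smooth_on_frechet_derivative smooth_\<Phi>)
    qed (auto simp: t0_I)
    have 2: "divergence (\<lambda>x. q (x, t0) *\<^sub>R space_grad \<Phi> (x, t0)) x
        = (\<Sum>p\<in>P. divergence (\<lambda>x. Q p (x, t0) *\<^sub>R space_grad \<Phi> (x, t0)) x)"
    proof (rule divergence_sum[OF oS])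
      show "Ck_on 1 ?S (\<lambda>x. Q p (x, t0) *\<^sub>R space_grad \<Phi> (x, t0))" if "p \<in> P" for p
        by (rule Ck_on_scaleR[OF oS Ck_on_space_slice[OF D1(1) CQ[OF that]] Csg])
    qed (use z Qsum in \<open>auto simp: scaleR_sum_left\<close>)
    show ?thesis
      unfolding transport_rate_def 1 2 by (simp add: sum_subtractf sum_distrib_left)
  qed
  show "set_integrable (surface_measure (\<Gamma> t0)) (\<Gamma> t0) (transport_rate \<Phi> t0 q)"
    by (rule surface_integral_sum(1)[OF loc(2) rate])
  have "((\<lambda>t. \<Sum>p\<in>P. surface_integral (\<Gamma> t) (\<lambda>x. Q p (x, t))) has_real_derivative
      (\<Sum>p\<in>P. surface_integral (\<Gamma> t0) (transport_rate \<Phi> t0 (Q p)))) (at t0)"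
    by (rule DERIV_sum[OF loc(1)])
  then have "((\<lambda>t. \<Sum>p\<in>P. surface_integral (\<Gamma> t) (\<lambda>x. Q p (x, t))) has_real_derivative
      surface_integral (\<Gamma> t0) (transport_rate \<Phi> t0 q)) (at t0)"
    by (simp only: surface_integral_sum(2)[OF loc(2) rate])
  moreover have "open {t0 - \<eta><..<t0 + \<eta>}" "t0 \<in> {t0 - \<eta><..<t0 + \<eta>}" using \<eta>(1) by auto
  ultimately show "((\<lambda>t. surface_integral (\<Gamma> t) (\<lambda>x. q (x, t))) has_real_derivative
      surface_integral (\<Gamma> t0) (transport_rate \<Phi> t0 q)) (at t0)"
    by (rule has_field_derivative_transform_within_open) (subst J, auto)
qed

end

subsection \<open>Partial derivatives\<close>

abbreviation pd :: "3 \<Rightarrow> (real^3 \<Rightarrow> real) \<Rightarrow> real^3 \<Rightarrow> real" where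
  "pd j f x \<equiv> frechet_derivative f (at x) (axis j 1)"

lemma Ck_on_1_has_derivative:
  "Ck_on 1 N f \<Longrightarrow> x \<in> N \<Longrightarrow> (f has_derivative frechet_derivative f (at x)) (at x)"
  using Ck_on_SucD(1)[of 0 N f x] by simp

lemma pd_eqI: "(f has_derivative f') (at x) \<Longrightarrow> pd j f x = f' (axis j 1)"
  by (simp add: frechet_derivative_at[symmetric])

lemma pd_mult:
  "Ck_on 1 N f \<Longrightarrow> Ck_on 1 N g \<Longrightarrow> x \<in> N \<Longrightarrow> pd j (\<lambda>x. f x * g x) x = f x * pd j g x + pd j f x * g x"
  using pd_eqI[OF has_derivative_mult] Ck_on_1_has_derivative by fast

lemma pd_add:
  "Ck_on 1 N f \<Longrightarrow> Ck_on 1 N g \<Longrightarrow> x \<in> N \<Longrightarrow> pd j (\<lambda>x. f x + g x) x = pd j f x + pd j g x"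
  using pd_eqI[OF has_derivative_add] Ck_on_1_has_derivative by fast

lemma pd_diff:
  "Ck_on 1 N f \<Longrightarrow> Ck_on 1 N g \<Longrightarrow> x \<in> N \<Longrightarrow> pd j (\<lambda>x. f x - g x) x = pd j f x - pd j g x"
  using pd_eqI[OF has_derivative_diff] Ck_on_1_has_derivative by fast

lemma pd_sum:
  assumes "\<And>i. i \<in> A \<Longrightarrow> Ck_on 1 N (f i)" "x \<in> N"
  shows "pd j (\<lambda>x. \<Sum>i\<in>A. f i x) x = (\<Sum>i\<in>A. pd j (f i) x)"
proof (rule pd_eqI[OF has_derivative_sum])
  show "(f i has_derivative frechet_derivative (f i) (at x)) (at x)" if "i \<in> A" for i
    by (rule Ck_on_1_has_derivative[OF assms(1)[OF that] assms(2)])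
qed

lemma pd_cong:
  assumes "open N" "Ck_on 1 N f" "x \<in> N" "\<And>x. x \<in> N \<Longrightarrow> f x = g x"
  shows "pd j f x = pd j g x"
proof -
  have "(g has_derivative frechet_derivative f (at x)) (at x)"
    by (rule has_derivative_transform_within_open[OF Ck_on_1_has_derivative[OF assms(2,3)] assms(1,3)])
       (rule assms(4))
  from pd_eqI[OF this] show ?thesis by simp
qed

lemma pd_eq_0:
  assumes "open N" "x \<in> N" "\<And>x. x \<in> N \<Longrightarrow> f x = c"
  shows "pd j f x = 0"
  using pd_cong[OF assms(1) Ck_on_const[OF assms(1)] assms(2), of c f] assms(3) pd_eqI[OF has_derivative_const]
  by metis

lemma Ck_on_pd: "Ck_on (Suc k) N f \<Longrightarrow> Ck_on k N (\<lambda>x. pd j f x)"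
  by simp

lemma pd_commute:
  assumes "open N" "Ck_on 2 N f" "x \<in> N"
  shows "pd i (\<lambda>x. pd j f x) x = pd j (\<lambda>x. pd i f x) x"
  by (rule frechet_derivative_commute[OF assms])

lemma divergence_eq_sum_pd:
  assumes "Ck_on 1 N Y" "x \<in> N"
  shows "divergence Y x = (\<Sum>i\<in>UNIV. pd i (\<lambda>x. Y x $ i) x)"
proof -
  have "pd i (\<lambda>x. Y x $ i) x = frechet_derivative Y (at x) (axis i 1) $ i" for i
    by (rule pd_eqI[OF bounded_linear.has_derivative[OF bounded_linear_vec_nth
          Ck_on_1_has_derivative[OF assms]]])
  then show ?thesis by (simp add: divergence_def trace_def jacobian_nth)
qed

lemma jacobian_eq_pd:
  assumes "Ck_on 1 N Y" "x \<in> N"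
  shows "jacobian Y (at x) $ i $ j = pd j (\<lambda>x. Y x $ i) x"
  unfolding jacobian_nth
  by (rule pd_eqI[OF bounded_linear.has_derivative[OF bounded_linear_vec_nth
          Ck_on_1_has_derivative[OF assms]], symmetric])

lemma pd_slice:
  assumes "(f has_derivative f') (at (x, t))"
  shows "pd j (\<lambda>x. f (x, t)) x = f' (axis j 1, 0)"
  by (rule pd_eqI[OF has_derivative_space_slice[OF assms]])

subsection \<open>Geometry of the level sets of a distance function\<close>

text \<open>What remains of \<Phi> at time \<open>t0\<close>: its gradient \<nu>, a curl free field
  of unit length on an open set. The curvature identities below follow from these two
  properties.\<close>

locale distance_level_set =
  fixes N :: "(real^3) set" and \<nu> :: "3 \<Rightarrow> real^3 \<Rightarrow> real"
  assumes N: "open N" and Ck_\<nu>: "\<And>k i. Ck_on k N (\<nu> i)"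
    and unit: "\<And>x. x \<in> N \<Longrightarrow> (\<Sum>i\<in>UNIV. \<nu> i x * \<nu> i x) = 1"
    and curl_free: "\<And>x i j. x \<in> N \<Longrightarrow> pd j (\<nu> i) x = pd i (\<nu> j) x"
begin

text \<open>The Hessian of the distance function. Besides the two principal curvatures it has the
  eigenvalue 0, with eigenvector \<nu> (lemma \<open>a_\<nu>\<close>), so its trace \<open>h\<close>
  and its second elementary symmetric function \<open>g\<close> are the mean and the Gaussian
  curvature.\<close>

definition a :: "3 \<Rightarrow> 3 \<Rightarrow> real^3 \<Rightarrow> real" where "a i j x = pd j (\<nu> i) x"

definition tg :: "(real^3 \<Rightarrow> real) \<Rightarrow> 3 \<Rightarrow> real^3 \<Rightarrow> real" where
  "tg f i x = pd i f x - (\<Sum>k\<in>UNIV. pd k f x * \<nu> k x) * \<nu> i x"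

definition h :: "real^3 \<Rightarrow> real" where "h x = (\<Sum>i\<in>UNIV. a i i x)"

definition g :: "real^3 \<Rightarrow> real" where
  "g x = ((h x)\<^sup>2 - (\<Sum>i\<in>UNIV. \<Sum>j\<in>UNIV. a i j x * a j i x)) / 2"

lemma Ck_a: "Ck_on k N (a i j)"
  unfolding a_def[abs_def] by (rule Ck_on_pd[OF Ck_\<nu>])

lemma Ck_h: "Ck_on k N h"
  unfolding h_def[abs_def] by (rule Ck_on_sum[OF N Ck_a])

lemma Ck_g: "Ck_on k N g"
proof -
  have "Ck_on k N (\<lambda>x. ((h x)\<^sup>2 - (\<Sum>i\<in>UNIV. \<Sum>j\<in>UNIV. a i j x * a j i x)) * (1 / 2))"
    by (rule Ck_on_mult[OF N Ck_on_diff[OF N Ck_on_power2[OF N Ck_h] Ck_on_sum[OF N Ck_on_sum[OF N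
      Ck_on_mult[OF N Ck_a Ck_a]]]] Ck_on_const[OF N]])
  then show ?thesis by (simp add: g_def[abs_def])
qed

lemma Ck_tg: "Ck_on (Suc k) N f \<Longrightarrow> Ck_on k N (tg f i)"
  unfolding tg_def[abs_def]
  by (rule Ck_on_diff[OF N Ck_on_pd Ck_on_mult[OF N Ck_on_sum[OF N Ck_on_mult[OF N Ck_on_pd Ck_\<nu>]] Ck_\<nu>]])

lemma a_sym: "x \<in> N \<Longrightarrow> a i j x = a j i x"
  unfolding a_def by (rule curl_free)

text \<open>The derivative of |\<nu>|^2 = 1, combined with the symmetry of \<open>a\<close>.\<close>

lemma a_\<nu>: assumes "x \<in> N" shows "(\<Sum>j\<in>UNIV. a i j x * \<nu> j x) = 0"
proof -
  have "0 = pd i (\<lambda>x. \<Sum>j\<in>UNIV. \<nu> j x * \<nu> j x) x"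
    by (rule pd_eq_0[OF N assms unit, symmetric])
  also have "\<dots> = (\<Sum>j\<in>UNIV. pd i (\<lambda>x. \<nu> j x * \<nu> j x) x)"
    by (rule pd_sum[OF Ck_on_mult[OF N Ck_\<nu> Ck_\<nu>] assms])
  also have "\<dots> = (\<Sum>j\<in>UNIV. 2 * (a i j x * \<nu> j x))"
    by (rule sum.cong) (simp_all add: pd_mult[OF Ck_\<nu> Ck_\<nu> assms] curl_free[OF assms, of i] a_def)
  finally show ?thesis by (simp add: sum_distrib_left[symmetric])
qed

lemma pd_a_commute: assumes "x \<in> N" shows "pd k (a i j) x = pd j (a i k) x"
  unfolding a_def[abs_def] by (rule pd_commute[OF N Ck_\<nu> assms])

lemma pd_a_sym: assumes "x \<in> N" shows "pd k (a i j) x = pd k (a j i) x"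
  by (rule pd_cong[OF N Ck_a assms a_sym])

text \<open>The Riccati equation of a family of parallel surfaces: differentiate
  \<open>a_\<nu>\<close> in direction \<open>j\<close> and exchange the two differentiations in the
  term with third derivatives.\<close>

lemma normal_derivative_a:
  assumes "x \<in> N"
  shows "(\<Sum>k\<in>UNIV. \<nu> k x * pd k (a i j) x) = - (\<Sum>k\<in>UNIV. a i k x * a k j x)"
proof -
  have "0 = pd j (\<lambda>x. \<Sum>k\<in>UNIV. a i k x * \<nu> k x) x"
    by (rule pd_eq_0[OF N assms a_\<nu>, symmetric])
  also have "\<dots> = (\<Sum>k\<in>UNIV. pd j (\<lambda>x. a i k x * \<nu> k x) x)"
    by (rule pd_sum[OF Ck_on_mult[OF N Ck_a Ck_\<nu>] assms])
  also have "\<dots> = (\<Sum>k\<in>UNIV. a i k x * a k j x) + (\<Sum>k\<in>UNIV. \<nu> k x * pd k (a i j) x)"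
  proof -
    have "pd j (\<lambda>x. a i k x * \<nu> k x) x = a i k x * a k j x + \<nu> k x * pd k (a i j) x" for k
      using pd_mult[where f="a i k" and g="\<nu> k" and j=j, OF Ck_a Ck_\<nu> assms]
        pd_a_commute[OF assms, where k=j and i=i and j=k]
      by (simp add: a_def[of k j])
    then show ?thesis by (simp add: sum.distrib)
  qed
  finally show ?thesis by simp
qed

lemma pd_h: "x \<in> N \<Longrightarrow> pd k h x = (\<Sum>i\<in>UNIV. pd k (a i i) x)"
  unfolding h_def[abs_def] by (rule pd_sum[OF Ck_a])

text \<open>The contracted symmetry of third derivatives. It says that the tensor a - h I is
  divergence free, which is how \<open>divergence_a_h\<close> uses it.\<close>

lemma Codazzi: assumes "x \<in> N" shows "(\<Sum>i\<in>UNIV. pd i (a i j) x) = pd j h x"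
  unfolding pd_h[OF assms]
  by (rule sum.cong) (simp_all add: pd_a_commute[OF assms, of _ _ j])

lemma pd_g:
  assumes x: "x \<in> N"
  shows "pd k g x = h x * pd k h x - (\<Sum>i\<in>UNIV. \<Sum>j\<in>UNIV. a i j x * pd k (a j i) x)"
proof -
  have dh: "(h has_derivative frechet_derivative h (at x)) (at x)"
    and da: "(a i j has_derivative frechet_derivative (a i j) (at x)) (at x)" for i j
    using Ck_on_1_has_derivative[OF Ck_h x] Ck_on_1_has_derivative[OF Ck_a x] by auto
  have "((\<lambda>x. (h x * h x - (\<Sum>i\<in>UNIV. \<Sum>j\<in>UNIV. a i j x * a j i x)) * (1 / 2)) has_derivative
     (\<lambda>e. ((h x * frechet_derivative h (at x) e + frechet_derivative h (at x) e * h x)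
       - (\<Sum>i\<in>UNIV. \<Sum>j\<in>UNIV. a i j x * frechet_derivative (a j i) (at x) e + frechet_derivative (a i j) (at x) e * a j i x)) * (1/2))) (at x)"
    by (intro has_derivative_mult_left has_derivative_diff has_derivative_mult has_derivative_sum dh da)
  from pd_eqI[OF this, of k]
  have "pd k g x = (2 * (h x * pd k h x)
      - (\<Sum>i\<in>UNIV. \<Sum>j\<in>UNIV. a i j x * pd k (a j i) x + pd k (a i j) x * a j i x)) * (1/2)"
    by (simp add: g_def[abs_def] power2_eq_square)
  moreover have "(\<Sum>i\<in>UNIV. \<Sum>j\<in>UNIV. a i j x * pd k (a j i) x + pd k (a i j) x * a j i x)
      = 2 * (\<Sum>i\<in>UNIV. \<Sum>j\<in>UNIV. a i j x * pd k (a j i) x)"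
    unfolding sum_distrib_left
    by (intro sum.cong) (simp_all add: a_sym[OF x] pd_a_sym[OF x])
  ultimately show ?thesis by simp
qed

lemma normal_derivative_h:
  assumes x: "x \<in> N"
  shows "(\<Sum>k\<in>UNIV. \<nu> k x * pd k h x) = - ((h x)\<^sup>2 - 2 * g x)"
proof -
  have "(\<Sum>k\<in>UNIV. \<nu> k x * pd k h x) = (\<Sum>i\<in>UNIV. \<Sum>k\<in>UNIV. \<nu> k x * pd k (a i i) x)"
    unfolding pd_h[OF x] sum_distrib_left by (rule sum.swap)
  also have "\<dots> = - (\<Sum>i\<in>UNIV. \<Sum>k\<in>UNIV. a i k x * a k i x)"
    unfolding normal_derivative_a[OF x] by (simp add: sum_negf)
  finally show ?thesis by (simp add: g_def field_simps)
qed

text \<open>The trace of the Cayley--Hamilton identity, multiplied by the matrix.\<close>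

lemma trace_cube_singular:
  fixes b :: "3 \<Rightarrow> 3 \<Rightarrow> real" and v :: "3 \<Rightarrow> real"
  assumes ker: "\<And>i. (\<Sum>j\<in>UNIV. b i j * v j) = 0" and v: "(\<Sum>i\<in>UNIV. v i * v i) = 1"
  defines "H \<equiv> \<Sum>i\<in>UNIV. b i i" and "T2 \<equiv> \<Sum>i\<in>UNIV. \<Sum>j\<in>UNIV. b i j * b j i"
  shows "(\<Sum>i\<in>UNIV. \<Sum>j\<in>UNIV. b i j * (\<Sum>k\<in>UNIV. b j k * b k i)) = H * T2 - (H\<^sup>2 - T2) / 2 * H"
proof -
  define M :: "real^3^3" where "M = (\<chi> i j. b i j)"
  define w :: "real^3" where "w = (\<chi> i. v i)"
  have "M *v w = 0" using ker by (simp add: M_def w_def matrix_vector_mult_def vec_eq_iff)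
  moreover have "w \<noteq> 0"
  proof
    assume "w = 0"
    then have "v i = 0" for i by (simp add: w_def vec_eq_iff)
    then show False using v by simp
  qed
  ultimately have "\<not> invertible M"
    by (metis invertible_def matrix_vector_mul_assoc matrix_vector_mul_lid matrix_vector_mult_0_right)
  then have "det M = 0" using invertible_det_nz by blast
  then have D: "b 1 1 * b 2 2 * b 3 3 + b 1 2 * b 2 3 * b 3 1 + b 1 3 * b 2 1 * b 3 2
    - b 1 1 * b 2 3 * b 3 2 - b 1 2 * b 2 1 * b 3 3 - b 1 3 * b 2 2 * b 3 1 = 0"
    by (simp add: det_3 M_def)
  \<comment> \<open>Newton's identity for the third power sum of the eigenvalues; the bracket is the
    determinant of the matrix.\<close>
  have "2 * (\<Sum>i\<in>UNIV. \<Sum>j\<in>UNIV. b i j * (\<Sum>k\<in>UNIV. b j k * b k i)) = 3 * H * T2 - H ^ 3 + 6 * 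
    (b 1 1 * b 2 2 * b 3 3 + b 1 2 * b 2 3 * b 3 1 + b 1 3 * b 2 1 * b 3 2
    - b 1 1 * b 2 3 * b 3 2 - b 1 2 * b 2 1 * b 3 3 - b 1 3 * b 2 2 * b 3 1)"
    unfolding H_def T2_def sum_3 by algebra
  then show ?thesis unfolding D by (simp add: field_simps power2_eq_square power3_eq_cube)
qed

text \<open>With T2 = tr A^2 = h^2 - 2 g, the Riccati equation gives - h T2 + tr A^3, and tr A^3 = h
  T2 - g h because A is singular.\<close>

lemma normal_derivative_g:
  assumes x: "x \<in> N"
  shows "(\<Sum>k\<in>UNIV. \<nu> k x * pd k g x) = - g x * h x"
proof -
  let ?T2 = "\<Sum>i\<in>UNIV. \<Sum>j\<in>UNIV. a i j x * a j i x"
  have "(\<Sum>k\<in>UNIV. \<nu> k x * pd k g x)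
     = h x * (\<Sum>k\<in>UNIV. \<nu> k x * pd k h x) - (\<Sum>k\<in>UNIV. \<Sum>i\<in>UNIV. \<Sum>j\<in>UNIV. a i j x * (\<nu> k x * pd k (a j i) x))"
    unfolding pd_g[OF x] by (simp add: sum_3 algebra_simps)
  also have "(\<Sum>k\<in>UNIV. \<Sum>i\<in>UNIV. \<Sum>j\<in>UNIV. a i j x * (\<nu> k x * pd k (a j i) x))
     = (\<Sum>i\<in>UNIV. \<Sum>j\<in>UNIV. a i j x * (\<Sum>k\<in>UNIV. \<nu> k x * pd k (a j i) x))"
    by (simp add: sum_3 algebra_simps)
  also have "\<dots> = - (\<Sum>i\<in>UNIV. \<Sum>j\<in>UNIV. a i j x * (\<Sum>k\<in>UNIV. a j k x * a k i x))"
    unfolding normal_derivative_a[OF x] by (simp add: sum_negf)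
  also have "(\<Sum>i\<in>UNIV. \<Sum>j\<in>UNIV. a i j x * (\<Sum>k\<in>UNIV. a j k x * a k i x)) = h x * ?T2 - g x * h x"
    using trace_cube_singular[of "\<lambda>i j. a i j x" "\<lambda>i. \<nu> i x", OF a_\<nu>[OF x] unit[OF x]]
    by (simp add: h_def g_def)
  finally show ?thesis
    unfolding normal_derivative_h[OF x] by (simp add: g_def[of x] field_simps)
qed

lemma tg_\<nu>: assumes x: "x \<in> N" shows "(\<Sum>i\<in>UNIV. tg f i x * \<nu> i x) = 0"
proof -
  have "(\<Sum>i\<in>UNIV. tg f i x * \<nu> i x) = (\<Sum>k\<in>UNIV. pd k f x * \<nu> k x) * (1 - (\<Sum>i\<in>UNIV. \<nu> i x * \<nu> i x))"
    by (simp add: tg_def sum_3 algebra_simps)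
  then show ?thesis using unit[OF x] by simp
qed

lemma a_tg: assumes x: "x \<in> N" shows "(\<Sum>k\<in>UNIV. a i k x * tg f k x) = (\<Sum>k\<in>UNIV. a i k x * pd k f x)"
proof -
  have "(\<Sum>k\<in>UNIV. a i k x * tg f k x) = (\<Sum>k\<in>UNIV. a i k x * pd k f x)
      - (\<Sum>k\<in>UNIV. pd k f x * \<nu> k x) * (\<Sum>k\<in>UNIV. a i k x * \<nu> k x)"
    by (simp add: tg_def sum_3 algebra_simps)
  then show ?thesis using a_\<nu>[OF x] by simp
qed

lemma tg_sym: "(\<Sum>i\<in>UNIV. pd i f x * tg f' i x) = (\<Sum>i\<in>UNIV. pd i f' x * tg f i x)"
  by (simp add: tg_def sum_3 algebra_simps)

text \<open>On tangential gradients a - h I gives a symmetric bilinear form, because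
  \<open>a\<close> is symmetric and annihilates \<nu>. Together with \<open>tg_sym\<close> this
  cancels the products of first derivatives in the divergence of \<open>Green_field\<close>.\<close>

lemma a_h_tg_sym:
  assumes x: "x \<in> N"
  shows "(\<Sum>i\<in>UNIV. pd i f x * ((\<Sum>k\<in>UNIV. a i k x * tg f' k x) - h x * tg f' i x))
       = (\<Sum>i\<in>UNIV. pd i f' x * ((\<Sum>k\<in>UNIV. a i k x * tg f k x) - h x * tg f i x))"
proof -
  have "(\<Sum>i\<in>UNIV. pd i f x * ((\<Sum>k\<in>UNIV. a i k x * tg f' k x) - h x * tg f' i x))
    = (\<Sum>i\<in>UNIV. \<Sum>k\<in>UNIV. pd i f x * (a i k x * pd k f' x)) - h x * (\<Sum>i\<in>UNIV. pd i f x * tg f' i x)" for f f'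
    unfolding a_tg[OF x] by (simp add: sum_3 algebra_simps)
  moreover have "(\<Sum>i\<in>UNIV. \<Sum>k\<in>UNIV. pd i f x * (a i k x * pd k f' x))
      = (\<Sum>i\<in>UNIV. \<Sum>k\<in>UNIV. pd i f' x * (a i k x * pd k f x))"
    by (subst sum.swap) (intro sum.cong, simp_all add: a_sym[OF x])
  ultimately show ?thesis by (simp add: tg_sym[of f])
qed

text \<open>The terms in which a coefficient is differentiated cancel by \<open>Codazzi\<close>, so
  the second order operator is in divergence form.\<close>

lemma divergence_a_h:
  assumes x: "x \<in> N" and X: "\<And>i. Ck_on 1 N (X i)"
  shows "(\<Sum>i\<in>UNIV. pd i (\<lambda>x. (\<Sum>k\<in>UNIV. a i k x * X k x) - h x * X i x) x)
    = (\<Sum>i\<in>UNIV. \<Sum>k\<in>UNIV. a i k x * pd i (X k) x) - h x * (\<Sum>i\<in>UNIV. pd i (X i) x)"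
proof -
  have C: "Ck_on 1 N (\<lambda>x. a i k x * X j x)" "Ck_on 1 N (\<lambda>x. h x * X i x)" for i j k
    by (intro Ck_on_mult[OF N Ck_a X] Ck_on_mult[OF N Ck_h X])+
  have "pd i (\<lambda>x. (\<Sum>k\<in>UNIV. a i k x * X k x) - h x * X i x) x
     = (\<Sum>k\<in>UNIV. a i k x * pd i (X k) x + pd i (a i k) x * X k x) - (h x * pd i (X i) x + pd i h x * X i x)" for i
    by (simp add: pd_diff[OF Ck_on_sum[OF N C(1)] C(2) x] pd_sum[OF C(1) x]
        pd_mult[OF Ck_a X x] pd_mult[OF Ck_h X x])
  then have "(\<Sum>i\<in>UNIV. pd i (\<lambda>x. (\<Sum>k\<in>UNIV. a i k x * X k x) - h x * X i x) x)
    = (\<Sum>i\<in>UNIV. (\<Sum>k\<in>UNIV. a i k x * pd i (X k) x + pd i (a i k) x * X k x) - (h x * pd i (X i) x + pd i h x * X i x))"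
    by (simp only:)
  also have "\<dots> = (\<Sum>i\<in>UNIV. \<Sum>k\<in>UNIV. a i k x * pd i (X k) x) - h x * (\<Sum>i\<in>UNIV. pd i (X i) x)
      + (\<Sum>k\<in>UNIV. (\<Sum>i\<in>UNIV. pd i (a i k) x) * X k x) - (\<Sum>k\<in>UNIV. pd k h x * X k x)"
    by (simp add: sum_3 algebra_simps)
  finally show ?thesis unfolding Codazzi[OF x] by simp
qed

lemma divergence_scale:
  assumes x: "x \<in> N" and "Ck_on 1 N s" "\<And>i. Ck_on 1 N (X i)"
  shows "(\<Sum>i\<in>UNIV. pd i (\<lambda>x. s x * X i x) x) = (\<Sum>i\<in>UNIV. pd i s x * X i x) + s x * (\<Sum>i\<in>UNIV. pd i (X i) x)"
  by (simp add: pd_mult[OF assms(2,3) x] sum.distrib sum_distrib_left)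

text \<open>\<open>hess_term\<close> and \<open>lap\<close> have ambient derivatives where the
  theorem has tangential ones. For tangential gradients the two versions agree, by
  \<open>tan_jacobian_inner_eq_hess_term\<close> and \<open>laplace_beltrami_eq_lap\<close>.\<close>

definition hess_term :: "(real^3 \<Rightarrow> real) \<Rightarrow> real^3 \<Rightarrow> real" where
  "hess_term f x = (\<Sum>i\<in>UNIV. \<Sum>k\<in>UNIV. a i k x * pd i (tg f k) x)"

definition lap :: "(real^3 \<Rightarrow> real) \<Rightarrow> real^3 \<Rightarrow> real" where
  "lap f x = (\<Sum>i\<in>UNIV. pd i (tg f i) x)"

text \<open>Green's formula for the Laplacian and for the second order operator that arises from the
  variation of the Gaussian curvature: the difference of both sides is a divergence.\<close>

definition Green_field :: "(real^3 \<Rightarrow> real) \<Rightarrow> (real^3 \<Rightarrow> real) \<Rightarrow> (real^3 \<Rightarrow> real) \<Rightarrow> real^3 \<Rightarrow> real^3" where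
  "Green_field v P Q x = (\<chi> i. (v x * tg P i x - P x * tg v i x) +
     (Q x * ((\<Sum>k\<in>UNIV. a i k x * tg v k x) - h x * tg v i x)
      - v x * ((\<Sum>k\<in>UNIV. a i k x * tg Q k x) - h x * tg Q i x)))"

lemma Green_field:
  assumes C: "Ck_on 2 N v" "Ck_on 2 N P" "Ck_on 2 N Q"
  shows "Ck_on 1 N (Green_field v P Q)"
    and "x \<in> N \<Longrightarrow> (\<Sum>i\<in>UNIV. Green_field v P Q x $ i * \<nu> i x) = 0"
    and "x \<in> N \<Longrightarrow> divergence (Green_field v P Q) x =
      (v x * lap P x - P x * lap v x) + (Q x * (hess_term v x - h x * lap v x) - v x * (hess_term Q x - h x * lap Q x))"
proof -
  have C1: "Ck_on 1 N v" "Ck_on 1 N P" "Ck_on 1 N Q" using Ck_on_le[OF C(1), of 1] Ck_on_le[OF C(2), of 1] Ck_on_le[OF C(3), of 1] by simp_all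
  have Ct: "Ck_on 1 N (tg v i)" "Ck_on 1 N (tg P i)" "Ck_on 1 N (tg Q i)" for i
    using C by (auto intro!: Ck_tg simp: numeral_2_eq_2 simp del: Ck_on.simps)
  define M where "M X i x = (\<Sum>k\<in>UNIV. a i k x * X k x) - h x * X i x" for X i x
  have CM: "Ck_on 1 N (M X i)" if "\<And>i. Ck_on 1 N (X i)" for X i
    unfolding M_def[abs_def]
    by (rule Ck_on_diff[OF N Ck_on_sum[OF N Ck_on_mult[OF N Ck_a that]] Ck_on_mult[OF N Ck_h that]])
  have comp: "Green_field v P Q x $ i = (v x * tg P i x - P x * tg v i x) + (Q x * M (tg v) i x - v x * M (tg Q) i x)" for x i
    by (simp add: Green_field_def M_def)
  have CC: "Ck_on 1 N (\<lambda>x. v x * tg P i x)" "Ck_on 1 N (\<lambda>x. P x * tg v i x)"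
    "Ck_on 1 N (\<lambda>x. Q x * M (tg v) i x)" "Ck_on 1 N (\<lambda>x. v x * M (tg Q) i x)" for i
    by (intro Ck_on_mult[OF N] C1 Ct CM)+
  have CG: "Ck_on 1 N (\<lambda>x. \<chi> i. (v x * tg P i x - P x * tg v i x) + (Q x * M (tg v) i x - v x * M (tg Q) i x))"
    by (intro Ck_on_vec_lambda[OF N] Ck_on_add[OF N] Ck_on_diff[OF N] CC)
  then show G: "Ck_on 1 N (Green_field v P Q)"
    by (simp add: Green_field_def[abs_def] M_def del: Ck_on.simps One_nat_def)
  assume x: "x \<in> N"
  have M\<nu>: "(\<Sum>i\<in>UNIV. M (tg f) i x * \<nu> i x) = 0" for f
  proof -
    have "(\<Sum>i\<in>UNIV. M (tg f) i x * \<nu> i x) = (\<Sum>k\<in>UNIV. (\<Sum>i\<in>UNIV. a k i x * \<nu> i x) * tg f k x)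
        - h x * (\<Sum>i\<in>UNIV. tg f i x * \<nu> i x)"
      unfolding M_def a_sym[OF x, of _ 1] by (simp add: sum_3 a_sym[OF x, of 2 1] a_sym[OF x, of 3 1] a_sym[OF x, of 3 2] algebra_simps)
    then show ?thesis by (simp add: a_\<nu>[OF x] tg_\<nu>[OF x])
  qed
  have "(\<Sum>i\<in>UNIV. Green_field v P Q x $ i * \<nu> i x) = v x * (\<Sum>i\<in>UNIV. tg P i x * \<nu> i x)
     - P x * (\<Sum>i\<in>UNIV. tg v i x * \<nu> i x) + Q x * (\<Sum>i\<in>UNIV. M (tg v) i x * \<nu> i x) - v x * (\<Sum>i\<in>UNIV. M (tg Q) i x * \<nu> i x)"
    unfolding comp by (simp add: sum_3 algebra_simps)
  then show "(\<Sum>i\<in>UNIV. Green_field v P Q x $ i * \<nu> i x) = 0" by (simp add: M\<nu> tg_\<nu>[OF x])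
  have divM: "(\<Sum>i\<in>UNIV. pd i (M (tg f) i) x) = hess_term f x - h x * lap f x" if "\<And>i. Ck_on 1 N (tg f i)" for f
    unfolding M_def[abs_def] divergence_a_h[OF x that] hess_term_def lap_def ..
  have "divergence (Green_field v P Q) x
     = (\<Sum>i\<in>UNIV. (pd i (\<lambda>x. v x * tg P i x) x - pd i (\<lambda>x. P x * tg v i x) x)
       + (pd i (\<lambda>x. Q x * M (tg v) i x) x - pd i (\<lambda>x. v x * M (tg Q) i x) x))"
    unfolding divergence_eq_sum_pd[OF G x] comp
    by (simp only: pd_add[OF Ck_on_diff[OF N CC(1,2)] Ck_on_diff[OF N CC(3,4)] x]
        pd_diff[OF CC(1,2) x] pd_diff[OF CC(3,4) x])
  also have "\<dots> = ((\<Sum>i\<in>UNIV. pd i v x * tg P i x) + v x * lap P x) - ((\<Sum>i\<in>UNIV. pd i P x * tg v i x) + P x * lap v x)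
     + ((\<Sum>i\<in>UNIV. pd i Q x * M (tg v) i x) + Q x * (hess_term v x - h x * lap v x))
     - ((\<Sum>i\<in>UNIV. pd i v x * M (tg Q) i x) + v x * (hess_term Q x - h x * lap Q x))"
    unfolding sum.distrib sum_subtractf divergence_scale[OF x C1(1) Ct(2)] divergence_scale[OF x C1(2) Ct(1)]
      divergence_scale[OF x C1(3) CM[OF Ct(1)]] divergence_scale[OF x C1(1) CM[OF Ct(3)]]
      divM[OF Ct(1)] divM[OF Ct(3)] lap_def by simp
  finally show "divergence (Green_field v P Q) x =
      (v x * lap P x - P x * lap v x) + (Q x * (hess_term v x - h x * lap v x) - v x * (hess_term Q x - h x * lap Q x))"
    using tg_sym[of v x P] a_h_tg_sym[OF x, of v Q] by (simp add: M_def)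
qed

text \<open>Differentiate \<open>tg_\<nu>\<close> and contract with \<nu>; the term with
  \<open>a\<close> drops out because \<open>a\<close> annihilates \<nu>. In other words, the ambient
  divergence of a tangential gradient has no normal part.\<close>

lemma normal_tg_derivative:
  assumes x: "x \<in> N" and f: "\<And>i. Ck_on 1 N (tg f i)"
  shows "(\<Sum>i\<in>UNIV. \<Sum>j\<in>UNIV. pd j (tg f i) x * (\<nu> j x * \<nu> i x)) = 0"
proof -
  have "(\<Sum>i\<in>UNIV. tg f i x * a i j x + pd j (tg f i) x * \<nu> i x) = 0" for j
  proof -
    have "0 = pd j (\<lambda>x. \<Sum>i\<in>UNIV. tg f i x * \<nu> i x) x"
      by (rule pd_eq_0[OF N x tg_\<nu>, symmetric])
    also have "\<dots> = (\<Sum>i\<in>UNIV. tg f i x * a i j x + pd j (tg f i) x * \<nu> i x)"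
      unfolding pd_sum[OF Ck_on_mult[OF N f Ck_\<nu>] x] pd_mult[OF f Ck_\<nu> x] a_def ..
    finally show ?thesis by simp
  qed
  then have "0 = (\<Sum>j\<in>UNIV. \<nu> j x * (\<Sum>i\<in>UNIV. tg f i x * a i j x + pd j (tg f i) x * \<nu> i x))" by simp
  also have "\<dots> = (\<Sum>i\<in>UNIV. tg f i x * (\<Sum>j\<in>UNIV. a i j x * \<nu> j x)) + (\<Sum>i\<in>UNIV. \<Sum>j\<in>UNIV. pd j (tg f i) x * (\<nu> j x * \<nu> i x))"
    by (simp add: sum_3 algebra_simps)
  finally show ?thesis by (simp add: a_\<nu>[OF x])
qed

end

context distance_level_set
begin

text \<open>The curvature functions of the theorem agree with smooth ones on \<open>N\<close>, and
  agreement on an open set carries over to derivatives. The projection I - n n^T removes from the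
  Laplacian a double normal term, which is zero by \<open>normal_tg_derivative\<close>, and from the
  contraction a term that \<open>a\<close> annihilates.\<close>

lemma
  assumes n0: "\<And>x i. x \<in> N \<Longrightarrow> n0 x $ i = \<nu> i x"
    and P: "Ck_on 2 N P" and gf: "\<And>x. x \<in> N \<Longrightarrow> gf x = P x" and x: "x \<in> N"
  shows laplace_beltrami_eq_lap: "laplace_beltrami n0 gf x = lap P x"
    and tan_jacobian_inner_eq_hess_term:
      "tan_jacobian n0 n0 x \<bullet> tan_jacobian n0 (tan_grad n0 gf) x = hess_term P x"
proof -
  have P1: "Ck_on 1 N P" using Ck_on_le[OF P, of 1] by simp
  have Ct: "Ck_on 1 N (tg P i)" for i by (rule Ck_tg) (use P in \<open>simp only: Suc_1\<close>)
  have "pd i gf x = pd i P x" if "x \<in> N" for i x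
    by (rule pd_cong[OF N P1 that, symmetric]) (simp add: gf)
  then have tgr: "tan_grad n0 gf x $ i = tg P i x" if "x \<in> N" for i x
    using that by (simp add: tan_grad_def tg_def grad_def inner_vec_def n0)
  have Jw: "jacobian (tan_grad n0 gf) (at x) $ i $ j = pd j (tg P i) x" for i j
  proof -
    have eq: "(\<chi> i. tg P i y) = tan_grad n0 gf y" if "y \<in> N" for y
      using that by (simp add: vec_eq_iff tgr)
    have "Ck_on 1 N (tan_grad n0 gf)"
      by (rule Ck_on_cong[OF N eq Ck_on_vec_lambda[OF N Ct]])
    then show ?thesis
      using jacobian_eq_pd[OF _ x] pd_cong[OF N Ct x, of i "\<lambda>x. tan_grad n0 gf x $ i"] tgr by metis
  qed
  have Jn: "jacobian n0 (at x) $ i $ j = a i j x" for i j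
  proof -
    have eq: "(\<chi> i. \<nu> i y) = n0 y" if "y \<in> N" for y
      using that by (simp add: vec_eq_iff n0)
    have "Ck_on 1 N n0"
      by (rule Ck_on_cong[OF N eq Ck_on_vec_lambda[OF N Ck_\<nu>]])
    then show ?thesis
      unfolding a_def using jacobian_eq_pd[OF _ x] pd_cong[OF N Ck_\<nu> x, of i "\<lambda>x. n0 x $ i"] n0 by metis
  qed
  have tj: "tan_jacobian n0 V x $ i $ j = jacobian V (at x) $ i $ j
      - (\<Sum>k\<in>UNIV. jacobian V (at x) $ i $ k * \<nu> k x) * \<nu> j x" for V i j
  proof -
    have "tan_jacobian n0 V x $ i $ j
      = (\<Sum>k\<in>UNIV. jacobian V (at x) $ i $ k * ((if k = j then 1 else 0) - \<nu> k x * \<nu> j x))"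
      by (simp add: tan_jacobian_def matrix_matrix_mult_def mat_def n0[OF x])
    also have "\<dots> = (\<Sum>k\<in>UNIV. jacobian V (at x) $ i $ k * (if k = j then 1 else 0))
        - (\<Sum>k\<in>UNIV. jacobian V (at x) $ i $ k * \<nu> k x) * \<nu> j x"
      unfolding sum_distrib_right sum_subtractf[symmetric] by (simp add: algebra_simps)
    finally show ?thesis by (simp add: if_distrib cong: if_cong)
  qed
  have "laplace_beltrami n0 gf x = lap P x - (\<Sum>i\<in>UNIV. \<Sum>j\<in>UNIV. pd j (tg P i) x * (\<nu> j x * \<nu> i x))"
    by (simp add: laplace_beltrami_def tan_div_def trace_def tj Jw lap_def sum_subtractf
        sum_distrib_right mult.assoc)
  then show "laplace_beltrami n0 gf x = lap P x" by (simp add: normal_tg_derivative[OF x Ct])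
  have "tan_jacobian n0 n0 x \<bullet> tan_jacobian n0 (tan_grad n0 gf) x
     = (\<Sum>i\<in>UNIV. \<Sum>j\<in>UNIV. a i j x * (pd j (tg P i) x - (\<Sum>k\<in>UNIV. pd k (tg P i) x * \<nu> k x) * \<nu> j x))"
    unfolding matrix_inner_eq_sum tj Jn Jw by (simp add: a_\<nu>[OF x])
  also have "\<dots> = (\<Sum>i\<in>UNIV. \<Sum>j\<in>UNIV. a i j x * pd j (tg P i) x)
     - (\<Sum>i\<in>UNIV. (\<Sum>k\<in>UNIV. pd k (tg P i) x * \<nu> k x) * (\<Sum>j\<in>UNIV. a i j x * \<nu> j x))"
    by (simp add: sum_subtractf sum_distrib_left right_diff_distrib mult.assoc mult.left_commute)
  also have "\<dots> = (\<Sum>i\<in>UNIV. \<Sum>j\<in>UNIV. a i j x * pd j (tg P i) x)"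
    by (simp add: a_\<nu>[OF x])
  also have "\<dots> = hess_term P x"
    unfolding hess_term_def by (subst sum.swap) (intro sum.cong, simp_all add: a_sym[OF x])
  finally show "tan_jacobian n0 n0 x \<bullet> tan_jacobian n0 (tan_grad n0 gf) x = hess_term P x" .
qed

end

lemma surface_integral_cong:
  "(\<And>x. x \<in> S \<Longrightarrow> f x = g x) \<Longrightarrow> surface_integral S f = surface_integral S g"
  unfolding surface_integral_def set_lebesgue_integral_def
  by (rule Bochner_Integration.integral_cong) (auto simp: indicator_def)

subsection \<open>The first variation of curvature dependent energies\<close>

context moving_level_set
begin

text \<open>Integrability is what allows the integral of the transport rate to be split into the two
  variation terms and a divergence.\<close>

lemma set_integrable_level_set:
  fixes f :: "real^3 \<Rightarrow> real"
  assumes f: "continuous_on (\<Gamma> t0) f"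
  shows "set_integrable (surface_measure (\<Gamma> t0)) (\<Gamma> t0) f"
proof -
  obtain P \<rho> \<delta> U \<kappa> where P: "finite P" and U: "open U" "\<Gamma> t0 \<subseteq> U"
    and ch: "\<And>p. p \<in> P \<Longrightarrow> has_chart p (\<rho> p) (\<delta> p)"
    and \<kappa>1: "\<And>p. p \<in> P \<Longrightarrow> Ck_on 1 U (\<kappa> p)"
    and \<delta>: "\<And>p. p \<in> P \<Longrightarrow> \<delta> p > 0"
    and \<kappa>0: "\<And>p x. p \<in> P \<Longrightarrow> x \<notin> cball p (\<rho> p) \<Longrightarrow> \<kappa> p x = 0"
    and \<kappa>_sum: "\<And>x. x \<in> U \<Longrightarrow> (\<Sum>p\<in>P. \<kappa> p x) = (1::real)"
    by (rule partition_of_unity, rule that)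
  have loc: "set_integrable (surface_measure (\<Gamma> t0)) (\<Gamma> t0) (\<lambda>x. \<kappa> p x * f x)" if p: "p \<in> P" for p
  proof -
    obtain e1 e2 e3 \<psi> W a b R where "level_set_chart \<Phi> (UNIV \<times> I) p t0 e1 e2 e3 \<psi> W a b (\<delta> p) (\<rho> p) R"
      using ch[OF p] unfolding has_chart_def by blast
    then interpret level_set_chart \<Phi> "UNIV \<times> I" p t0 e1 e2 e3 \<psi> W a b "\<delta> p" "\<rho> p" R .
    have t: "t0 \<in> {t0 - \<delta> p..t0 + \<delta> p}" using \<delta>[OF p] by simp
    have c: "continuous_on (\<Gamma> t0) (\<lambda>x. \<kappa> p x * f x)"
      by (intro continuous_on_mult f continuous_on_subset[OF Ck_on_continuous[OF \<kappa>1[OF p]] U(2)])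
    show ?thesis
      by (rule surface_integral_chart(1)[OF t closed_level_set[OF t0_I] c]) (simp add: \<kappa>0[OF p])
  qed
  show ?thesis
  proof (rule surface_integral_sum(1)[OF loc])
    show "f x = (\<Sum>p\<in>P. \<kappa> p x * f x)" if "x \<in> \<Gamma> t0" for x
      using \<kappa>_sum[of x] that U(2) by (simp add: sum_distrib_right[symmetric] subset_iff)
  qed
qed

section \<open>Curvatures as functions on space-time and their time derivatives\<close>

abbreviation "dd u z \<equiv> frechet_derivative (\<lambda>z. frechet_derivative \<Phi> (at z) u) (at z)"

text \<open>The region where the normalised gradient and the curvatures built from it are smooth. It
  is open in space-time, which allows differentiation in time although \<Phi> is known to be a
  distance function at \<open>t0\<close> only.\<close>

definition regular :: "((real^3) \<times> real) set" where
  "regular = {z \<in> UNIV \<times> I. space_grad \<Phi> z \<in> - {0}}"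

definition unit_normal :: "(real^3) \<times> real \<Rightarrow> real^3" where
  "unit_normal z = space_grad \<Phi> z /\<^sub>R norm (space_grad \<Phi> z)"

definition shape :: "3 \<Rightarrow> 3 \<Rightarrow> (real^3) \<times> real \<Rightarrow> real" where
  "shape i j z = frechet_derivative (\<lambda>z. unit_normal z $ i) (at z) (axis j 1, 0)"

definition mean_curv :: "(real^3) \<times> real \<Rightarrow> real" where
  "mean_curv z = (\<Sum>i\<in>UNIV. shape i i z)"

definition Gauss_curv :: "(real^3) \<times> real \<Rightarrow> real" where
  "Gauss_curv z = ((mean_curv z)\<^sup>2 - (\<Sum>i\<in>UNIV. \<Sum>j\<in>UNIV. shape i j z * shape j i z)) / 2"

lemma Ck_d\<Phi>: "Ck_on k (UNIV \<times> I) (\<lambda>z. frechet_derivative \<Phi> (at z) u)"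
  by (intro smooth_on_Ck smooth_on_frechet_derivative smooth_\<Phi>)

lemma Ck_space_grad: "Ck_on k (UNIV \<times> I) (space_grad \<Phi>)"
  unfolding space_grad_def[abs_def] by (intro Ck_on_vec_lambda open_space_time Ck_d\<Phi>)

lemma open_regular: "open regular"
  unfolding regular_def by (rule open_preimage_Ck[OF Ck_space_grad[of 0] open_space_time]) auto

lemma regular_subset: "regular \<subseteq> UNIV \<times> I" by (auto simp: regular_def)

lemma N_regular: "x \<in> N \<Longrightarrow> (x, t0) \<in> regular"
  using unit_grad[of x] t0_I by (auto simp: regular_def)

lemma Ck_norm_grad: "Ck_on k regular (\<lambda>z. norm (space_grad \<Phi> z))"
  by (rule Ck_on_norm[OF open_regular _ Ck_on_subset[OF Ck_space_grad regular_subset]])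
     (simp add: regular_def)

lemma Ck_unit_normal: "Ck_on k regular unit_normal"
  unfolding unit_normal_def[abs_def]
  by (rule Ck_on_scaleR[OF open_regular Ck_on_inverse[OF open_regular _ Ck_norm_grad]
        Ck_on_subset[OF Ck_space_grad regular_subset]]) (simp add: regular_def)

lemma Ck_unit_normal_nth: "Ck_on k regular (\<lambda>z. unit_normal z $ i)"
  by (rule Ck_on_vec_nth[OF open_regular Ck_unit_normal])

lemma Ck_shape: "Ck_on k regular (shape i j)"
  unfolding shape_def[abs_def] using Ck_unit_normal_nth[of "Suc k" i] by simp

lemma Ck_mean_curv: "Ck_on k regular mean_curv"
  unfolding mean_curv_def[abs_def] by (rule Ck_on_sum[OF open_regular Ck_shape])

lemma Ck_Gauss_curv: "Ck_on k regular Gauss_curv"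
proof -
  have "Ck_on k regular (\<lambda>z. ((mean_curv z)\<^sup>2 - (\<Sum>i\<in>UNIV. \<Sum>j\<in>UNIV. shape i j z * shape j i z)) * (1 / 2))"
    by (rule Ck_on_mult[OF open_regular Ck_on_diff[OF open_regular Ck_on_power2[OF open_regular Ck_mean_curv]
          Ck_on_sum[OF open_regular Ck_on_sum[OF open_regular Ck_on_mult[OF open_regular Ck_shape Ck_shape]]]]
          Ck_on_const[OF open_regular]])
  then show ?thesis by (simp add: Gauss_curv_def[abs_def])
qed

lemma regular_has_derivative:
  assumes "\<And>k. Ck_on k regular f" "z \<in> regular"
  shows "(f has_derivative frechet_derivative f (at z)) (at z)"
  using Ck_on_SucD(1)[OF assms(1) assms(2)] .

lemma jacobian_unit_normal:
  assumes z: "(x, t) \<in> regular"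
  shows "jacobian (\<lambda>x. unit_normal (x, t)) (at x) $ i $ j = shape i j (x, t)"
proof -
  have "Ck_on 1 {x. (x, t) \<in> regular} (\<lambda>x. unit_normal (x, t))"
    by (rule Ck_on_space_slice[OF open_regular Ck_unit_normal])
  then have "jacobian (\<lambda>x. unit_normal (x, t)) (at x) $ i $ j = pd j (\<lambda>x. unit_normal (x, t) $ i) x"
    by (rule jacobian_eq_pd) (simp add: z)
  also have "\<dots> = shape i j (x, t)"
    unfolding shape_def by (rule pd_slice[OF regular_has_derivative[OF Ck_unit_normal_nth z]])
  finally show ?thesis .
qed

lemma divergence_unit_normal:
  "(x, t) \<in> regular \<Longrightarrow> divergence (\<lambda>x. unit_normal (x, t)) x = mean_curv (x, t)"
  by (simp add: divergence_def trace_def jacobian_unit_normal mean_curv_def)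

lemma trace_cofactor_unit_normal:
  "(x, t) \<in> regular \<Longrightarrow>
    trace (cofactor_matrix (jacobian (\<lambda>x. unit_normal (x, t)) (at x))) = Gauss_curv (x, t)"
  unfolding trace_cofactor_matrix_3
  by (simp add: trace_def matrix_matrix_mult_def jacobian_unit_normal Gauss_curv_def mean_curv_def)

definition speed :: "real^3 \<Rightarrow> real" where
  "speed x = - frechet_derivative \<Phi> (at (x, t0)) (0, 1)"

lemma N_slice: "N \<subseteq> {x. (x, t0) \<in> UNIV \<times> I}" "N \<subseteq> {x. (x, t0) \<in> regular}"
  using t0_I N_regular by auto

lemma Ck_slice: "Ck_on k regular f \<Longrightarrow> Ck_on k N (\<lambda>x. f (x, t0))"
  by (rule Ck_on_subset[OF Ck_on_space_slice[OF open_regular] N_slice(2)])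

lemma Ck_speed: "Ck_on k N speed"
  unfolding speed_def[abs_def]
  by (rule Ck_on_minus[OF open_N Ck_on_subset[OF Ck_on_space_slice[OF open_space_time Ck_d\<Phi>] N_slice(1)]])

lemma d\<Phi>_has_derivative:
  "z \<in> UNIV \<times> I \<Longrightarrow> ((\<lambda>z. frechet_derivative \<Phi> (at z) u) has_derivative dd u z) (at z)"
  by (rule Ck_on_SucD(1)[OF Ck_d\<Phi>])

lemma dd_commute: "z \<in> UNIV \<times> I \<Longrightarrow> dd u z w = dd w z u"
  by (rule frechet_derivative_commute[OF open_space_time smooth_on_Ck[OF smooth_\<Phi>]])

definition normal0 :: "3 \<Rightarrow> real^3 \<Rightarrow> real" where
  "normal0 i x = space_grad \<Phi> (x, t0) $ i"

lemma unit_normal_N: "x \<in> N \<Longrightarrow> unit_normal (x, t0) $ i = normal0 i x"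
  by (simp add: unit_normal_def normal0_def unit_grad)

sublocale distance_level_set N normal0
proof
  show "open N" by (rule open_N)
  show "Ck_on k N (normal0 i)" for k i
    unfolding normal0_def[abs_def]
    by (rule Ck_on_vec_nth[OF open_N Ck_on_subset[OF Ck_on_space_slice[OF open_space_time Ck_space_grad] N_slice(1)]])
  show "(\<Sum>i\<in>UNIV. normal0 i x * normal0 i x) = 1" if "x \<in> N" for x
  proof -
    have "space_grad \<Phi> (x, t0) \<bullet> space_grad \<Phi> (x, t0) = 1"
      using unit_grad[OF that] by (simp add: norm_eq_1)
    then show ?thesis by (simp add: inner_vec_def normal0_def)
  qed
  show "pd j (normal0 i) x = pd i (normal0 j) x" if "x \<in> N" for x i j
  proof -
    have z: "(x, t0) \<in> UNIV \<times> I" using t0_I by simp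
    have "pd j (normal0 i) x = dd (axis i 1, 0) (x, t0) (axis j 1, 0)" for i j
      unfolding normal0_def[abs_def] space_grad_def
      using pd_slice[OF d\<Phi>_has_derivative[OF z]] by simp
    then show ?thesis using dd_commute[OF z] by simp
  qed
qed

lemma shape_N: assumes "x \<in> N" shows "shape i j (x, t0) = a i j x"
proof -
  have "shape i j (x, t0) = pd j (\<lambda>x. unit_normal (x, t0) $ i) x"
    unfolding shape_def
    by (rule pd_slice[OF regular_has_derivative[OF Ck_unit_normal_nth N_regular[OF assms]], symmetric])
  also have "\<dots> = pd j (normal0 i) x"
    by (rule pd_cong[OF open_N Ck_slice[OF Ck_unit_normal_nth] assms unit_normal_N])
  finally show ?thesis by (simp add: a_def)
qed

lemma mean_curv_N: "x \<in> N \<Longrightarrow> mean_curv (x, t0) = h x"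
  by (simp add: mean_curv_def h_def shape_N)

lemma Gauss_curv_N: "x \<in> N \<Longrightarrow> Gauss_curv (x, t0) = g x"
  by (simp add: Gauss_curv_def g_def shape_N mean_curv_N)

text \<open>The time derivative of the gradient is minus the full gradient of \<open>speed\<close>.
  The norm in the denominator has a time derivative too, and this removes the normal
  component.\<close>

lemma unit_normal_time_derivative:
  assumes x: "x \<in> N"
  shows "frechet_derivative (\<lambda>z. unit_normal z $ i) (at (x, t0)) (0, 1) = - tg speed i x"
proof -
  let ?z = "(x, t0)"
  have z: "?z \<in> UNIV \<times> I" using t0_I by simp
  have zr: "?z \<in> regular" by (rule N_regular[OF x])
  define s where "s i z = frechet_derivative \<Phi> (at z) (axis i 1, 0)" for i z
  define m where "m z = norm (space_grad \<Phi> z)" for z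
  have ds: "(s i has_derivative dd (axis i 1, 0) ?z) (at ?z)" for i
    unfolding s_def[abs_def] by (rule d\<Phi>_has_derivative[OF z])
  have dm: "(m has_derivative frechet_derivative m (at ?z)) (at ?z)"
    by (rule regular_has_derivative[OF _ zr]) (simp add: m_def[abs_def] Ck_norm_grad del: Ck_on.simps)
  have m1: "m ?z = 1" using unit_grad[OF x] by (simp add: m_def)
  have s\<nu>: "s i ?z = normal0 i x" for i by (simp add: s_def normal0_def space_grad_def)
  have st: "dd (axis i 1, 0) ?z (0, 1) = - pd i speed x" for i
  proof -
    have "pd i speed x = - dd (0, 1) ?z (axis i 1, 0)"
      unfolding speed_def[abs_def]
      by (rule pd_eqI[OF has_derivative_minus[OF has_derivative_space_slice[OF d\<Phi>_has_derivative[OF z]]]])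
    then show ?thesis using dd_commute[OF z] by simp
  qed
  have "m z * m z = (\<Sum>k\<in>UNIV. s k z * s k z)" for z
    by (simp add: m_def s_def power2_norm_eq_inner[unfolded power2_eq_square] inner_vec_def space_grad_def)
  then have eq: "(\<lambda>z. m z * m z) = (\<lambda>z. \<Sum>k\<in>UNIV. s k z * s k z)" by auto
  have "((\<lambda>z. \<Sum>k\<in>UNIV. s k z * s k z) has_derivative
      (\<lambda>w. \<Sum>k\<in>UNIV. s k ?z * dd (axis k 1, 0) ?z w + dd (axis k 1, 0) ?z w * s k ?z)) (at ?z)"
    by (intro has_derivative_sum has_derivative_mult ds)
  moreover have "((\<lambda>z. m z * m z) has_derivative
      (\<lambda>w. m ?z * frechet_derivative m (at ?z) w + frechet_derivative m (at ?z) w * m ?z)) (at ?z)"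
    by (rule has_derivative_mult[OF dm dm])
  ultimately have "(\<lambda>w. \<Sum>k\<in>UNIV. s k ?z * dd (axis k 1, 0) ?z w + dd (axis k 1, 0) ?z w * s k ?z)
    = (\<lambda>w. m ?z * frechet_derivative m (at ?z) w + frechet_derivative m (at ?z) w * m ?z)"
    unfolding eq by (rule has_derivative_unique)
  from fun_cong[OF this, of "(0, 1)"]
  have mt: "frechet_derivative m (at ?z) (0, 1) = - (\<Sum>k\<in>UNIV. pd k speed x * normal0 k x)"
    by (simp add: m1 st s\<nu> sum_negf mult.commute sum_distrib_left[symmetric])
  have "((\<lambda>z. s i z / m z) has_derivative
      (\<lambda>w. (dd (axis i 1, 0) ?z w * m ?z - s i ?z * frechet_derivative m (at ?z) w) / (m ?z * m ?z))) (at ?z)"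
    by (rule has_derivative_divide'[OF ds dm]) (simp add: m1)
  moreover have "(\<lambda>z. unit_normal z $ i) = (\<lambda>z. s i z / m z)"
    by (simp add: unit_normal_def s_def m_def space_grad_def divide_inverse mult.commute fun_eq_iff)
  ultimately have "((\<lambda>z. unit_normal z $ i) has_derivative
      (\<lambda>w. (dd (axis i 1, 0) ?z w * m ?z - s i ?z * frechet_derivative m (at ?z) w) / (m ?z * m ?z))) (at ?z)"
    by simp
  from frechet_derivative_at[OF this, symmetric] show ?thesis
    by (simp add: m1 st s\<nu> mt tg_def mult.commute)
qed

lemma shape_time_derivative:
  assumes x: "x \<in> N"
  shows "frechet_derivative (shape i j) (at (x, t0)) (0, 1) = - pd j (tg speed i) x"
proof -
  have zr: "(x, t0) \<in> regular" by (rule N_regular[OF x])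
  define f where "f z = frechet_derivative (\<lambda>z. unit_normal z $ i) (at z) (0, 1)" for z
  have Cf: "Ck_on k regular f" for k
    unfolding f_def[abs_def] using Ck_unit_normal_nth[of "Suc k" i] by simp
  have Ct: "Ck_on k N (tg speed i)" for k by (rule Ck_tg[OF Ck_speed])
  have "frechet_derivative (shape i j) (at (x, t0)) (0, 1) = frechet_derivative f (at (x, t0)) (axis j 1, 0)"
    unfolding shape_def[abs_def] f_def[abs_def]
    by (rule frechet_derivative_commute[OF open_regular Ck_unit_normal_nth zr])
  also have "\<dots> = pd j (\<lambda>x. f (x, t0)) x"
    by (rule pd_slice[OF regular_has_derivative[OF Cf zr], symmetric])
  also have "\<dots> = pd j (\<lambda>x. - tg speed i x) x"
    by (rule pd_cong[OF open_N Ck_slice[OF Cf] x]) (simp add: f_def unit_normal_time_derivative)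
  also have "\<dots> = - pd j (tg speed i) x"
    by (rule pd_eqI[OF has_derivative_minus[OF Ck_on_1_has_derivative[OF Ct x]]])
  finally show ?thesis .
qed

lemma mean_curv_time_derivative:
  assumes x: "x \<in> N"
  shows "frechet_derivative mean_curv (at (x, t0)) (0, 1) = - lap speed x"
proof -
  have "(mean_curv has_derivative (\<lambda>w. \<Sum>i\<in>UNIV. frechet_derivative (shape i i) (at (x, t0)) w)) (at (x, t0))"
    unfolding mean_curv_def[abs_def]
    by (intro has_derivative_sum regular_has_derivative[OF Ck_shape N_regular[OF x]])
  from frechet_derivative_at[OF this, symmetric] show ?thesis
    by (simp add: shape_time_derivative[OF x] lap_def sum_negf)
qed

lemma Gauss_curv_time_derivative:
  assumes x: "x \<in> N"
  shows "frechet_derivative Gauss_curv (at (x, t0)) (0, 1) = hess_term speed x - h x * lap speed x"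
proof -
  let ?z = "(x, t0)"
  note z = N_regular[OF x]
  have "((\<lambda>z. (mean_curv z * mean_curv z - (\<Sum>i\<in>UNIV. \<Sum>j\<in>UNIV. shape i j z * shape j i z)) * (1 / 2)) has_derivative
     (\<lambda>w. ((mean_curv ?z * frechet_derivative mean_curv (at ?z) w + frechet_derivative mean_curv (at ?z) w * mean_curv ?z)
       - (\<Sum>i\<in>UNIV. \<Sum>j\<in>UNIV. shape i j ?z * frechet_derivative (shape j i) (at ?z) w
           + frechet_derivative (shape i j) (at ?z) w * shape j i ?z)) * (1 / 2))) (at ?z)"
    by (intro has_derivative_mult_left has_derivative_diff has_derivative_mult has_derivative_sum
        regular_has_derivative[OF Ck_shape z] regular_has_derivative[OF Ck_mean_curv z])
  then have "(Gauss_curv has_derivative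
     (\<lambda>w. ((mean_curv ?z * frechet_derivative mean_curv (at ?z) w + frechet_derivative mean_curv (at ?z) w * mean_curv ?z)
       - (\<Sum>i\<in>UNIV. \<Sum>j\<in>UNIV. shape i j ?z * frechet_derivative (shape j i) (at ?z) w
           + frechet_derivative (shape i j) (at ?z) w * shape j i ?z)) * (1 / 2))) (at ?z)"
    by (simp add: Gauss_curv_def[abs_def] power2_eq_square)
  from fun_cong[OF frechet_derivative_at[OF this], of "(0, 1)"]
  have "frechet_derivative Gauss_curv (at ?z) (0, 1) = (- 2 * (h x * lap speed x)
      + ((\<Sum>i\<in>UNIV. \<Sum>j\<in>UNIV. a i j x * pd i (tg speed j) x) + (\<Sum>i\<in>UNIV. \<Sum>j\<in>UNIV. pd j (tg speed i) x * a j i x))) * (1 / 2)"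
    by (simp add: mean_curv_time_derivative[OF x] shape_time_derivative[OF x] shape_N[OF x] mean_curv_N[OF x]
        sum.distrib sum_negf sum_subtractf)
  moreover have "(\<Sum>i\<in>UNIV. \<Sum>j\<in>UNIV. pd j (tg speed i) x * a j i x) = hess_term speed x"
    unfolding hess_term_def by (subst sum.swap) (simp add: mult.commute)
  ultimately show ?thesis by (simp add: hess_term_def)
qed

section \<open>The energy density and its variation\<close>

context
  fixes F :: "real \<Rightarrow> real \<Rightarrow> real"
  assumes F: "smooth_on UNIV (\<lambda>(h, g). F h g)"
begin

definition dF :: "real \<times> real \<Rightarrow> (real^3) \<times> real \<Rightarrow> real" where
  "dF w z = frechet_derivative (\<lambda>(h, g). F h g) (at (mean_curv z, Gauss_curv z)) w"

definition energy_density :: "(real^3) \<times> real \<Rightarrow> real" where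
  "energy_density z = F (mean_curv z) (Gauss_curv z)"

lemma Ck_curvs: "Ck_on k regular (\<lambda>z. (mean_curv z, Gauss_curv z))"
  by (rule Ck_on_Pair[OF open_regular Ck_mean_curv Ck_Gauss_curv])

lemma Ck_dF: "Ck_on k regular (dF w)"
  unfolding dF_def[abs_def]
  by (rule Ck_on_compose[OF open_regular open_UNIV subset_UNIV smooth_on_Ck[OF smooth_on_frechet_derivative[OF F]] Ck_curvs])

lemma Ck_energy_density: "Ck_on k regular energy_density"
  using Ck_on_compose[OF open_regular open_UNIV subset_UNIV smooth_on_Ck[OF F] Ck_curvs, of k]
  by (simp add: energy_density_def[abs_def])

lemma energy_density_derivative:
  assumes z: "z \<in> regular"
  shows "frechet_derivative energy_density (at z) w =
     dF (1, 0) z * frechet_derivative mean_curv (at z) w + dF (0, 1) z * frechet_derivative Gauss_curv (at z) w"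
proof -
  let ?y = "(mean_curv z, Gauss_curv z)"
  have dF: "((\<lambda>(h, g). F h g) has_derivative frechet_derivative (\<lambda>(h, g). F h g) (at ?y)) (at ?y)"
    by (rule smooth_on_has_derivative[OF F UNIV_I])
  interpret linear "frechet_derivative (\<lambda>(h, g). F h g) (at ?y)"
    using dF has_derivative_linear by blast
  have "((\<lambda>z. (mean_curv z, Gauss_curv z)) has_derivative
      (\<lambda>w. (frechet_derivative mean_curv (at z) w, frechet_derivative Gauss_curv (at z) w))) (at z)"
    by (intro has_derivative_Pair regular_has_derivative[OF Ck_mean_curv z] regular_has_derivative[OF Ck_Gauss_curv z])
  from has_derivative_compose[OF this dF]
  have "(energy_density has_derivative (\<lambda>w. frechet_derivative (\<lambda>(h, g). F h g) (at ?y)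
      (frechet_derivative mean_curv (at z) w, frechet_derivative Gauss_curv (at z) w))) (at z)"
    by (simp add: energy_density_def[abs_def])
  from frechet_derivative_at[OF this, symmetric]
  have "frechet_derivative energy_density (at z) w = frechet_derivative (\<lambda>(h, g). F h g) (at ?y)
      (frechet_derivative mean_curv (at z) w *\<^sub>R (1, 0) + frechet_derivative Gauss_curv (at z) w *\<^sub>R (0, 1))"
    by simp
  also have "\<dots> = dF (1, 0) z * frechet_derivative mean_curv (at z) w + dF (0, 1) z * frechet_derivative Gauss_curv (at z) w"
    unfolding add scaleR dF_def by simp
  finally show ?thesis .
qed

abbreviation "P0 \<equiv> \<lambda>x. dF (1, 0) (x, t0)"
abbreviation "Q0 \<equiv> \<lambda>x. dF (0, 1) (x, t0)"

definition variation_H :: "real^3 \<Rightarrow> real" where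
  "variation_H x = (energy_density (x, t0) * h x - P0 x * ((h x)\<^sup>2 - 2 * g x) - lap P0 x) * speed x"

definition variation_G :: "real^3 \<Rightarrow> real" where
  "variation_G x = (- Q0 x * g x * h x - h x * lap Q0 x + hess_term Q0 x) * speed x"

lemma Ck_P0: "Ck_on k N (\<lambda>x. dF w (x, t0))"
  by (rule Ck_slice[OF Ck_dF])

text \<open>The chain rule leaves \<open>speed\<close> under the operators \<open>lap\<close> and
  \<open>hess_term\<close>. Pointwise, \<open>Green_field\<close> moves them to \<open>P0\<close>
  and \<open>Q0\<close> at the price of the divergence of a tangential field, whose surface integral
  is zero.\<close>

lemma transport_rate_energy_density:
  assumes x: "x \<in> N"
  shows "transport_rate \<Phi> t0 energy_density x =
    variation_H x + variation_G x + divergence (Green_field speed P0 Q0) x"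
proof -
  let ?z = "(x, t0)" and ?f = "\<lambda>x. energy_density (x, t0)"
  note z = N_regular[OF x]
  have Cf: "Ck_on 1 N ?f" by (rule Ck_slice[OF Ck_energy_density])
  have f_t: "frechet_derivative energy_density (at ?z) (0, 1)
      = - P0 x * lap speed x + Q0 x * (hess_term speed x - h x * lap speed x)"
    unfolding energy_density_derivative[OF z] mean_curv_time_derivative[OF x] Gauss_curv_time_derivative[OF x] by simp
  have f_x: "pd i ?f x = P0 x * pd i h x + Q0 x * pd i g x" for i
  proof -
    have "pd i h x = pd i (\<lambda>x. mean_curv (x, t0)) x"
      by (rule pd_cong[OF open_N Ck_h x]) (simp add: mean_curv_N)
    moreover have "pd i g x = pd i (\<lambda>x. Gauss_curv (x, t0)) x"
      by (rule pd_cong[OF open_N Ck_g x]) (simp add: Gauss_curv_N)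
    ultimately show ?thesis
      by (simp add: pd_slice[OF regular_has_derivative[OF Ck_energy_density z]] energy_density_derivative[OF z]
          pd_slice[OF regular_has_derivative[OF Ck_mean_curv z]] pd_slice[OF regular_has_derivative[OF Ck_Gauss_curv z]])
  qed
  have Csg: "Ck_on 1 N (\<lambda>x. space_grad \<Phi> (x, t0))"
    by (rule Ck_on_subset[OF Ck_on_space_slice[OF open_space_time Ck_space_grad] N_slice(1)])
  have "divergence (\<lambda>x. ?f x *\<^sub>R space_grad \<Phi> (x, t0)) x = (\<Sum>i\<in>UNIV. pd i (\<lambda>x. ?f x * normal0 i x) x)"
    unfolding divergence_eq_sum_pd[OF Ck_on_scaleR[OF open_N Cf Csg] x] by (simp add: normal0_def[abs_def])
  also have "\<dots> = (\<Sum>i\<in>UNIV. pd i ?f x * normal0 i x) + ?f x * h x"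
    by (simp add: divergence_scale[OF x Cf Ck_\<nu>] h_def a_def)
  also have "(\<Sum>i\<in>UNIV. pd i ?f x * normal0 i x)
      = P0 x * (\<Sum>i\<in>UNIV. normal0 i x * pd i h x) + Q0 x * (\<Sum>i\<in>UNIV. normal0 i x * pd i g x)"
    unfolding f_x sum_distrib_left sum.distrib[symmetric] by (intro sum.cong) (auto simp: algebra_simps)
  finally have div: "divergence (\<lambda>x. ?f x *\<^sub>R space_grad \<Phi> (x, t0)) x
      = - P0 x * ((h x)\<^sup>2 - 2 * g x) - Q0 x * g x * h x + ?f x * h x"
    by (simp add: normal_derivative_h[OF x] normal_derivative_g[OF x] algebra_simps)
  have "transport_rate \<Phi> t0 energy_density x = (- P0 x * lap speed x + Q0 x * (hess_term speed x - h x * lap speed x))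
      + speed x * (- P0 x * ((h x)\<^sup>2 - 2 * g x) - Q0 x * g x * h x + ?f x * h x)"
    unfolding transport_rate_def f_t div by (simp add: speed_def)
  then show ?thesis
    unfolding Green_field(3)[OF Ck_speed Ck_P0 Ck_P0 x] variation_H_def variation_G_def
    by (simp add: algebra_simps)
qed

lemma continuous_variation:
  "continuous_on N variation_H" "continuous_on N variation_G"
proof -
  have CP: "Ck_on 1 N (tg (\<lambda>x. dF w (x, t0)) i)" for w i by (rule Ck_tg[OF Ck_P0])
  have pc: "continuous_on N (\<lambda>x. pd j (tg (\<lambda>x. dF w (x, t0)) i) x)" for w i j
    using Ck_on_pd[of 0 N] CP by simp
  have lap: "continuous_on N (lap (\<lambda>x. dF w (x, t0)))" for w
    unfolding lap_def[abs_def] by (intro continuous_on_sum pc)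
  have hess: "continuous_on N (hess_term (\<lambda>x. dF w (x, t0)))" for w
    unfolding hess_term_def[abs_def] by (intro continuous_on_sum continuous_on_mult pc Ck_on_continuous[OF Ck_a])
  note cont = lap hess Ck_on_continuous[OF Ck_slice[OF Ck_energy_density]] Ck_on_continuous[OF Ck_h]
    Ck_on_continuous[OF Ck_g] Ck_on_continuous[OF Ck_P0] Ck_on_continuous[OF Ck_speed]
  show "continuous_on N variation_H" "continuous_on N variation_G"
    unfolding variation_H_def[abs_def] variation_G_def[abs_def]
    by (intro continuous_on_mult continuous_on_diff continuous_on_add continuous_on_minus continuous_on_power
        continuous_on_const cont)+
qed

theorem energy_first_variation:
  "((\<lambda>t. surface_integral (\<Gamma> t) (\<lambda>x. energy_density (x, t))) has_real_derivative
     surface_integral (\<Gamma> t0) variation_H + surface_integral (\<Gamma> t0) variation_G) (at t0)"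
proof -
  have tangential: "Green_field speed P0 Q0 x \<bullet> space_grad \<Phi> (x, t0) = 0" if "x \<in> N" for x
    using Green_field(2)[OF Ck_speed Ck_P0 Ck_P0 that] by (simp add: inner_vec_def normal0_def)
  note dv = surface_integral_divergence[OF Green_field(1)[OF Ck_speed Ck_P0 Ck_P0] tangential]
  have iH: "set_integrable (surface_measure (\<Gamma> t0)) (\<Gamma> t0) variation_H"
    and iG: "set_integrable (surface_measure (\<Gamma> t0)) (\<Gamma> t0) variation_G"
    using continuous_variation level_set_N by (blast intro: set_integrable_level_set continuous_on_subset)+
  have "surface_integral (\<Gamma> t0) (transport_rate \<Phi> t0 energy_density) =
      surface_integral (\<Gamma> t0) (\<lambda>x. variation_H x + variation_G x + divergence (Green_field speed P0 Q0) x)"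
    by (rule surface_integral_cong) (use level_set_N in \<open>auto simp: transport_rate_energy_density\<close>)
  also have "\<dots> = surface_integral (\<Gamma> t0) variation_H + surface_integral (\<Gamma> t0) variation_G"
    using set_integral_add(2)[OF set_integral_add(1)[OF iH iG] dv(1)] set_integral_add(2)[OF iH iG] dv(2)
    by (simp add: surface_integral_def)
  finally show ?thesis
    using surface_integral_transport(1)[OF open_regular Ck_energy_density] N_regular level_set_N by auto
qed

end

end

section \<open>Translation into the terms of the theorem\<close>

theorem mainTheorem3:
  fixes I :: "real set"
    and \<phi> :: "real^3 \<Rightarrow> real \<Rightarrow> real"
    and u :: "real^3 \<Rightarrow> real \<Rightarrow> real^3"
    and F :: "real \<Rightarrow> real \<Rightarrow> real"
    and \<Gamma> :: "real \<Rightarrow> (real^3) set"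
    and n :: "real \<Rightarrow> real^3 \<Rightarrow> real^3"
    and H G F\<^sub>H F\<^sub>G :: "real \<Rightarrow> real^3 \<Rightarrow> real"
    and J :: "real \<Rightarrow> real"
    and t\<^sub>0 :: real
  assumes "open I" and "is_interval I"
    and "smooth_on (UNIV \<times> I) (\<lambda>(x, t). \<phi> x t)"
    and "smooth_on (UNIV \<times> I) (\<lambda>(x, t). u x t)"
    and transport: "\<And>x t. t \<in> I \<Longrightarrow> deriv (\<phi> x) t + u x t \<bullet> grad (\<lambda>y. \<phi> y t) x = 0"
    and level_set: "\<And>t. \<Gamma> t = {x. \<phi> x t = 0}"
    and "\<And>t. t \<in> I \<Longrightarrow> closed_surface (\<Gamma> t)"
    and "\<exists>K. compact K \<and> (\<forall>t\<in>I. \<Gamma> t \<subseteq> K)"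
    and "\<And>t. t \<in> I \<Longrightarrow>
           \<exists>N. open N \<and> \<Gamma> t \<subseteq> N \<and> (\<forall>x\<in>N. norm (grad (\<lambda>y. \<phi> y t) x) > 0)"
    and same_topology: "\<And>s t. s \<in> I \<Longrightarrow> t \<in> I \<Longrightarrow> \<Gamma> s homeomorphic \<Gamma> t"
    and normal: "\<And>t x. n t x = grad (\<lambda>y. \<phi> y t) x /\<^sub>R norm (grad (\<lambda>y. \<phi> y t) x)"
    and mean_curvature: "\<And>t x. H t x = divergence (n t) x"
    and Gauss_curvature: "\<And>t x. G t x = trace (cofactor_matrix (jacobian (n t) (at x)))"
    and "smooth_on UNIV (\<lambda>(h, g). F h g)"
    and "\<And>t x. F\<^sub>H t x = deriv (\<lambda>h. F h (G t x)) (H t x)"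
    and "\<And>t x. F\<^sub>G t x = deriv (\<lambda>g. F (H t x) g) (G t x)"
    and energy: "\<And>t. J t = surface_integral (\<Gamma> t) (\<lambda>x. F (H t x) (G t x))"
    and "t\<^sub>0 \<in> I"
    and distance_function:
      "\<exists>N. open N \<and> \<Gamma> t\<^sub>0 \<subseteq> N \<and> (\<forall>x\<in>N. norm (grad (\<lambda>y. \<phi> y t\<^sub>0) x) = 1)"
  shows "(J has_real_derivative
           surface_integral (\<Gamma> t\<^sub>0) (\<lambda>x.
             (F (H t\<^sub>0 x) (G t\<^sub>0 x) * H t\<^sub>0 x
               - F\<^sub>H t\<^sub>0 x * ((H t\<^sub>0 x)\<^sup>2 - 2 * G t\<^sub>0 x)
               - laplace_beltrami (n t\<^sub>0) (F\<^sub>H t\<^sub>0) x) * (u x t\<^sub>0 \<bullet> n t\<^sub>0 x))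
         + surface_integral (\<Gamma> t\<^sub>0) (\<lambda>x.
             (- F\<^sub>G t\<^sub>0 x * G t\<^sub>0 x * H t\<^sub>0 x
               - H t\<^sub>0 x * laplace_beltrami (n t\<^sub>0) (F\<^sub>G t\<^sub>0) x
               + tan_jacobian (n t\<^sub>0) (n t\<^sub>0) x
                   \<bullet> tan_jacobian (n t\<^sub>0) (tan_grad (n t\<^sub>0) (F\<^sub>G t\<^sub>0)) x)
             * (u x t\<^sub>0 \<bullet> n t\<^sub>0 x)))
         (at t\<^sub>0)"
proof -
  define \<Phi> where "\<Phi> = (\<lambda>(x, t). \<phi> x t)"
  have \<Phi>: "\<Phi> (x, t) = \<phi> x t" for x t by (simp add: \<Phi>_def)
  have smooth_\<Phi>: "smooth_on (UNIV \<times> I) \<Phi>" unfolding \<Phi>_def by fact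
  have \<Gamma>: "\<Gamma> t = {x. \<Phi> (x, t) = 0}" for t by (simp add: level_set \<Phi>)
  obtain K where K: "compact K" "\<And>t. t \<in> I \<Longrightarrow> \<Gamma> t \<subseteq> K" using assms(8) by blast
  obtain N where N: "open N" "\<Gamma> t\<^sub>0 \<subseteq> N" "\<And>x. x \<in> N \<Longrightarrow> norm (grad (\<lambda>y. \<phi> y t\<^sub>0) x) = 1"
    using distance_function by blast
  have d\<Phi>: "(\<Phi> has_derivative frechet_derivative \<Phi> (at (x, t))) (at (x, t))" if "t \<in> I" for x t
    using smooth_on_has_derivative[OF smooth_\<Phi>] that by blast
  have grad: "grad (\<lambda>y. \<phi> y t) x = space_grad \<Phi> (x, t)" if "t \<in> I" for x t
  proof -
    have "(\<lambda>y. \<phi> y t) = (\<lambda>y. \<Phi> (y, t))" by (simp add: \<Phi>)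
    then show ?thesis
      using pd_slice[OF d\<Phi>[OF that]] by (simp add: grad_def space_grad_def)
  qed
  have locale_assms: "moving_level_set \<Phi> I t\<^sub>0 K N"
  proof
    show "{x. \<Phi> (x, t) = 0} \<subseteq> K" if "t \<in> I" for t using K(2)[OF that] by (simp add: \<Gamma>)
    show "norm (space_grad \<Phi> (x, t\<^sub>0)) = 1" if "x \<in> N" for x
      using N(3)[OF that] by (simp add: grad \<open>t\<^sub>0 \<in> I\<close>)
  qed (use K N \<open>open I\<close> \<open>t\<^sub>0 \<in> I\<close> smooth_\<Phi> in \<open>auto simp: \<Gamma>\<close>)
  interpret M: moving_level_set \<Phi> I "t\<^sub>0" K N by (rule locale_assms)
  have n: "n t = (\<lambda>x. M.unit_normal (x, t))" if "t \<in> I" for t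
    by (simp add: fun_eq_iff normal grad[OF that] M.unit_normal_def)
  have HG: "H t x = M.mean_curv (x, t)" "G t x = M.Gauss_curv (x, t)" if "(x, t) \<in> M.regular" for x t
  proof -
    have "t \<in> I" using that M.regular_subset by auto
    then show "H t x = M.mean_curv (x, t)" "G t x = M.Gauss_curv (x, t)"
      using M.divergence_unit_normal[OF that] M.trace_cofactor_unit_normal[OF that]
      by (simp_all add: mean_curvature Gauss_curvature n)
  qed
  \<comment> \<open>The gradient is nonzero along every surface, so \<open>J\<close> agrees with the
    energy of the locale at all times in \<open>I\<close> and not just at \<open>t\<^sub>0\<close>;
    the derivative depends on this.\<close>
  have regular: "(x, t) \<in> M.regular" if t: "t \<in> I" and x: "x \<in> \<Gamma> t" for x t
  proof -
    have "norm (space_grad \<Phi> (x, t)) > 0" using assms(9)[OF t] x by (auto simp: grad[OF t])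
    then show ?thesis using t by (auto simp: M.regular_def)
  qed
  note F = \<open>smooth_on UNIV (\<lambda>(h, g). F h g)\<close>
  have J: "surface_integral {x. \<Phi> (x, t) = 0} (\<lambda>x. M.energy_density F (x, t)) = J t" if t: "t \<in> I" for t
    unfolding energy \<Gamma>[symmetric]
    by (rule surface_integral_cong) (simp add: HG regular[OF t] M.energy_density_def[OF F])
  have partial:
    "deriv (\<lambda>h. F h c) b = frechet_derivative (\<lambda>(h, g). F h g) (at (b, c)) (1, 0)"
    "deriv (\<lambda>g. F b g) c = frechet_derivative (\<lambda>(h, g). F h g) (at (b, c)) (0, 1)" for b c
  proof -
    let ?D = "frechet_derivative (\<lambda>(h, g). F h g) (at (b, c))"
    have dF: "((\<lambda>(h, g). F h g) has_derivative ?D) (at (b, c))"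
      by (rule smooth_on_has_derivative[OF F UNIV_I])
    interpret linear ?D using dF has_derivative_linear by blast
    have "s * ?D (1, 0) = ?D (s, 0)" "s * ?D (0, 1) = ?D (0, s)" for s
      using scaleR[of s "(1, 0)"] scaleR[of s "(0, 1)"] by simp_all
    then have "((\<lambda>h. F h c) has_real_derivative ?D (1, 0)) (at b)"
      "((\<lambda>g. F b g) has_real_derivative ?D (0, 1)) (at c)"
      using has_derivative_space_slice[OF dF] has_derivative_time_slice[OF dF]
      by (auto intro!: has_derivative_imp_has_field_derivative)
    then show "deriv (\<lambda>h. F h c) b = ?D (1, 0)" "deriv (\<lambda>g. F b g) c = ?D (0, 1)"
      by (auto intro: DERIV_imp_deriv)
  qed
  \<comment> \<open>These equations are established on all of \<open>N\<close>, because the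
    Laplace-Beltrami operator differentiates \<open>F\<^sub>H\<close> and \<open>F\<^sub>G\<close>
    in the surrounding space.\<close>
  have FHG: "F\<^sub>H t\<^sub>0 x = M.dF F (1, 0) (x, t\<^sub>0)" "F\<^sub>G t\<^sub>0 x = M.dF F (0, 1) (x, t\<^sub>0)" if "x \<in> N" for x
    using HG[OF M.N_regular[OF that]] by (simp_all add: assms(15,16) partial M.dF_def[OF F])
  have n0: "n t\<^sub>0 x $ i = M.normal0 i x" if "x \<in> N" for x i
    using M.unit_normal_N[OF that] by (simp add: n \<open>t\<^sub>0 \<in> I\<close>)
  \<comment> \<open>Where |grad \<phi>| = 1 the normal is the gradient itself, so the transport
    equation identifies the inner product of \<open>u\<close> and the normal with minus the time
    derivative of \<phi>.\<close>
  have speed: "u x t\<^sub>0 \<bullet> n t\<^sub>0 x = M.speed x" if x: "x \<in> N" for x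
  proof -
    interpret linear "frechet_derivative \<Phi> (at (x, t\<^sub>0))"
      using d\<Phi>[OF \<open>t\<^sub>0 \<in> I\<close>] has_derivative_linear by blast
    have "s * frechet_derivative \<Phi> (at (x, t\<^sub>0)) (0, 1) = frechet_derivative \<Phi> (at (x, t\<^sub>0)) (0, s)" for s
      using scaleR[of s "(0, 1)"] by simp
    then have "(\<phi> x has_real_derivative frechet_derivative \<Phi> (at (x, t\<^sub>0)) (0, 1)) (at t\<^sub>0)"
      using has_derivative_time_slice[OF d\<Phi>[OF \<open>t\<^sub>0 \<in> I\<close>, of x]]
      by (auto intro!: has_derivative_imp_has_field_derivative simp: \<Phi>)
    then have "deriv (\<phi> x) t\<^sub>0 = frechet_derivative \<Phi> (at (x, t\<^sub>0)) (0, 1)"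
      by (rule DERIV_imp_deriv)
    moreover have "n t\<^sub>0 x = grad (\<lambda>y. \<phi> y t\<^sub>0) x"
      by (simp add: normal N(3)[OF x])
    ultimately show ?thesis
      using transport[OF \<open>t\<^sub>0 \<in> I\<close>, of x] by (simp add: M.speed_def)
  qed
  have eqH: "(F (H t\<^sub>0 x) (G t\<^sub>0 x) * H t\<^sub>0 x - F\<^sub>H t\<^sub>0 x * ((H t\<^sub>0 x)\<^sup>2 - 2 * G t\<^sub>0 x)
        - laplace_beltrami (n t\<^sub>0) (F\<^sub>H t\<^sub>0) x) * (u x t\<^sub>0 \<bullet> n t\<^sub>0 x) = M.variation_H F x"
    and eqG: "(- F\<^sub>G t\<^sub>0 x * G t\<^sub>0 x * H t\<^sub>0 x - H t\<^sub>0 x * laplace_beltrami (n t\<^sub>0) (F\<^sub>G t\<^sub>0) x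
         + tan_jacobian (n t\<^sub>0) (n t\<^sub>0) x \<bullet> tan_jacobian (n t\<^sub>0) (tan_grad (n t\<^sub>0) (F\<^sub>G t\<^sub>0)) x)
         * (u x t\<^sub>0 \<bullet> n t\<^sub>0 x) = M.variation_G F x" if "x \<in> \<Gamma> t\<^sub>0" for x
  proof -
    have x: "x \<in> N" using that N(2) by auto
    note z = M.N_regular[OF x]
    note [simp] = HG[OF z] FHG[OF x] speed[OF x] M.mean_curv_N[OF x] M.Gauss_curv_N[OF x]
      M.laplace_beltrami_eq_lap[OF n0 M.Ck_P0[OF F] FHG(1) x]
      M.laplace_beltrami_eq_lap[OF n0 M.Ck_P0[OF F] FHG(2) x]
      M.tan_jacobian_inner_eq_hess_term[OF n0 M.Ck_P0[OF F] FHG(2) x]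
    show "(F (H t\<^sub>0 x) (G t\<^sub>0 x) * H t\<^sub>0 x - F\<^sub>H t\<^sub>0 x * ((H t\<^sub>0 x)\<^sup>2 - 2 * G t\<^sub>0 x)
        - laplace_beltrami (n t\<^sub>0) (F\<^sub>H t\<^sub>0) x) * (u x t\<^sub>0 \<bullet> n t\<^sub>0 x) = M.variation_H F x"
      by (simp add: M.variation_H_def[OF F] M.energy_density_def[OF F])
    show "(- F\<^sub>G t\<^sub>0 x * G t\<^sub>0 x * H t\<^sub>0 x - H t\<^sub>0 x * laplace_beltrami (n t\<^sub>0) (F\<^sub>G t\<^sub>0) x
         + tan_jacobian (n t\<^sub>0) (n t\<^sub>0) x \<bullet> tan_jacobian (n t\<^sub>0) (tan_grad (n t\<^sub>0) (F\<^sub>G t\<^sub>0)) x)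
         * (u x t\<^sub>0 \<bullet> n t\<^sub>0 x) = M.variation_G F x"
      by (simp add: M.variation_G_def[OF F])
  qed
  have "(J has_real_derivative surface_integral {x. \<Phi> (x, t\<^sub>0) = 0} (M.variation_H F)
      + surface_integral {x. \<Phi> (x, t\<^sub>0) = 0} (M.variation_G F)) (at t\<^sub>0)"
    by (rule has_field_derivative_transform_within_open[OF M.energy_first_variation[OF F]
          \<open>open I\<close> \<open>t\<^sub>0 \<in> I\<close> J])
  moreover have "surface_integral (\<Gamma> t\<^sub>0) (\<lambda>x.
        (F (H t\<^sub>0 x) (G t\<^sub>0 x) * H t\<^sub>0 x - F\<^sub>H t\<^sub>0 x * ((H t\<^sub>0 x)\<^sup>2 - 2 * G t\<^sub>0 x)
          - laplace_beltrami (n t\<^sub>0) (F\<^sub>H t\<^sub>0) x) * (u x t\<^sub>0 \<bullet> n t\<^sub>0 x))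
      = surface_integral (\<Gamma> t\<^sub>0) (M.variation_H F)"
    by (rule surface_integral_cong) (rule eqH)
  moreover have "surface_integral (\<Gamma> t\<^sub>0) (\<lambda>x.
        (- F\<^sub>G t\<^sub>0 x * G t\<^sub>0 x * H t\<^sub>0 x - H t\<^sub>0 x * laplace_beltrami (n t\<^sub>0) (F\<^sub>G t\<^sub>0) x
          + tan_jacobian (n t\<^sub>0) (n t\<^sub>0) x \<bullet> tan_jacobian (n t\<^sub>0) (tan_grad (n t\<^sub>0) (F\<^sub>G t\<^sub>0)) x)
          * (u x t\<^sub>0 \<bullet> n t\<^sub>0 x))
      = surface_integral (\<Gamma> t\<^sub>0) (M.variation_G F)"
    by (rule surface_integral_cong) (rule eqG)
  ultimately show ?thesis by (simp only: \<Gamma>[symmetric])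
qed

end
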